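(* Suppose that $k=k(n)$ satisfies $n - k \sim c \sqrt{n}$ as $n\to\infty$ for a constant $c>0$, and fix $\alpha > 0$. The probability that the forest induced by the vertices with labels in $[k]$ of a uniformly random labeled tree $T_n$ with $n$ vertices contains a connected component with at least $\alpha n$ vertices tends to $$\sum_{j \geq 1} \frac{(-1)^{j-1} c^j}{(2\pi)^{j/2}} \int\cdots\int_{\substack{\alpha \leq t_1 < \cdots < t_j \\ \tau_j = t_1 + \cdots + t_j < 1}} \ \prod_{i=1}^j t_i^{-3/2}\, (1-\tau_j)^{-3/2} \exp \Big( - \frac{c^2\tau_j}{2 (1-\tau_j)} \Big) \,dt_1 \cdots dt_j$$ as $n \to \infty$.
   Context: $[k]=\{1,\dots,k\}$. A labeled tree with $n$ vertices is an (unrooted) tree with vertex set $[n]$. In the $j$-th summand, $\tau_j=t_1+\cdots+t_j$, and the factor $(1-\tau_j)^{-3/2}$ and the exponential appear once (not inside the product over $i$). The domain of integration is empty when $j\alpha\ge 1$, so the sum has only finitely many nonzero terms. *)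

theory Defs
  imports "HOL-Probability.Probability" "HOL-Library.Landau_Symbols"
begin

text \<open>
  A finite simple graph is given by its vertex set \<open>V\<close> and its set \<open>E\<close> of edges, each edge being a
  two-element subset of \<open>V\<close>. The digraph-based trees of the AFP entry \<open>Graph_Theory\<close> do not fit here:
  an undirected edge encoded as a pair of opposite arcs is already a cycle there.
\<close>

definition simple_graph :: "'a set \<Rightarrow> 'a set set \<Rightarrow> bool" where
  "simple_graph V E \<longleftrightarrow> finite V \<and> (\<forall>e\<in>E. e \<subseteq> V \<and> card e = 2)"

definition adj_rel :: "'a set set \<Rightarrow> ('a \<times> 'a) set" where
  "adj_rel E = {(u, v). u \<noteq> v \<and> {u, v} \<in> E}"

definition connected_graph :: "'a set \<Rightarrow> 'a set set \<Rightarrow> bool" where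
  "connected_graph V E \<longleftrightarrow> V \<noteq> {} \<and> (\<forall>u\<in>V. \<forall>v\<in>V. (u, v) \<in> (adj_rel E)\<^sup>*)"

definition is_cycle :: "'a set set \<Rightarrow> 'a list \<Rightarrow> bool" where
  "is_cycle E xs \<longleftrightarrow> length xs \<ge> 3 \<and> distinct xs \<and>
     (\<forall>i<length xs. {xs ! i, xs ! ((i + 1) mod length xs)} \<in> E)"

definition is_tree :: "'a set \<Rightarrow> 'a set set \<Rightarrow> bool" where
  "is_tree V E \<longleftrightarrow> simple_graph V E \<and> connected_graph V E \<and> (\<nexists>xs. is_cycle E xs)"

definition labeled_trees :: "nat \<Rightarrow> nat set set set" where
  "labeled_trees n = {E. is_tree {1..n} E}"

definition induced_edges :: "'a set \<Rightarrow> 'a set set \<Rightarrow> 'a set set" where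
  "induced_edges A E = {e \<in> E. e \<subseteq> A}"

definition graph_components :: "'a set \<Rightarrow> 'a set set \<Rightarrow> 'a set set" where
  "graph_components V E = {C. \<exists>u\<in>V. C = {v \<in> V. (u, v) \<in> (adj_rel E)\<^sup>*}}"

text \<open>For \<open>k > n\<close> the labels in \<open>{n+1..k}\<close> are not vertices, hence the intersection with \<open>{1..n}\<close>.\<close>

definition has_large_component :: "real \<Rightarrow> nat \<Rightarrow> nat \<Rightarrow> nat set set \<Rightarrow> bool" where
  "has_large_component \<alpha> n k E \<longleftrightarrow>
     (\<exists>C \<in> graph_components ({1..k} \<inter> {1..n}) (induced_edges {1..k} E).
        real (card C) \<ge> \<alpha> * real n)"

text \<open>The uniform distribution below is meaningful for \<open>n \<ge> 1\<close>; \<open>pmf_of_set\<close> of the empty set, which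
  occurs for \<open>n = 0\<close>, is unspecified.\<close>

definition prob_large_component :: "real \<Rightarrow> nat \<Rightarrow> nat \<Rightarrow> real" where
  "prob_large_component \<alpha> n k =
     measure_pmf.prob (pmf_of_set (labeled_trees n)) {E. has_large_component \<alpha> n k E}"

text \<open>A point \<open>(t\<^sub>1, \<dots>, t\<^sub>j)\<close> of \<open>\<real>\<^sup>j\<close> is a function in \<open>{1..j} \<rightarrow>\<^sub>E UNIV\<close>, and integration is with
  respect to the \<open>j\<close>-fold product of Lebesgue measure.\<close>

definition integration_domain :: "real \<Rightarrow> nat \<Rightarrow> (nat \<Rightarrow> real) set" where
  "integration_domain \<alpha> j = {t \<in> {1..j} \<rightarrow>\<^sub>E UNIV.
     \<alpha> \<le> t 1 \<and> (\<forall>i\<in>{1..<j}. t i < t (i + 1)) \<and> (\<Sum>i=1..j. t i) < 1}"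

lemma finite_labeled_trees: "finite (labeled_trees n)"
proof (rule finite_subset)
  show "labeled_trees n \<subseteq> Pow (Pow {1..n})"
    by (auto simp: labeled_trees_def is_tree_def simple_graph_def)
qed auto

lemma labeled_trees_nonempty:
  assumes "n \<ge> 1"
  shows "labeled_trees n \<noteq> {}"
proof -
  define E where "E = {{1, v} | v. v \<in> {2..n}}"
  have sym: "(u, v) \<in> adj_rel E \<Longrightarrow> (v, u) \<in> adj_rel E" for u v
    by (auto simp: adj_rel_def insert_commute)
  have to1: "(1, v) \<in> (adj_rel E)\<^sup>*" if "v \<in> {1..n}" for v
  proof (cases "v = 1")
    case False
    then have "(1, v) \<in> adj_rel E" using that by (auto simp: adj_rel_def E_def)
    then show ?thesis by blast
  qed auto
  have from1: "(v, 1) \<in> (adj_rel E)\<^sup>*" if "v \<in> {1..n}" for v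
  proof (cases "v = 1")
    case False
    then have "(1, v) \<in> adj_rel E" using that by (auto simp: adj_rel_def E_def)
    then show ?thesis using sym by blast
  qed auto
  have "(u, v) \<in> (adj_rel E)\<^sup>*" if "u \<in> {1..n}" "v \<in> {1..n}" for u v
    using from1[OF that(1)] to1[OF that(2)] by (rule rtrancl_trans)
  then have "connected_graph {1..n} E"
    using assms by (simp add: connected_graph_def)
  moreover have "simple_graph {1..n} E"
    using assms by (auto simp: simple_graph_def E_def)
  moreover have "\<not> is_cycle E xs" for xs
  proof
    assume c: "is_cycle E xs"
    then have len: "length xs \<ge> 3" and dist: "distinct xs"
      and edge: "\<And>i. i < length xs \<Longrightarrow> {xs ! i, xs ! ((i + 1) mod length xs)} \<in> E"
      by (auto simp: is_cycle_def)
    have one: "e \<in> E \<Longrightarrow> 1 \<in> e" for e by (auto simp: E_def)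
    have pos: "0 < length xs" using len by linarith
    have m: "(0 + 1) mod length xs = 1" "(1 + 1) mod length xs = 2" "(length xs - 1 + 1) mod length xs = 0"
      and l: "0 < length xs" "1 < length xs" "length xs - 1 < length xs"
      using len pos by simp_all
    have a: "1 \<in> {xs ! 0, xs ! 1}" using one[OF edge[OF l(1)]] unfolding m .
    have b: "1 \<in> {xs ! 1, xs ! 2}" using one[OF edge[OF l(2)]] unfolding m .
    have d: "1 \<in> {xs ! (length xs - 1), xs ! 0}" using one[OF edge[OF l(3)]] unfolding m .
    have ne: "xs ! i \<noteq> xs ! j" if "i < length xs" "j < length xs" "i \<noteq> j" for i j
      using that dist by (simp add: nth_eq_iff_index_eq)
    show False
    proof (cases "xs ! 0 = 1")
      case True
      then show False using b ne[of 0 1] ne[of 0 2] len pos by auto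
    next
      case False
      then have "xs ! 1 = 1" "xs ! (length xs - 1) = 1" using a d by simp_all
      moreover have "xs ! 1 \<noteq> xs ! (length xs - 1)" using len by (intro ne) simp_all
      ultimately show False by simp
    qed
  qed
  ultimately have "E \<in> labeled_trees n" by (simp add: labeled_trees_def is_tree_def)
  then show ?thesis by blast
qed

end

theory Submission
  imports Defs "HOL-Real_Asymp.Real_Asymp"
begin

text \<open>
Call the vertices \<open>k + 1, \<dots>, n\<close> outer, and let \<open>m = n - k\<close> be their number. The proof rests on an
exact count. If \<open>S\<^sub>1, \<dots>, S\<^sub>j\<close> are disjoint nonempty sets of inner vertices with sizes \<open>s\<^sub>i\<close> and
total size \<open>s\<close>, then the number of trees in which every \<open>S\<^sub>i\<close> is a component of the inner forest
is \<open>(\<Prod>i. m * s\<^sub>i ^ (s\<^sub>i - 1)) * (n - s) ^ (k - s - 1) * n ^ (m - 1)\<close>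
(\<open>card_trees_with_components\<close>; the case \<open>j = 0\<close> is Cayley's formula). To see this, root the tree
at an outer vertex, so that it becomes an acyclic parent function. Build that function in layers:
each \<open>S\<^sub>i\<close> is a rooted tree whose root has an outer parent, the other inner vertices choose
parents outside the \<open>S\<^sub>i\<close>, and finally the outer vertices choose parents among all vertices. Each
layer is counted by one lemma (\<open>card_forest_extensions\<close>): a vertex that receives a parent in \<open>X\<close>
must avoid its own tree, and when \<open>i\<close> vertices have been treated before, the choices lost in this
way add up, over all forests built so far, to \<open>|X| ^ i\<close> times the size that this tree had at the
beginning.

Multiplying by the number of choices of the sets \<open>S\<^sub>i\<close> gives the expected number of tuples of
components with given sizes (\<open>expected_tuples_eq\<close>). By Stirling's formula, \<open>n ^ j\<close> times this
expectation converges, when \<open>s\<^sub>i / n \<rightarrow> t\<^sub>i\<close>, to the integrand of the \<open>j\<close>-th summand times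
\<open>c ^ j / (2 * pi) powr (j / 2)\<close>. It is also bounded uniformly in all sizes \<open>s\<^sub>i \<ge> \<alpha> * n\<close>
(\<open>scaled_expected_tuples_bounded\<close>); here the factor \<open>exp (- m\<^sup>2 / (2 * (n - s)))\<close> beats the
negative powers of \<open>n - s\<close>. The expected number of tuples with increasing sizes at least \<open>\<alpha> * n\<close>
is the integral of a step function on cubes of side \<open>1 / n\<close>, so dominated convergence yields the
\<open>j\<close>-th integral (\<open>sum_expected_tuples_tendsto\<close>).

There are at most \<open>1 / \<alpha>\<close> large components. If their sizes are distinct, then each \<open>j\<close>-subset of
them has exactly one increasing enumeration, and inclusion-exclusion expresses the indicator of
the existence of a large component as the alternating sum of the numbers of increasing tuples. If
two large components have the same size, the two sides differ by a bounded amount, and the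
expected number of such pairs is \<open>O(1/n)\<close> (\<open>prob_large_component_approx\<close>,
\<open>tied_pairs_negligible\<close>).
\<close>

section \<open>Counting acyclic parent functions\<close>

text \<open>
Edges are directed from a vertex to its parent; the roots are the vertices outside \<open>A\<close>.
\<close>

definition parent_rel :: "'a set \<Rightarrow> ('a \<Rightarrow> 'a) \<Rightarrow> ('a \<times> 'a) set" where
  "parent_rel A f = (\<lambda>v. (v, f v)) ` A"

definition descendants :: "('a \<times> 'a) set \<Rightarrow> 'a set \<Rightarrow> 'a \<Rightarrow> 'a set" where
  "descendants r X b = {x \<in> X. (x, b) \<in> r\<^sup>*}"

text \<open>
The relation \<open>r\<close> is the part of the forest that is already built. The vertices in \<open>A\<close> have no
parent yet and receive one in \<open>X\<close>.
\<close>

definition forest_extensions :: "('a \<times> 'a) set \<Rightarrow> 'a set \<Rightarrow> 'a set \<Rightarrow> ('a \<Rightarrow> 'a) set" where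
  "forest_extensions r A X = {f \<in> A \<rightarrow>\<^sub>E X. acyclic (r \<union> parent_rel A f)}"

lemma parent_rel_insert_upd:
  "a \<notin> A \<Longrightarrow> parent_rel (insert a A) (f(a := y)) = insert (a, y) (parent_rel A f)"
  by (auto simp: parent_rel_def)

lemma single_valued_parent_rel: "single_valued (parent_rel A f)"
  by (auto simp: parent_rel_def single_valued_def)

lemma Domain_parent_rel [simp]: "Domain (parent_rel A f) = A"
  by (force simp: parent_rel_def)

lemma single_valued_Un_parent_rel:
  "single_valued r \<Longrightarrow> A \<inter> Domain r = {} \<Longrightarrow> single_valued (r \<union> parent_rel A f)"
  by (auto simp: parent_rel_def single_valued_def)

lemma rtrancl_from_sink: "(b, y) \<in> r\<^sup>* \<Longrightarrow> b \<notin> Domain r \<Longrightarrow> y = b"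
  by (auto elim: converse_rtranclE)

lemma sink_unique:
  assumes "single_valued r" "a \<notin> Domain r" "b \<notin> Domain r" "(x, a) \<in> r\<^sup>*" "(x, b) \<in> r\<^sup>*"
  shows "a = b"
  using single_valued_confluent[OF assms(1,4,5)] rtrancl_from_sink assms(2,3) by metis

lemma finite_forest_extensions:
  "finite A \<Longrightarrow> finite X \<Longrightarrow> finite (forest_extensions r A X)"
  unfolding forest_extensions_def by (rule finite_subset[OF _ finite_PiE[of A "\<lambda>_. X"]]) auto

lemma forest_extensions_insert:
  assumes "a \<notin> A"
  shows "forest_extensions r (insert a A) X =
    (\<lambda>(f, y). f(a := y)) ` (SIGMA f : forest_extensions r A X.
       X - descendants (r \<union> parent_rel A f) X a)" (is "?L = ?g ` ?S")
proof -
  have rel: "r \<union> parent_rel (insert a A) (f(a := y)) = insert (a, y) (r \<union> parent_rel A f)" for f y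
    using parent_rel_insert_upd[OF assms] by auto
  have L: "f \<in> ?g ` ?S" if f: "f \<in> ?L" for f
  proof -
    have "f \<in> insert a A \<rightarrow>\<^sub>E X" using f by (simp add: forest_extensions_def)
    then obtain y g where g: "f = g(a := y)" "y \<in> X" "g \<in> A \<rightarrow>\<^sub>E X"
      by (auto simp: PiE_insert_eq)
    have "acyclic (insert (a, y) (r \<union> parent_rel A g))"
      using f rel[of g y] by (simp add: forest_extensions_def g(1))
    then have "(g, y) \<in> ?S" using g by (auto simp: forest_extensions_def descendants_def)
    then show ?thesis using g(1) by force
  qed
  have R: "?g p \<in> ?L" if p: "p \<in> ?S" for p
  proof -
    obtain f y where fy: "p = (f, y)" "f \<in> forest_extensions r A X" "y \<in> X"
        "(y, a) \<notin> (r \<union> parent_rel A f)\<^sup>*"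
      using p by (auto simp: descendants_def)
    have "f(a := y) \<in> insert a A \<rightarrow>\<^sub>E X"
      using fy by (auto simp: forest_extensions_def intro!: PiE_fun_upd)
    moreover have "acyclic (r \<union> parent_rel (insert a A) (f(a := y)))"
      unfolding rel using fy by (simp add: forest_extensions_def)
    ultimately show ?thesis using fy(1) by (simp add: forest_extensions_def)
  qed
  show ?thesis by (rule equalityI, rule subsetI, erule L, rule image_subsetI, erule R)
qed

lemma inj_on_forest_extensions_insert:
  assumes "a \<notin> A"
  shows "inj_on (\<lambda>(f, y). f(a := y)) (SIGMA f : forest_extensions r A X. B f)"
proof (rule inj_onI)
  fix p q
  assume p: "p \<in> (SIGMA f : forest_extensions r A X. B f)"
    and q: "q \<in> (SIGMA f : forest_extensions r A X. B f)"
    and pq: "(\<lambda>(f, y). f(a := y)) p = (\<lambda>(f, y). f(a := y)) q"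
  obtain f y where f: "p = (f, y)" "f \<in> forest_extensions r A X"
    using p by (cases p) simp
  obtain g z where g: "q = (g, z)" "g \<in> forest_extensions r A X"
    using q by (cases q) simp
  have eq: "f(a := y) = g(a := z)" using pq unfolding f(1) g(1) by (simp only: prod.case)
  have "f v = g v" for v
  proof (cases "v = a")
    case True
    have "f a = undefined" "g a = undefined"
      using f(2) g(2) assms by (auto simp: forest_extensions_def intro: PiE_arb)
    then show ?thesis using True by simp
  next
    case False
    then show ?thesis using fun_cong[OF eq, of v] by simp
  qed
  then have "f = g" by (rule ext)
  moreover have "y = z" using fun_cong[OF eq, of a] by simp
  ultimately show "p = q" by (simp add: f(1) g(1))
qed

lemma card_Diff_descendants:
  assumes "finite X"
  shows "int (card (X - descendants r X a)) = int (card X) - int (card (descendants r X a))"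
proof -
  have "descendants r X a \<subseteq> X" by (auto simp: descendants_def)
  then show ?thesis
    using assms card_Diff_subset[of "descendants r X a" X] card_mono[OF assms] finite_subset
    by (metis of_nat_diff)
qed

text \<open>
Let \<open>T\<^sub>a\<close> and \<open>T\<^sub>b\<close> be the sizes of the trees below the roots \<open>a\<close> and \<open>b\<close>. A parent for \<open>a\<close> is
chosen outside the tree of \<open>a\<close>, and the tree of \<open>a\<close> is added to that of \<open>b\<close> for the \<open>T\<^sub>b\<close> choices
inside the tree of \<open>b\<close>. The sizes of the new trees of \<open>b\<close> add up to
\<open>(|X| - T\<^sub>a) * T\<^sub>b + T\<^sub>b * T\<^sub>a = |X| * T\<^sub>b\<close>, whatever \<open>T\<^sub>a\<close> is. So every new vertex contributes a
factor \<open>|X|\<close>.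
\<close>

lemma sum_card_descendants_forest_extensions:
  assumes "finite A" "finite X" "single_valued r" "acyclic r" "A \<inter> Domain r = {}"
    and "b \<notin> A" "b \<notin> Domain r"
  shows "(\<Sum>f\<in>forest_extensions r A X. int (card (descendants (r \<union> parent_rel A f) X b))) =
    int (card X) ^ card A * int (card (descendants r X b))"
  using assms(1,5,6)
proof (induction A rule: finite_induct)
  case empty
  have "forest_extensions r {} X = {\<lambda>_. undefined}"
    using assms(4) by (auto simp: forest_extensions_def parent_rel_def)
  then show ?case by (simp add: parent_rel_def)
next
  case (insert a A)
  let ?F = "forest_extensions r A X"
  let ?r = "\<lambda>f. r \<union> parent_rel A f"
  let ?D = "\<lambda>f. descendants (?r f) X"
  have finD: "finite (?D f v)" for f v using assms(2) by (simp add: descendants_def)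
  have step: "(\<Sum>y\<in>X - ?D f a. int (card (descendants (insert (a, y) (?r f)) X b))) =
      int (card X) * int (card (?D f b))" for f
  proof -
    have sv: "single_valued (?r f)"
      using insert.prems assms(3) by (intro single_valued_Un_parent_rel) auto
    have disj: "?D f a \<inter> ?D f b = {}"
      using sink_unique[OF sv, of a b] insert.prems insert.hyps assms(7)
      by (auto simp: descendants_def Domain_Un_eq)
    have D: "descendants (insert (a, y) (?r f)) X b = ?D f b \<union> (if y \<in> ?D f b then ?D f a else {})"
      if "y \<in> X" for y
      using that by (auto simp: descendants_def rtrancl_insert)
    have "(\<Sum>y\<in>X - ?D f a. int (card (descendants (insert (a, y) (?r f)) X b))) =
      (\<Sum>y\<in>X - ?D f a. int (card (?D f b)) + (if y \<in> ?D f b then int (card (?D f a)) else 0))"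
      using disj by (intro sum.cong refl) (auto simp: D card_Un_disjoint finD Int_commute)
    also have "\<dots> = int (card (X - ?D f a)) * int (card (?D f b))
        + int (card ((X - ?D f a) \<inter> ?D f b)) * int (card (?D f a))"
      using assms(2) by (simp add: sum.distrib sum.If_cases Int_def)
    also have "(X - ?D f a) \<inter> ?D f b = ?D f b" using disj by (auto simp: descendants_def)
    also have "int (card (X - ?D f a)) = int (card X) - int (card (?D f a))"
      by (rule card_Diff_descendants[OF assms(2)])
    finally show ?thesis by (simp add: algebra_simps)
  qed
  have "(\<Sum>f\<in>forest_extensions r (insert a A) X. int (card (descendants (r \<union> parent_rel (insert a A) f) X b)))
     = (\<Sum>(f, y)\<in>(SIGMA f : ?F. X - ?D f a). int (card (descendants (insert (a, y) (?r f)) X b)))"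
    unfolding forest_extensions_insert[OF insert.hyps(2)]
    by (subst sum.reindex[OF inj_on_forest_extensions_insert[OF insert.hyps(2)]])
      (auto simp: parent_rel_insert_upd[OF insert.hyps(2)] intro!: sum.cong)
  also have "\<dots> = (\<Sum>f\<in>?F. \<Sum>y\<in>X - ?D f a. int (card (descendants (insert (a, y) (?r f)) X b)))"
    using insert.hyps assms(2) by (subst sum.Sigma) (auto intro: finite_forest_extensions)
  also have "\<dots> = int (card X) * (\<Sum>f\<in>?F. int (card (?D f b)))"
    unfolding step by (simp add: sum_distrib_left)
  finally show ?case using insert by (simp add: mult.assoc)
qed

text \<open>
A further vertex \<open>a\<close> has \<open>|X|\<close> minus the size of its own tree many choices. The previous lemma
gives the sum of these tree sizes over all forests built so far.
\<close>

lemma card_forest_extensions: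
  assumes "finite A" "finite X" "single_valued r" "acyclic r" "A \<inter> Domain r = {}"
  shows "int (card (forest_extensions r A X)) * int (card X) =
    int (card X) ^ card A * (int (card X) - (\<Sum>a\<in>A. int (card (descendants r X a))))"
  using assms(1,5)
proof (induction A rule: finite_induct)
  case empty
  have "forest_extensions r {} X = {\<lambda>_. undefined}"
    using assms(4) by (auto simp: forest_extensions_def parent_rel_def)
  then show ?case by simp
next
  case (insert a A)
  let ?F = "forest_extensions r A X"
  let ?D = "\<lambda>f. descendants (r \<union> parent_rel A f) X"
  have "card (forest_extensions r (insert a A) X) = card (SIGMA f : ?F. X - ?D f a)"
    unfolding forest_extensions_insert[OF insert.hyps(2)]
    by (rule card_image[OF inj_on_forest_extensions_insert[OF insert.hyps(2)]])
  also have "\<dots> = (\<Sum>f\<in>?F. card (X - ?D f a))"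
    using insert.hyps assms(2) by (intro card_SigmaI) (auto intro: finite_forest_extensions)
  also have "int \<dots> = (\<Sum>f\<in>?F. int (card X) - int (card (?D f a)))"
    by (simp add: card_Diff_descendants[OF assms(2)])
  also have "\<dots> = int (card ?F) * int (card X) - int (card X) ^ card A * int (card (descendants r X a))"
    using sum_card_descendants_forest_extensions[of A X r a] insert assms
    by (simp add: sum_subtractf)
  also have "\<dots> = int (card X) ^ card A *
      (int (card X) - (\<Sum>a\<in>insert a A. int (card (descendants r X a))))"
    using insert by (simp add: algebra_simps)
  finally show ?case using insert.hyps by simp
qed

section \<open>Rooted forests with prescribed branches\<close>

lemma card_forest_extensions_empty:
  assumes "finite X" "A \<subseteq> X"
  shows "card (forest_extensions {} A X) * card X = card X ^ card A * (card X - card A)"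
proof -
  have fA: "finite A" using assms finite_subset by blast
  have "descendants {} X a = {a}" if "a \<in> A" for a
    using that assms by (auto simp: descendants_def)
  then have "int (card (forest_extensions {} A X)) * int (card X) =
      int (card X) ^ card A * (int (card X) - int (card A))"
    using card_forest_extensions[of A X "{}"] assms fA by (simp add: acyclic_def)
  also have "int (card X) - int (card A) = int (card X - card A)"
    using card_mono[OF assms] by (simp add: of_nat_diff)
  finally show ?thesis by (metis of_nat_eq_iff of_nat_mult of_nat_power)
qed

text \<open>
A rooted tree on \<open>S\<close> whose root has a parent in \<open>M\<close>.
\<close>

definition hanging_trees :: "'a set \<Rightarrow> 'a set \<Rightarrow> ('a \<Rightarrow> 'a) set" where
  "hanging_trees S M = {h \<in> S \<rightarrow>\<^sub>E S \<union> M. acyclic (parent_rel S h) \<and> (\<exists>!v. v \<in> S \<and> h v \<notin> S)}"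

lemma hanging_trees_eq:
  assumes "S \<inter> M = {}"
  shows "hanging_trees S M =
    (\<Union>v\<in>S. (\<lambda>(h, y). h(v := y)) ` (forest_extensions {} (S - {v}) S \<times> M))"
proof (intro equalityI subsetI)
  fix f assume f: "f \<in> hanging_trees S M"
  then obtain v where v: "v \<in> S" "f v \<notin> S" and uniq: "\<And>w. w \<in> S \<Longrightarrow> f w \<notin> S \<Longrightarrow> w = v"
    by (auto simp: hanging_trees_def)
  define h where "h = restrict f (S - {v})"
  have ext: "f \<in> S \<rightarrow>\<^sub>E S \<union> M" and ac: "acyclic (parent_rel S f)"
    using f by (auto simp: hanging_trees_def)
  have "h \<in> S - {v} \<rightarrow>\<^sub>E S" using uniq by (auto simp: h_def)
  moreover have "parent_rel (S - {v}) h \<subseteq> parent_rel S f" by (auto simp: h_def parent_rel_def)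
  then have "acyclic (parent_rel (S - {v}) h)" using ac by (rule acyclic_subset[rotated])
  moreover have "f v \<in> M" using ext v by (auto simp: PiE_def Pi_def)
  moreover have "f = h(v := f v)"
  proof
    fix x show "f x = (h(v := f v)) x" using PiE_arb[OF ext, of x] by (auto simp: h_def)
  qed
  ultimately have "(h, f v) \<in> forest_extensions {} (S - {v}) S \<times> M" "f = (\<lambda>(h, y). h(v := y)) (h, f v)"
    by (auto simp: forest_extensions_def)
  then show "f \<in> (\<Union>v\<in>S. (\<lambda>(h, y). h(v := y)) ` (forest_extensions {} (S - {v}) S \<times> M))"
    using v by blast
next
  fix f assume "f \<in> (\<Union>v\<in>S. (\<lambda>(h, y). h(v := y)) ` (forest_extensions {} (S - {v}) S \<times> M))"
  then obtain v h y where v: "v \<in> S" and h: "h \<in> forest_extensions {} (S - {v}) S"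
    and y: "y \<in> M" and f: "f = h(v := y)" by auto
  have ext: "h \<in> S - {v} \<rightarrow>\<^sub>E S" and ac: "acyclic (parent_rel (S - {v}) h)"
    using h by (auto simp: forest_extensions_def)
  have ynS: "y \<notin> S" using y assms by auto
  have hS: "h w \<in> S" if "w \<in> S" "w \<noteq> v" for w using ext that by (auto simp: PiE_def Pi_def)
  have "h(v := y) \<in> insert v (S - {v}) \<rightarrow>\<^sub>E S \<union> M"
    using ext y by (intro PiE_fun_upd) (auto simp: PiE_def Pi_def)
  then have "f \<in> S \<rightarrow>\<^sub>E S \<union> M" using v f by (simp add: insert_absorb)
  moreover have "acyclic (parent_rel S f)"
  proof -
    have "parent_rel S f = insert (v, y) (parent_rel (S - {v}) h)"
      using parent_rel_insert_upd[of v "S - {v}" h y] v f by (simp add: insert_absorb)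
    moreover have "(y, v) \<notin> (parent_rel (S - {v}) h)\<^sup>*"
    proof
      assume "(y, v) \<in> (parent_rel (S - {v}) h)\<^sup>*"
      moreover have "y \<notin> Domain (parent_rel (S - {v}) h)"
        unfolding Domain_parent_rel using ynS by simp
      ultimately have "v = y" by (rule rtrancl_from_sink)
      then show False using v ynS by simp
    qed
    ultimately show ?thesis using ac by simp
  qed
  moreover have "\<exists>!w. w \<in> S \<and> f w \<notin> S"
    using v ynS hS by (intro ex1I[of _ v]) (auto simp: f split: if_splits)
  ultimately show "f \<in> hanging_trees S M" by (simp add: hanging_trees_def)
qed

text \<open>
There are \<open>|M|\<close> parents for the root, and \<open>|S| ^ (|S| - 1)\<close> rooted trees on \<open>S\<close>: for each of the
\<open>|S|\<close> possible roots, the other vertices form a forest extension with targets in \<open>S\<close>.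
\<close>

lemma card_hanging_trees:
  assumes "finite S" "finite M" "S \<inter> M = {}" "S \<noteq> {}"
  shows "card (hanging_trees S M) = card M * card S ^ (card S - 1)"
proof -
  let ?F = "\<lambda>v. forest_extensions {} (S - {v}) S"
  let ?g = "\<lambda>v (h, y). h(v := y)"
  have inj: "inj_on (?g v) (?F v \<times> M)" for v
    using inj_on_forest_extensions_insert[of v "S - {v}" "{}" S "\<lambda>_. M"] by simp
  have out: "f v \<notin> S" "\<And>w. w \<in> S \<Longrightarrow> w \<noteq> v \<Longrightarrow> f w \<in> S" if "f \<in> ?g v ` (?F v \<times> M)" for f v
    using that assms(3) by (auto simp: forest_extensions_def PiE_def Pi_def)
  have disj: "?g v ` (?F v \<times> M) \<inter> ?g w ` (?F w \<times> M) = {}" if "v \<in> S" "w \<in> S" "v \<noteq> w" for v w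
  proof (rule ccontr)
    assume "?g v ` (?F v \<times> M) \<inter> ?g w ` (?F w \<times> M) \<noteq> {}"
    then obtain f where f: "f \<in> ?g v ` (?F v \<times> M)" "f \<in> ?g w ` (?F w \<times> M)" by blast
    show False using out(1)[OF f(1)] out(2)[OF f(2) that(1) that(3)] by simp
  qed
  have "card (hanging_trees S M) = (\<Sum>v\<in>S. card (?g v ` (?F v \<times> M)))"
    unfolding hanging_trees_eq[OF assms(3)] using assms disj
    by (intro card_UN_disjoint) (auto intro!: finite_imageI finite_cartesian_product finite_forest_extensions)
  also have "\<dots> = (\<Sum>v\<in>S. card (?F v) * card M)"
    by (intro sum.cong refl) (subst card_image[OF inj], rule card_cartesian_product)
  also have "\<dots> = (\<Sum>v\<in>S. card (?F v)) * card M" by (simp add: sum_distrib_right)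
  also have "(\<Sum>v\<in>S. card (?F v)) = card S ^ (card S - 1)"
  proof -
    have "card (?F v) * card S = card S ^ (card S - 1)" if "v \<in> S" for v
    proof -
      have "card S - (card S - 1) = 1" using assms(1,4) by (simp add: card_gt_0_iff Suc_le_eq)
      then show ?thesis
        using card_forest_extensions_empty[of S "S - {v}"] that assms(1) by simp
    qed
    then have "(\<Sum>v\<in>S. card (?F v) * card S) = (\<Sum>v\<in>S. card S ^ (card S - 1))"
      by (intro sum.cong refl) simp
    then have "(\<Sum>v\<in>S. card (?F v)) * card S = card S ^ (card S - 1) * card S"
      by (simp add: sum_distrib_right)
    then show ?thesis using assms(1,4) by simp
  qed
  finally show ?thesis by simp
qed

text \<open>
This expresses through parents that \<open>S\<close> is a component of the graph induced on \<open>K\<close> when all edges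
join a vertex to its parent and the remaining vertices \<open>M\<close> contain the root; see
\<open>hangs_off_iff_component\<close>.
\<close>

definition hangs_off :: "'a set \<Rightarrow> 'a set \<Rightarrow> ('a \<Rightarrow> 'a) \<Rightarrow> 'a set \<Rightarrow> bool" where
  "hangs_off K M f S \<longleftrightarrow>
     (\<exists>!v. v \<in> S \<and> f v \<notin> S) \<and> (\<forall>v\<in>S. f v \<in> S \<union> M) \<and> (\<forall>v\<in>K - S. f v \<notin> S)"

definition inner_forests :: "'a set \<Rightarrow> 'a set \<Rightarrow> 'i set \<Rightarrow> ('i \<Rightarrow> 'a set) \<Rightarrow> ('a \<Rightarrow> 'a) set" where
  "inner_forests K M I S =
     {f \<in> K \<rightarrow>\<^sub>E K \<union> M. acyclic (parent_rel K f) \<and> (\<forall>i\<in>I. hangs_off K M f (S i))}"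

text \<open>
A cycle with edges of both kinds would pass from an edge of \<open>s\<close> to an edge of \<open>r\<close> at some vertex.
\<close>

lemma acyclic_Un_separated:
  assumes "finite r" "finite s" "acyclic r" "acyclic s" "Domain r \<inter> Range s = {}"
  shows "acyclic (r \<union> s)"
  using wf_Un[of r s] assms by (simp add: wf_iff_acyclic_if_finite)

lemma finite_parent_rel: "finite A \<Longrightarrow> finite (parent_rel A f)"
  by (simp add: parent_rel_def)

lemma parent_rel_cong: "(\<And>v. v \<in> A \<Longrightarrow> f v = g v) \<Longrightarrow> parent_rel A f = parent_rel A g"
  by (auto simp: parent_rel_def)

lemma parent_rel_Un: "parent_rel (A \<union> B) f = parent_rel A f \<union> parent_rel B f"
  by (auto simp: parent_rel_def)

lemma ex1_cong: "(\<And>v. P v \<longleftrightarrow> Q v) \<Longrightarrow> (\<exists>!v. P v) \<longleftrightarrow> (\<exists>!v. Q v)"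
  by simp

text \<open>
A branch \<open>T\<close> and the rest of the inner forest do not interact: edges leave \<open>T\<close> only towards \<open>M\<close>,
where no inner edge starts, and no edge enters \<open>T\<close>. So the two parts can be chosen independently.
\<close>

lemma card_inner_forests_insert:
  assumes fin: "finite K" "finite M" and KM: "K \<inter> M = {}"
    and T: "T \<subseteq> K" "S i = T" and dis: "\<And>k. k \<in> I \<Longrightarrow> S k \<subseteq> K - T" and i: "i \<notin> I"
  shows "card (inner_forests K M (insert i I) S) =
    card (hanging_trees T M) * card (inner_forests (K - T) M I S)"
proof -
  let ?m = "\<lambda>f. (restrict f T, restrict f (K - T))"
  let ?n = "\<lambda>(h, g) v. if v \<in> T then h v else g v"
  have "bij_betw ?m (inner_forests K M (insert i I) S)
      (hanging_trees T M \<times> inner_forests (K - T) M I S)"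
  proof (rule bij_betw_byWitness[where f' = ?n])
    show "\<forall>f\<in>inner_forests K M (insert i I) S. ?n (?m f) = f"
    proof
      fix f assume "f \<in> inner_forests K M (insert i I) S"
      then have ext: "f \<in> K \<rightarrow>\<^sub>E K \<union> M" by (simp add: inner_forests_def)
      show "?n (?m f) = f"
      proof
        fix v show "?n (?m f) v = f v" using PiE_arb[OF ext, of v] T by auto
      qed
    qed
    show "\<forall>p\<in>hanging_trees T M \<times> inner_forests (K - T) M I S. ?m (?n p) = p"
    proof
      fix p assume p: "p \<in> hanging_trees T M \<times> inner_forests (K - T) M I S"
      obtain h g where hg: "p = (h, g)" by (cases p)
      have h: "h \<in> T \<rightarrow>\<^sub>E T \<union> M" and g: "g \<in> (K - T) \<rightarrow>\<^sub>E (K - T) \<union> M"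
        using p by (auto simp: hg hanging_trees_def inner_forests_def)
      have "restrict (?n (h, g)) T v = h v" for v using PiE_arb[OF h, of v] by simp
      moreover have "restrict (?n (h, g)) (K - T) v = g v" for v using PiE_arb[OF g, of v] by simp
      ultimately show "?m (?n p) = p" unfolding hg by auto
    qed
    show "?m ` inner_forests K M (insert i I) S \<subseteq> hanging_trees T M \<times> inner_forests (K - T) M I S"
    proof (rule image_subsetI)
      fix f assume f: "f \<in> inner_forests K M (insert i I) S"
      have ext: "f \<in> K \<rightarrow>\<^sub>E K \<union> M" and ac: "acyclic (parent_rel K f)"
        and ho: "hangs_off K M f T" and hk: "\<And>k. k \<in> I \<Longrightarrow> hangs_off K M f (S k)"
        using f T by (auto simp: inner_forests_def)
      have fv: "f v \<in> K \<union> M" if "v \<in> K" for v using ext that by (auto simp: PiE_def Pi_def)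
      have "restrict f T \<in> T \<rightarrow>\<^sub>E T \<union> M" using ho by (auto simp: hangs_off_def)
      moreover have "acyclic (parent_rel T (restrict f T))"
        using T by (intro acyclic_subset[OF ac]) (auto simp: parent_rel_def)
      moreover have "\<exists>!v. v \<in> T \<and> restrict f T v \<notin> T"
        using ho unfolding hangs_off_def by (elim conjE) (rule iffD1[OF ex1_cong], auto)
      ultimately have 1: "restrict f T \<in> hanging_trees T M" by (simp add: hanging_trees_def)
      have "restrict f (K - T) \<in> (K - T) \<rightarrow>\<^sub>E (K - T) \<union> M"
        using ho fv by (auto simp: hangs_off_def)
      moreover have "acyclic (parent_rel (K - T) (restrict f (K - T)))"
        using T by (intro acyclic_subset[OF ac]) (auto simp: parent_rel_def)
      moreover have "hangs_off (K - T) M (restrict f (K - T)) (S k)" if k: "k \<in> I" for k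
      proof -
        have Sk: "v \<in> K - T" if "v \<in> S k" for v using dis[OF k] that by auto
        have "\<exists>!v. v \<in> S k \<and> restrict f (K - T) v \<notin> S k"
          using hk[OF k] Sk unfolding hangs_off_def by (elim conjE) (rule iffD1[OF ex1_cong], auto)
        then show ?thesis using hk[OF k] Sk by (auto simp: hangs_off_def)
      qed
      ultimately have "restrict f (K - T) \<in> inner_forests (K - T) M I S"
        by (simp add: inner_forests_def)
      with 1 show "?m f \<in> hanging_trees T M \<times> inner_forests (K - T) M I S" by simp
    qed
    show "?n ` (hanging_trees T M \<times> inner_forests (K - T) M I S) \<subseteq> inner_forests K M (insert i I) S"
    proof (rule image_subsetI)
      fix p assume p: "p \<in> hanging_trees T M \<times> inner_forests (K - T) M I S"
      obtain h g where hg: "p = (h, g)" by (cases p)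
      define f where "f = ?n (h, g)"
      have fT: "f v = h v" if "v \<in> T" for v using that by (simp add: f_def)
      have fK: "f v = g v" if "v \<notin> T" for v using that by (simp add: f_def)
      have h: "h \<in> T \<rightarrow>\<^sub>E T \<union> M" and ach: "acyclic (parent_rel T h)"
        and ex1: "\<exists>!v. v \<in> T \<and> h v \<notin> T"
        and g: "g \<in> (K - T) \<rightarrow>\<^sub>E (K - T) \<union> M" and acg: "acyclic (parent_rel (K - T) g)"
        and hk: "\<And>k. k \<in> I \<Longrightarrow> hangs_off (K - T) M g (S k)"
        using p by (auto simp: hg hanging_trees_def inner_forests_def)
      have hv: "h v \<in> T \<union> M" if "v \<in> T" for v using h that by (auto simp: PiE_def Pi_def)
      have gv: "g v \<in> (K - T) \<union> M" if "v \<in> K - T" for v using g that by (auto simp: PiE_def Pi_def)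
      have gu: "g v = undefined" if "v \<notin> K" for v using PiE_arb[OF g, of v] that by simp
      have "f \<in> K \<rightarrow>\<^sub>E K \<union> M"
        using hv gv gu T by (intro PiE_I) (auto simp: f_def)
      moreover have "acyclic (parent_rel K f)"
      proof -
        have "parent_rel K f = parent_rel T h \<union> parent_rel (K - T) g"
          using T parent_rel_Un[of T "K - T" f] parent_rel_cong[of T f h] parent_rel_cong[of "K - T" f g]
            fT fK by (simp add: Un_absorb1)
        moreover have "Domain (parent_rel T h) \<inter> Range (parent_rel (K - T) g) = {}"
          using gv T KM by (auto simp: parent_rel_def)
        ultimately show ?thesis
          using acyclic_Un_separated ach acg fin T finite_subset[OF T(1)] by (metis finite_Diff finite_parent_rel)
      qed
      moreover have "hangs_off K M f T"
      proof -
        have "\<exists>!v. v \<in> T \<and> f v \<notin> T"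
          using ex1 by (rule iffD1[OF ex1_cong, rotated]) (use fT in auto)
        moreover have "f v \<in> T \<union> M" if "v \<in> T" for v using hv[OF that] fT[OF that] by simp
        moreover have "f v \<notin> T" if "v \<in> K - T" for v
          using gv[OF that] fK[of v] that T KM by auto
        ultimately show ?thesis by (auto simp: hangs_off_def)
      qed
      moreover have "hangs_off K M f (S k)" if k: "k \<in> I" for k
      proof -
        have Sk: "v \<in> K - T" if "v \<in> S k" for v using dis[OF k] that by auto
        have fS: "f v = g v" if "v \<in> S k" for v using fK Sk[OF that] by simp
        have H: "\<exists>!v. v \<in> S k \<and> g v \<notin> S k" "\<And>v. v \<in> S k \<Longrightarrow> g v \<in> S k \<union> M"
          "\<And>v. v \<in> K - T - S k \<Longrightarrow> g v \<notin> S k"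
          using hk[OF k] by (auto simp: hangs_off_def)
        have "\<exists>!v. v \<in> S k \<and> f v \<notin> S k"
          using H(1) by (rule iffD1[OF ex1_cong, rotated]) (use fS in auto)
        moreover have "f v \<in> S k \<union> M" if "v \<in> S k" for v using H(2)[OF that] fS[OF that] by simp
        moreover have "f v \<notin> S k" if v: "v \<in> K - S k" for v
        proof (cases "v \<in> T")
          case True
          then have "f v \<in> T \<union> M" using hv fT by simp
          then show ?thesis using Sk KM by auto
        next
          case False
          then show ?thesis using H(3)[of v] fK[of v] v by simp
        qed
        ultimately show ?thesis by (auto simp: hangs_off_def)
      qed
      ultimately have "f \<in> inner_forests K M (insert i I) S"
        using T by (simp add: inner_forests_def)
      then show "?n p \<in> inner_forests K M (insert i I) S" by (simp add: hg f_def)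
    qed
  qed
  then show ?thesis by (simp add: bij_betw_same_card card_cartesian_product)
qed

text \<open>
Splitting off the sets \<open>S i\<close> one after the other leaves an arbitrary forest on the other vertices
of \<open>K\<close> with roots in \<open>M\<close>.
\<close>

lemma card_inner_forests:
  assumes "finite I" "finite K" "finite M" "K \<inter> M = {}"
    and "\<And>i. i \<in> I \<Longrightarrow> S i \<subseteq> K \<and> S i \<noteq> {}" "disjoint_family_on S I"
  shows "card (inner_forests K M I S) * card (K \<union> M - \<Union>(S ` I)) =
    (\<Prod>i\<in>I. card M * card (S i) ^ (card (S i) - 1)) * card M *
      card (K \<union> M - \<Union>(S ` I)) ^ card (K - \<Union>(S ` I))"
  using assms
proof (induction I arbitrary: K rule: finite_induct)
  case empty
  have "inner_forests K M {} S = forest_extensions {} K (K \<union> M)"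
    by (simp add: inner_forests_def forest_extensions_def)
  moreover have "card (K \<union> M) - card K = card M"
    using empty by (simp add: card_Un_disjoint)
  ultimately show ?case using card_forest_extensions_empty[of "K \<union> M" K] empty by simp
next
  case (insert i I)
  let ?T = "S i"
  have dis: "S k \<subseteq> K - ?T" if "k \<in> I" for k
    using insert.prems(4)[of k] insert.prems(5) insert.hyps that
    by (auto simp: disjoint_family_on_def)
  have TK: "?T \<subseteq> K" "?T \<noteq> {}" using insert.prems(4)[of i] by auto
  have TM: "?T \<inter> M = {}" using TK insert.prems(3) by auto
  have un: "K \<union> M - \<Union>(S ` insert i I) = (K - ?T) \<union> M - \<Union>(S ` I)"
    "K - \<Union>(S ` insert i I) = (K - ?T) - \<Union>(S ` I)" using TM by auto
  have IH: "card (inner_forests (K - ?T) M I S) * card ((K - ?T) \<union> M - \<Union>(S ` I)) =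
    (\<Prod>i\<in>I. card M * card (S i) ^ (card (S i) - 1)) * card M *
      card ((K - ?T) \<union> M - \<Union>(S ` I)) ^ card ((K - ?T) - \<Union>(S ` I))"
  proof (rule insert.IH)
    show "disjoint_family_on S I" using insert.prems(5) by (auto simp: disjoint_family_on_def)
    show "S k \<subseteq> K - ?T \<and> S k \<noteq> {}" if "k \<in> I" for k
      using dis[OF that] insert.prems(4)[of k] that by auto
  qed (use insert.prems in auto)
  have "card (inner_forests K M (insert i I) S) =
     card M * card ?T ^ (card ?T - 1) * card (inner_forests (K - ?T) M I S)"
    using card_inner_forests_insert[of K M ?T S i I] insert dis TK
      card_hanging_trees[of ?T M] TM finite_subset[OF TK(1)] by simp
  then show ?case unfolding un using IH insert.hyps by (simp add: mult.assoc)
qed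

definition parent_functions :: "'a set \<Rightarrow> 'a \<Rightarrow> ('a \<Rightarrow> 'a) set" where
  "parent_functions V \<rho> = {f \<in> (V - {\<rho>}) \<rightarrow>\<^sub>E V. acyclic (parent_rel (V - {\<rho>}) f)}"

lemma acyclic_parent_rel_induct [consumes 2, case_names sink step]:
  assumes "finite A" "acyclic (parent_rel A f)"
    and "\<And>x. x \<notin> A \<Longrightarrow> P x" "\<And>x. x \<in> A \<Longrightarrow> P (f x) \<Longrightarrow> P x"
  shows "P x"
proof -
  have "wf ((parent_rel A f)\<inverse>)"
    using assms(1,2) by (intro finite_acyclic_wf_converse) (simp_all add: finite_parent_rel)
  then show ?thesis
  proof (induction x rule: wf_induct_rule)
    case (less x)
    show ?case
    proof (cases "x \<in> A")
      case True
      then have "(f x, x) \<in> (parent_rel A f)\<inverse>" by (auto simp: parent_rel_def)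
      then show ?thesis using less assms(4)[OF True] by blast
    qed (rule assms(3))
  qed
qed

lemma reaches_sink:
  assumes "finite K" "acyclic (parent_rel K f)" "\<And>v. v \<in> K \<Longrightarrow> f v \<in> K \<union> M" "x \<in> K \<union> M"
  shows "\<exists>a\<in>M. (x, a) \<in> (parent_rel K f)\<^sup>*"
  using assms(1,2,4)
proof (induction x rule: acyclic_parent_rel_induct)
  case (sink x)
  then show ?case by auto
next
  case (step x)
  then obtain a where a: "a \<in> M" "(f x, a) \<in> (parent_rel K f)\<^sup>*" using assms(3) by auto
  have "(x, f x) \<in> parent_rel K f" using step by (auto simp: parent_rel_def)
  then show ?case using a by (meson converse_rtrancl_into_rtrancl)
qed

text \<open>
Every vertex lies in exactly one of the trees with roots in \<open>M\<close>.
\<close>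

lemma sum_card_descendants_sinks:
  assumes "finite K" "finite M" "K \<inter> M = {}" "acyclic (parent_rel K f)"
    and "\<And>v. v \<in> K \<Longrightarrow> f v \<in> K \<union> M"
  shows "(\<Sum>a\<in>M. card (descendants (parent_rel K f) (K \<union> M) a)) = card (K \<union> M)"
proof -
  let ?D = "descendants (parent_rel K f) (K \<union> M)"
  have "?D a \<inter> ?D b = {}" if "a \<in> M" "b \<in> M" "a \<noteq> b" for a b
  proof -
    have "a \<notin> Domain (parent_rel K f)" "b \<notin> Domain (parent_rel K f)"
      unfolding Domain_parent_rel using that assms(3) by auto
    then show ?thesis using sink_unique[OF single_valued_parent_rel, of a K f b] that
      by (auto simp only: descendants_def)
  qed
  then have "card (\<Union>a\<in>M. ?D a) = (\<Sum>a\<in>M. card (?D a))"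
    using assms by (intro card_UN_disjoint) (auto simp: descendants_def)
  also have "(\<Union>a\<in>M. ?D a) = K \<union> M"
    using reaches_sink[OF assms(1,4,5)] by (auto simp: descendants_def)
  finally show ?thesis by simp
qed

lemma card_parent_functions_hanging:
  assumes fin: "finite K" "finite M" and KM: "K \<inter> M = {}" and \<rho>: "\<rho> \<in> M"
    and S: "\<And>i. i \<in> I \<Longrightarrow> S i \<subseteq> K"
  shows "card {f \<in> parent_functions (K \<union> M) \<rho>. \<forall>i\<in>I. hangs_off K M f (S i)} =
    (\<Sum>f\<in>inner_forests K M I S. card (forest_extensions (parent_rel K f) (M - {\<rho>}) (K \<union> M)))"
proof -
  let ?L = "{f \<in> parent_functions (K \<union> M) \<rho>. \<forall>i\<in>I. hangs_off K M f (S i)}"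
  let ?E = "\<lambda>f. forest_extensions (parent_rel K f) (M - {\<rho>}) (K \<union> M)"
  let ?m = "\<lambda>f. (restrict f K, restrict f (M - {\<rho>}))"
  let ?n = "\<lambda>(h, g) v. if v \<in> K then h v else g v"
  have V: "K \<union> M - {\<rho>} = K \<union> (M - {\<rho>})" using KM \<rho> by auto
  have ho: "hangs_off K M f (S i) \<longleftrightarrow> hangs_off K M g (S i)"
    if "\<And>v. v \<in> K \<Longrightarrow> f v = g v" "i \<in> I" for f g i
  proof -
    have "f v = g v" if "v \<in> S i" for v using that S[OF \<open>i \<in> I\<close>] \<open>\<And>v. v \<in> K \<Longrightarrow> f v = g v\<close> by auto
    then have "(\<exists>!v. v \<in> S i \<and> f v \<notin> S i) \<longleftrightarrow> (\<exists>!v. v \<in> S i \<and> g v \<notin> S i)"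
      by (intro ex1_cong) auto
    moreover have "(\<forall>v\<in>S i. f v \<in> S i \<union> M) \<longleftrightarrow> (\<forall>v\<in>S i. g v \<in> S i \<union> M)"
      using \<open>\<And>v. v \<in> S i \<Longrightarrow> f v = g v\<close> by auto
    moreover have "(\<forall>v\<in>K - S i. f v \<notin> S i) \<longleftrightarrow> (\<forall>v\<in>K - S i. g v \<notin> S i)"
      using that(1) by auto
    ultimately show ?thesis by (simp only: hangs_off_def)
  qed
  \<comment> \<open>A parent function consists of an inner part on \<open>K\<close> and an extension to the non-root outer vertices.\<close>
  have "bij_betw ?m ?L (SIGMA f : inner_forests K M I S. ?E f)"
  proof (rule bij_betw_byWitness[where f' = ?n])
    show "\<forall>f\<in>?L. ?n (?m f) = f"
    proof
      fix f assume "f \<in> ?L"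
      then have ext: "f \<in> (K \<union> M - {\<rho>}) \<rightarrow>\<^sub>E K \<union> M" by (simp add: parent_functions_def)
      show "?n (?m f) = f"
      proof
        fix v show "?n (?m f) v = f v" using PiE_arb[OF ext, of v] by auto
      qed
    qed
    show "\<forall>p\<in>(SIGMA f : inner_forests K M I S. ?E f). ?m (?n p) = p"
    proof
      fix p assume p: "p \<in> (SIGMA f : inner_forests K M I S. ?E f)"
      obtain h g where hg: "p = (h, g)" by (cases p)
      have h: "h \<in> K \<rightarrow>\<^sub>E K \<union> M" and g: "g \<in> (M - {\<rho>}) \<rightarrow>\<^sub>E K \<union> M"
        using p by (auto simp: hg forest_extensions_def inner_forests_def)
      have "restrict (?n (h, g)) K v = h v" for v using PiE_arb[OF h, of v] by simp
      moreover have "restrict (?n (h, g)) (M - {\<rho>}) v = g v" for v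
        using PiE_arb[OF g, of v] KM by auto
      ultimately show "?m (?n p) = p" unfolding hg by auto
    qed
    show "?m ` ?L \<subseteq> (SIGMA f : inner_forests K M I S. ?E f)"
    proof (rule image_subsetI)
      fix f assume f: "f \<in> ?L"
      have ext: "f \<in> (K \<union> M - {\<rho>}) \<rightarrow>\<^sub>E K \<union> M" and ac: "acyclic (parent_rel (K \<union> M - {\<rho>}) f)"
        and hk: "\<And>i. i \<in> I \<Longrightarrow> hangs_off K M f (S i)"
        using f by (auto simp: parent_functions_def)
      have fv: "f v \<in> K \<union> M" if "v \<in> K \<union> M" "v \<noteq> \<rho>" for v
        using ext that by (auto simp: PiE_def Pi_def)
      have nK: "\<rho> \<notin> K" using KM \<rho> by auto
      have "restrict f K \<in> K \<rightarrow>\<^sub>E K \<union> M" using fv nK by (intro PiE_I) auto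
      moreover have "acyclic (parent_rel K (restrict f K))"
        using nK by (intro acyclic_subset[OF ac]) (auto simp: parent_rel_def)
      moreover have "hangs_off K M (restrict f K) (S i)" if "i \<in> I" for i
        using hk[OF that] ho[of f "restrict f K" i] that by simp
      moreover have "restrict f (M - {\<rho>}) \<in> (M - {\<rho>}) \<rightarrow>\<^sub>E K \<union> M" using fv by (intro PiE_I) auto
      moreover have "acyclic (parent_rel K (restrict f K) \<union> parent_rel (M - {\<rho>}) (restrict f (M - {\<rho>})))"
        using nK by (intro acyclic_subset[OF ac]) (auto simp: parent_rel_def)
      ultimately show "?m f \<in> (SIGMA f : inner_forests K M I S. ?E f)"
        by (simp add: inner_forests_def forest_extensions_def)
    qed
    show "?n ` (SIGMA f : inner_forests K M I S. ?E f) \<subseteq> ?L"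
    proof (rule image_subsetI)
      fix p assume p: "p \<in> (SIGMA f : inner_forests K M I S. ?E f)"
      obtain h g where hg: "p = (h, g)" by (cases p)
      define f where "f = ?n (h, g)"
      have h: "h \<in> K \<rightarrow>\<^sub>E K \<union> M" and g: "g \<in> (M - {\<rho>}) \<rightarrow>\<^sub>E K \<union> M"
        and ac: "acyclic (parent_rel K h \<union> parent_rel (M - {\<rho>}) g)"
        and hk: "\<And>i. i \<in> I \<Longrightarrow> hangs_off K M h (S i)"
        using p by (auto simp: hg forest_extensions_def inner_forests_def)
      have hv: "h v \<in> K \<union> M" if "v \<in> K" for v using h that by (auto simp: PiE_def Pi_def)
      have gv: "g v \<in> K \<union> M" if "v \<in> M - {\<rho>}" for v using g that by (auto simp: PiE_def Pi_def)
      have gu: "g v = undefined" if "v \<notin> M - {\<rho>}" for v using PiE_arb[OF g that] .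
      have "f \<in> (K \<union> M - {\<rho>}) \<rightarrow>\<^sub>E K \<union> M" unfolding V
        using hv gv gu by (intro PiE_I) (auto simp: f_def)
      moreover have "parent_rel (K \<union> M - {\<rho>}) f = parent_rel K h \<union> parent_rel (M - {\<rho>}) g"
        unfolding V parent_rel_Un using KM
        by (intro arg_cong2[of _ _ _ _ "(\<union>)"] parent_rel_cong) (auto simp: f_def)
      moreover have "hangs_off K M f (S i)" if "i \<in> I" for i
        using hk[OF that] ho[of f h i] that by (simp add: f_def)
      ultimately have "f \<in> ?L" using ac by (simp add: parent_functions_def)
      then show "?n p \<in> ?L" by (simp add: hg f_def)
    qed
  qed
  then have "card ?L = card (SIGMA f : inner_forests K M I S. ?E f)" by (rule bij_betw_same_card)
  also have "\<dots> = (\<Sum>f\<in>inner_forests K M I S. card (?E f))"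
  proof (rule card_SigmaI)
    show "finite (inner_forests K M I S)" unfolding inner_forests_def
      by (rule finite_subset[OF _ finite_PiE[of K "\<lambda>_. K \<union> M"]]) (use fin in auto)
    show "\<forall>f\<in>inner_forests K M I S. finite (?E f)" using fin by (auto intro!: finite_forest_extensions)
  qed
  finally show ?thesis .
qed

text \<open>
For a fixed root \<open>\<rho>\<close> the number of ways to attach the outer vertices to a given inner forest is
proportional to the size of the tree of \<open>\<rho>\<close> in that forest. These sizes add up to the number of
all vertices, which is why the sum over \<open>\<rho>\<close> is independent of the inner forest.
\<close>

lemma sum_card_parent_functions_hanging:
  assumes fin: "finite K" "finite M" and KM: "K \<inter> M = {}" and M: "M \<noteq> {}"
    and S: "\<And>i. i \<in> I \<Longrightarrow> S i \<subseteq> K"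
  shows "(\<Sum>\<rho>\<in>M. card {f \<in> parent_functions (K \<union> M) \<rho>. \<forall>i\<in>I. hangs_off K M f (S i)}) =
    card (inner_forests K M I S) * card (K \<union> M) ^ (card M - 1)"
proof -
  let ?F = "inner_forests K M I S" and ?n = "card (K \<union> M)" and ?m = "card M"
  let ?E = "\<lambda>f \<rho>. card (forest_extensions (parent_rel K f) (M - {\<rho>}) (K \<union> M))"
  let ?D = "\<lambda>f a. int (card (descendants (parent_rel K f) (K \<union> M) a))"
  have n0: "?n > 0" and m0: "?m > 0" using M fin by (auto simp: card_gt_0_iff)
  have "(\<Sum>\<rho>\<in>M. int (?E f \<rho>)) = int ?n ^ (?m - 1)" if f: "f \<in> ?F" for f
  proof -
    have ext: "f \<in> K \<rightarrow>\<^sub>E K \<union> M" and ac: "acyclic (parent_rel K f)"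
      using f by (auto simp: inner_forests_def)
    have tot: "(\<Sum>a\<in>M. ?D f a) = int ?n"
      using sum_card_descendants_sinks[OF fin KM ac] ext
      by (simp add: PiE_def Pi_def flip: of_nat_sum)
    have E: "int (?E f \<rho>) * int ?n = int ?n ^ (?m - 1) * ?D f \<rho>" if \<rho>: "\<rho> \<in> M" for \<rho>
    proof -
      have "int (?E f \<rho>) * int ?n = int ?n ^ card (M - {\<rho>}) * (int ?n - (\<Sum>a\<in>M - {\<rho>}. ?D f a))"
        by (rule card_forest_extensions)
          (use fin KM ac in \<open>auto simp: single_valued_parent_rel simp del: Domain_Un_eq\<close>)
      moreover have "int ?n = ?D f \<rho> + (\<Sum>a\<in>M - {\<rho>}. ?D f a)"
        using tot sum.remove[OF fin(2) \<rho>, of "?D f"] by simp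
      ultimately show ?thesis using \<rho> by (simp add: card_Diff_singleton)
    qed
    have "(\<Sum>\<rho>\<in>M. int (?E f \<rho>)) * int ?n = (\<Sum>\<rho>\<in>M. int ?n ^ (?m - 1) * ?D f \<rho>)"
      unfolding sum_distrib_right by (intro sum.cong refl E)
    also have "\<dots> = int ?n ^ (?m - 1) * int ?n" by (simp only: sum_distrib_left[symmetric] tot)
    finally have "(\<Sum>\<rho>\<in>M. int (?E f \<rho>)) * int ?n = int ?n ^ (?m - 1) * int ?n" .
    then show ?thesis using n0 by simp
  qed
  then have "int (\<Sum>f\<in>?F. \<Sum>\<rho>\<in>M. ?E f \<rho>) = int (card ?F * ?n ^ (?m - 1))" by simp
  moreover have "(\<Sum>f\<in>?F. \<Sum>\<rho>\<in>M. ?E f \<rho>) = (\<Sum>\<rho>\<in>M. \<Sum>f\<in>?F. ?E f \<rho>)" by (rule sum.swap)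
  ultimately have "(\<Sum>\<rho>\<in>M. \<Sum>f\<in>?F. ?E f \<rho>) = card ?F * ?n ^ (?m - 1)" by linarith
  then show ?thesis using card_parent_functions_hanging[OF fin KM, of _ I S] S by simp
qed

section \<open>Trees as parent functions\<close>

definition parent_edges :: "'a set \<Rightarrow> ('a \<Rightarrow> 'a) \<Rightarrow> 'a set set" where
  "parent_edges A f = (\<lambda>v. {v, f v}) ` A"

lemma sym_adj_rel: "sym (adj_rel E)"
  by (auto simp: sym_def adj_rel_def insert_commute)

lemma adj_rel_rtrancl_sym: "(u, v) \<in> (adj_rel E)\<^sup>* \<Longrightarrow> (v, u) \<in> (adj_rel E)\<^sup>*"
  using sym_rtrancl[OF sym_adj_rel] by (rule symD)

lemma acyclic_parent_neq: "acyclic (parent_rel A f) \<Longrightarrow> v \<in> A \<Longrightarrow> f v \<noteq> v"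
  by (force simp: acyclic_def parent_rel_def)

lemma acyclic_parent_neq2:
  assumes "acyclic (parent_rel A f)" "v \<in> A" "f v \<in> A" shows "f (f v) \<noteq> v"
proof
  assume "f (f v) = v"
  have "(v, f v) \<in> parent_rel A f" "(f v, f (f v)) \<in> parent_rel A f"
    using assms by (auto simp: parent_rel_def)
  then have "(v, f (f v)) \<in> (parent_rel A f)\<^sup>+" by (meson trancl.simps)
  then show False using assms(1) \<open>f (f v) = v\<close> by (auto simp: acyclic_def)
qed

lemma parent_rel_subset_adj_rel:
  assumes "acyclic (parent_rel A f)"
  shows "parent_rel A f \<subseteq> adj_rel (parent_edges A f)"
  using acyclic_parent_neq[OF assms] acyclic_parent_neq[OF assms, THEN not_sym]
  by (auto simp: parent_rel_def adj_rel_def parent_edges_def)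

text \<open>
On a cycle of the undirected graph, take a vertex with no child on the cycle. Its two neighbours
on the cycle both have to be its parent.
\<close>

lemma no_cycle_parent_edges:
  assumes fin: "finite A" and ac: "acyclic (parent_rel A f)"
  shows "\<not> is_cycle (parent_edges A f) xs"
proof
  assume c: "is_cycle (parent_edges A f) xs"
  let ?n = "length xs"
  have len: "?n \<ge> 3" and dist: "distinct xs"
    and edge: "\<And>i. i < ?n \<Longrightarrow> {xs ! i, xs ! ((i + 1) mod ?n)} \<in> parent_edges A f"
    using c by (auto simp: is_cycle_def)
  have wf: "wf (parent_rel A f)"
    using fin ac by (simp add: wf_iff_acyclic_if_finite finite_parent_rel)
  have "xs ! 0 \<in> set xs" using len by (intro nth_mem) linarith
  then obtain x where x: "x \<in> set xs" and min: "\<And>y. (y, x) \<in> parent_rel A f \<Longrightarrow> y \<notin> set xs"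
    using wfE_min[OF wf] by metis
  obtain i where i: "i < ?n" "xs ! i = x" using x by (auto simp: in_set_conv_nth)
  define p where "p = (i + ?n - 1) mod ?n"
  define q where "q = (i + 1) mod ?n"
  have pq: "p < ?n" "q < ?n" using len by (auto simp: p_def q_def intro!: mod_less_divisor)
  have p1: "(p + 1) mod ?n = i"
  proof -
    have "(p + 1) mod ?n = (i + ?n - 1 + 1) mod ?n" unfolding p_def by (rule mod_add_left_eq)
    also have "i + ?n - 1 + 1 = i + ?n" using len by simp
    finally show ?thesis using i by simp
  qed
  have "p \<noteq> q"
  proof
    assume "p = q"
    then have cyc: "(i + 1 + 1) mod ?n = i" using p1 by (simp add: q_def mod_Suc_eq)
    consider "i + 1 + 1 < ?n" | "i + 1 + 1 = ?n" | "i + 1 + 1 = 1 + ?n" using i(1) by linarith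
    then show False
    proof cases
      case 1
      then have "(i + 1 + 1) mod ?n = i + 1 + 1" by (rule mod_less)
      then show False using cyc by linarith
    next
      case 2
      then have "(i + 1 + 1) mod ?n = 0" by (metis mod_self)
      then show False using cyc len 2 by linarith
    next
      case 3
      then have "(i + 1 + 1) mod ?n = 1 mod ?n" by (metis mod_add_self2)
      also have "\<dots> = 1" using len by (intro mod_less) linarith
      finally show False using cyc len 3 by linarith
    qed
  qed
  then have neq: "xs ! p \<noteq> xs ! q" using pq dist by (simp add: nth_eq_iff_index_eq)
  have par: "y = f x" if xy: "{x, y} \<in> parent_edges A f" "y \<in> set xs" for y
  proof -
    obtain v where v: "v \<in> A" "{x, y} = {v, f v}" using xy(1) unfolding parent_edges_def by (elim imageE)
    show ?thesis
    proof (cases "v = x")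
      case True
      then show ?thesis using v(2) acyclic_parent_neq[OF ac v(1)] by (auto simp: doubleton_eq_iff)
    next
      case False
      then have "v = y" "f y = x" using v(2) by (auto simp: doubleton_eq_iff)
      then have "(y, x) \<in> parent_rel A f" using v by (auto simp: parent_rel_def)
      then show ?thesis using min that by blast
    qed
  qed
  have "xs ! q = f x" using edge[OF i(1)] i pq by (intro par) (auto simp: q_def)
  moreover have "xs ! p = f x" using edge[OF pq(1)] i pq
    by (intro par) (auto simp: p1[simplified] insert_commute)
  ultimately show False using neq by simp
qed

lemma is_tree_parent_edges:
  assumes "finite V" "\<rho> \<in> V" "f \<in> parent_functions V \<rho>"
  shows "is_tree V (parent_edges (V - {\<rho>}) f)"
proof -
  let ?A = "V - {\<rho>}"
  have ext: "f \<in> ?A \<rightarrow>\<^sub>E V" and ac: "acyclic (parent_rel ?A f)"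
    using assms(3) by (auto simp: parent_functions_def)
  have fv: "f v \<in> V" if "v \<in> ?A" for v using ext that by (auto simp: PiE_def Pi_def)
  have fin: "finite ?A" using assms by simp
  have "simple_graph V (parent_edges ?A f)"
    using assms(1) fv acyclic_parent_neq[OF ac] by (auto simp: simple_graph_def parent_edges_def card_2_iff)
  moreover have "connected_graph V (parent_edges ?A f)"
  proof -
    have to: "(x, \<rho>) \<in> (adj_rel (parent_edges ?A f))\<^sup>*" if "x \<in> V" for x
    proof -
      have "\<exists>a\<in>{\<rho>}. (x, a) \<in> (parent_rel ?A f)\<^sup>*"
        by (rule reaches_sink[OF fin ac]) (use fv assms(2) that in auto)
      then show ?thesis using rtrancl_mono[OF parent_rel_subset_adj_rel[OF ac]] by blast
    qed
    have "(u, v) \<in> (adj_rel (parent_edges ?A f))\<^sup>*" if "u \<in> V" "v \<in> V" for u v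
      using to[OF that(1)] adj_rel_rtrancl_sym[OF to[OF that(2)]] by (rule rtrancl_trans)
    then show ?thesis using assms(2) by (auto simp: connected_graph_def)
  qed
  ultimately show ?thesis using no_cycle_parent_edges[OF fin ac] by (simp add: is_tree_def)
qed

text \<open>
The root and the set of edges determine the parents by induction on the distance from the root: an
edge between \<open>x\<close> and \<open>f x\<close> could only be directed differently in \<open>g\<close> if \<open>g (f x) = x\<close>, but by
induction \<open>g (f x) = f (f x)\<close>, which is not \<open>x\<close>.
\<close>

lemma inj_on_parent_edges:
  assumes "finite V"
  shows "inj_on (parent_edges (V - {\<rho>})) (parent_functions V \<rho>)"
proof (rule inj_onI)
  let ?A = "V - {\<rho>}"
  fix f g assume f: "f \<in> parent_functions V \<rho>" and g: "g \<in> parent_functions V \<rho>"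
    and eq: "parent_edges ?A f = parent_edges ?A g"
  have ef: "f \<in> ?A \<rightarrow>\<^sub>E V" and af: "acyclic (parent_rel ?A f)"
    and eg: "g \<in> ?A \<rightarrow>\<^sub>E V" and ag: "acyclic (parent_rel ?A g)"
    using f g by (auto simp: parent_functions_def)
  have fin: "finite ?A" using assms by simp
  have "x \<in> ?A \<longrightarrow> f x = g x" for x using fin af
  proof (induction x rule: acyclic_parent_rel_induct)
    case (step x)
    then have "{x, f x} \<in> parent_edges ?A g" unfolding eq[symmetric] by (auto simp: parent_edges_def)
    then obtain v where v: "v \<in> ?A" "{x, f x} = {v, g v}"
      unfolding parent_edges_def by (elim imageE)
    show ?case
    proof (cases "v = x")
      case True
      then show ?thesis using v acyclic_parent_neq[OF ag v(1)] by (auto simp: doubleton_eq_iff)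
    next
      case False
      then have v': "v = f x" "g v = x" using v(2) by (auto simp: doubleton_eq_iff)
      then have "f (f x) = x" using step.IH v(1) by simp
      then show ?thesis using acyclic_parent_neq2[OF af, of x] step.hyps v(1) v'(1) by simp
    qed
  qed auto
  then show "f = g" using ef eg by (intro PiE_ext[OF ef eg]) blast
qed

lemma rtrancl_imp_distinct_path:
  assumes "(u, v) \<in> r\<^sup>*"
  shows "\<exists>xs. xs \<noteq> [] \<and> hd xs = u \<and> last xs = v \<and> distinct xs \<and> successively (\<lambda>x y. (x, y) \<in> r) xs"
  using assms
proof (induction rule: converse_rtrancl_induct)
  case base
  then show ?case by (intro exI[of _ "[v]"]) simp
next
  case (step u w)
  then obtain xs where xs: "xs \<noteq> []" "hd xs = w" "last xs = v" "distinct xs"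
      "successively (\<lambda>x y. (x, y) \<in> r) xs" by blast
  show ?case
  proof (cases "u \<in> set xs")
    case True
    then obtain ys zs where "xs = ys @ u # zs" by (auto dest: split_list)
    then show ?thesis using xs by (intro exI[of _ "u # zs"]) (auto simp: successively_append_iff)
  next
    case False
    then show ?thesis using xs step(1) by (intro exI[of _ "u # xs"]) (auto simp: successively_Cons)
  qed
qed

text \<open>
The parent of \<open>v\<close> is a neighbour that is closer to \<open>\<rho>\<close>. The resulting edges already connect all
vertices, so any further edge of the tree would close a cycle.
\<close>

lemma tree_has_parent_function:
  assumes V: "finite V" "\<rho> \<in> V" and E: "is_tree V E"
  shows "\<exists>f\<in>parent_functions V \<rho>. parent_edges (V - {\<rho>}) f = E"
proof -
  let ?R = "adj_rel E" and ?A = "V - {\<rho>}"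
  have sg: "\<And>e. e \<in> E \<Longrightarrow> e \<subseteq> V \<and> card e = 2" and con: "\<And>u v. u \<in> V \<Longrightarrow> v \<in> V \<Longrightarrow> (u, v) \<in> ?R\<^sup>*"
    and nocyc: "\<And>xs. \<not> is_cycle E xs"
    using E by (auto simp: is_tree_def simple_graph_def connected_graph_def)
  define d where "d v = (LEAST k. (v, \<rho>) \<in> ?R ^^ k)" for v
  have closer: "\<exists>w. (v, w) \<in> ?R \<and> d w < d v" if v: "v \<in> ?A" for v
  proof -
    have "\<exists>k. (v, \<rho>) \<in> ?R ^^ k" using con[of v \<rho>] v V by (auto simp: rtrancl_power)
    then have dv: "(v, \<rho>) \<in> ?R ^^ d v" unfolding d_def by (rule LeastI_ex)
    have "d v \<noteq> 0" using dv v by (metis DiffE relpow_0_E singletonI)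
    then obtain k where k: "d v = Suc k" by (cases "d v") auto
    obtain w where w: "(v, w) \<in> ?R" "(w, \<rho>) \<in> ?R ^^ k" using dv unfolding k by (meson relpow_Suc_D2)
    have "d w \<le> k" unfolding d_def using w(2) by (rule Least_le)
    then show ?thesis using w k by auto
  qed
  define f where "f = restrict (\<lambda>v. SOME w. (v, w) \<in> ?R \<and> d w < d v) ?A"
  have f: "(v, f v) \<in> ?R" "d (f v) < d v" if "v \<in> ?A" for v
    using someI_ex[OF closer[OF that]] that by (auto simp: f_def)
  have "f v \<in> V" if "v \<in> ?A" for v using f(1)[OF that] sg by (auto simp: adj_rel_def)
  then have "f \<in> ?A \<rightarrow>\<^sub>E V" by (intro PiE_I) (auto simp: f_def)
  moreover have "acyclic (parent_rel ?A f)"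
  proof -
    have "(parent_rel ?A f)\<inverse> \<subseteq> Wellfounded.measure d"
    proof
      fix p assume "p \<in> (parent_rel ?A f)\<inverse>"
      then obtain v where "v \<in> ?A" "p = (f v, v)" unfolding parent_rel_def by blast
      then show "p \<in> Wellfounded.measure d" using f(2)[of v] by simp
    qed
    then have "acyclic ((parent_rel ?A f)\<inverse>)" by (meson wf_acyclic wf_measure wf_subset)
    then show ?thesis by simp
  qed
  ultimately have fpf: "f \<in> parent_functions V \<rho>" by (simp add: parent_functions_def)
  let ?F = "parent_edges ?A f"
  have FE: "?F \<subseteq> E" using f(1) by (auto simp: parent_edges_def adj_rel_def)
  have "e \<in> ?F" if e: "e \<in> E" for e
  proof (rule ccontr)
    assume ne: "e \<notin> ?F"
    obtain u v where uv: "e = {u, v}" "u \<noteq> v" "u \<in> V" "v \<in> V"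
      using sg[OF e] by (auto simp: card_2_iff)
    have "(u, v) \<in> (adj_rel ?F)\<^sup>*"
      using is_tree_parent_edges[OF V fpf] uv by (auto simp: is_tree_def connected_graph_def)
    then obtain xs where xs: "xs \<noteq> []" "hd xs = u" "last xs = v" "distinct xs"
        "successively (\<lambda>x y. (x, y) \<in> adj_rel ?F) xs"
      using rtrancl_imp_distinct_path by metis
    have nth: "(xs ! i, xs ! Suc i) \<in> adj_rel ?F" if "Suc i < length xs" for i
      using xs(5) that by (auto simp: successively_conv_nth)
    have hl: "xs ! 0 = u" "xs ! (length xs - 1) = v" using xs(1-3) by (auto simp: hd_conv_nth last_conv_nth)
    have l1: "length xs \<noteq> 1" using hl uv(2) by auto
    have l2: "length xs \<noteq> 2"
    proof
      assume l: "length xs = 2"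
      then have "(u, v) \<in> adj_rel ?F" using nth[of 0] hl by simp
      then show False using ne uv(1) by (simp add: adj_rel_def)
    qed
    have len: "length xs \<ge> 3" proof -
      have "length xs \<noteq> 0" using xs(1) by simp
      then show ?thesis using l1 l2 by linarith
    qed
    have "{xs ! i, xs ! ((i + 1) mod length xs)} \<in> E" if i: "i < length xs" for i
    proof (cases "Suc i < length xs")
      case True
      then show ?thesis using nth[OF True] FE by (auto simp: adj_rel_def)
    next
      case False
      then have "Suc i = length xs" using i by simp
      then have "i = length xs - 1" "(i + 1) mod length xs = 0" by auto
      then show ?thesis using hl e uv(1) by (simp add: insert_commute)
    qed
    then have "is_cycle E xs" using len xs(4) by (simp add: is_cycle_def)
    then show False using nocyc by simp
  qed
  then show ?thesis using fpf FE by blast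
qed

lemma bij_betw_parent_edges:
  assumes "finite V" "\<rho> \<in> V"
  shows "bij_betw (parent_edges (V - {\<rho>})) (parent_functions V \<rho>) {E. is_tree V E}"
  unfolding bij_betw_def
  using inj_on_parent_edges[OF assms(1)] is_tree_parent_edges[OF assms] tree_has_parent_function[OF assms]
  by (auto simp: image_iff) metis

text \<open>
Inside \<open>K\<close> the edges are those between a vertex and its parent. A set \<open>S\<close> that satisfies
\<open>hangs_off\<close> is closed under these edges, and its vertices lead to its unique exit vertex.
Conversely, two exit vertices of a component could not be connected, since every vertex leads to
only one exit.
\<close>

lemma hangs_off_iff_component:
  assumes fin: "finite K" "finite M" and KM: "K \<inter> M = {}" and \<rho>: "\<rho> \<in> M" and S: "S \<subseteq> K"
    and f: "f \<in> parent_functions (K \<union> M) \<rho>"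
  shows "hangs_off K M f S \<longleftrightarrow>
    S \<in> graph_components K (induced_edges K (parent_edges (K \<union> M - {\<rho>}) f))"
proof -
  let ?A = "K \<union> M - {\<rho>}"
  define R where "R = adj_rel (induced_edges K (parent_edges ?A f))"
  have ext: "f \<in> ?A \<rightarrow>\<^sub>E K \<union> M" and ac: "acyclic (parent_rel ?A f)"
    using f by (auto simp: parent_functions_def)
  have finA: "finite ?A" using fin by simp
  have KA: "x \<in> ?A" if "x \<in> K" for x using that KM \<rho> by auto
  have fv: "f v \<in> K \<union> M" if "v \<in> K" for v using ext KA[OF that] by (auto simp: PiE_def Pi_def)
  have up: "(x, f x) \<in> R" "(f x, x) \<in> R" if "x \<in> K" "f x \<in> K" for x
  proof -
    have "f x \<noteq> x" using acyclic_parent_neq[OF ac KA[OF that(1)]] .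
    moreover have "{x, f x} \<in> parent_edges ?A f" using KA[OF that(1)] by (auto simp: parent_edges_def)
    ultimately show "(x, f x) \<in> R" "(f x, x) \<in> R" using that
      by (auto simp: R_def adj_rel_def induced_edges_def insert_commute)
  qed
  have R: "x \<in> K \<and> y \<in> K \<and> (y = f x \<or> x = f y)" if "(x, y) \<in> R" for x y
  proof -
    have xy: "x \<in> K" "y \<in> K" "{x, y} \<in> parent_edges ?A f"
      using that by (auto simp: R_def adj_rel_def induced_edges_def)
    obtain v where "{x, y} = {v, f v}" using xy(3) unfolding parent_edges_def by (elim imageE)
    then show ?thesis using xy by (auto simp: doubleton_eq_iff)
  qed
  show ?thesis unfolding graph_components_def R_def[symmetric]
  proof
    assume h: "hangs_off K M f S"
    then have "\<exists>!v. v \<in> S \<and> f v \<notin> S" by (simp add: hangs_off_def)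
    then obtain v0 where v0: "v0 \<in> S" "f v0 \<notin> S" and uniq: "\<And>v. v \<in> S \<Longrightarrow> f v \<notin> S \<Longrightarrow> v = v0"
      by metis
    have hS: "\<And>v. v \<in> S \<Longrightarrow> f v \<in> S \<union> M" and hK: "\<And>v. v \<in> K \<Longrightarrow> f v \<in> S \<Longrightarrow> v \<in> S"
      using h by (auto simp: hangs_off_def)
    have "y \<in> S" if "(v0, y) \<in> R\<^sup>*" for y using that
    proof (induction rule: rtrancl_induct)
      case (step y z)
      then show ?case using R[OF step(2)] hS[of y] hK[of z] KM by auto
    qed (rule v0)
    moreover have "x \<in> S \<longrightarrow> (v0, x) \<in> R\<^sup>*" for x using finA ac
    proof (induction x rule: acyclic_parent_rel_induct)
      case (sink x)
      then show ?case using S KA by auto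
    next
      case (step x)
      show ?case
      proof
        assume x: "x \<in> S"
        show "(v0, x) \<in> R\<^sup>*"
        proof (cases "f x \<in> S")
          case True
          then have "(v0, f x) \<in> R\<^sup>*" "(f x, x) \<in> R" using step.IH up(2)[of x] x S by auto
          then show ?thesis by (rule rtrancl_into_rtrancl)
        next
          case False
          then show ?thesis using uniq x by auto
        qed
      qed
    qed
    ultimately have "S = {v \<in> K. (v0, v) \<in> R\<^sup>*}" using S by auto
    then show "S \<in> {C. \<exists>u\<in>K. C = {v \<in> K. (u, v) \<in> R\<^sup>*}}" using v0 S by blast
  next
    assume "S \<in> {C. \<exists>u\<in>K. C = {v \<in> K. (u, v) \<in> R\<^sup>*}}"
    then obtain u where u: "u \<in> K" "S = {v \<in> K. (u, v) \<in> R\<^sup>*}" by blast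
    have clos: "y \<in> S" if "x \<in> S" "(x, y) \<in> R" for x y
      using that R[OF that(2)] u(2) by (auto intro: rtrancl_into_rtrancl)
    have SK: "x \<in> K" if "x \<in> S" for x using that u by auto
    have "u \<in> S" using u by simp
    have 1: "\<forall>v\<in>S. f v \<in> S \<union> M" using up(1) clos fv SK by blast
    have 2: "\<forall>v\<in>K - S. f v \<notin> S" using up(2) clos SK by blast
    have ex: "\<exists>v\<in>S. f v \<notin> S"
    proof (rule ccontr)
      assume n: "\<not> (\<exists>v\<in>S. f v \<notin> S)"
      have "x \<notin> S" for x using finA ac
      proof (induction x rule: acyclic_parent_rel_induct)
        case (sink x)
        then show ?case using SK KA by blast
      qed (use n in auto)
      then show False using \<open>u \<in> S\<close> by blast
    qed
    define P where "P = {(x, f x) | x. x \<in> S \<and> f x \<in> S}"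
    have uniq: "v' = v" if v: "v \<in> S" "f v \<notin> S" and v': "v' \<in> S" "f v' \<notin> S" for v v'
    proof -
      have "(v, v') \<in> R\<^sup>*"
      proof -
        have "(u, v) \<in> R\<^sup>*" using v(1) u(2) by simp
        then have "(v, u) \<in> R\<^sup>*" unfolding R_def by (rule adj_rel_rtrancl_sym)
        moreover have "(u, v') \<in> R\<^sup>*" using v'(1) u(2) by simp
        ultimately show ?thesis by (rule rtrancl_trans)
      qed
      then have "v' \<in> S \<and> (v', v) \<in> P\<^sup>*"
      proof (induction rule: rtrancl_induct)
        case base
        then show ?case using v by simp
      next
        case (step y z)
        have z: "z \<in> S" using clos step by blast
        consider "z = f y" | "y = f z" using R[OF step(2)] by blast
        then show ?case
        proof cases
          case 1
          then have "y \<noteq> v" using z v by auto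
          then obtain w where "(y, w) \<in> P" "(w, v) \<in> P\<^sup>*" using step.IH by (meson converse_rtranclE)
          then show ?thesis using 1 z by (auto simp: P_def)
        next
          case 2
          then have "(z, y) \<in> P" using z step.IH by (auto simp: P_def)
          then show ?thesis using z step.IH by (meson converse_rtrancl_into_rtrancl)
        qed
      qed
      moreover have "v' \<notin> Domain P" using v' by (auto simp: P_def)
      ultimately show ?thesis using rtrancl_from_sink by metis
    qed
    have "\<exists>!v. v \<in> S \<and> f v \<notin> S" using ex uniq by blast
    then show "hangs_off K M f S" using 1 2 by (auto simp: hangs_off_def)
  qed
qed

text \<open>
Among the rooted trees each tree occurs once for every outer root. This factor \<open>|M|\<close> cancels
against the factor \<open>|M|\<close> that is left over in \<open>card_inner_forests\<close>. The factor
\<open>card (K \<union> M - \<Union>(S ` I))\<close> on the left avoids the exponent \<open>-1\<close> that would occur on the right if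
the sets \<open>S i\<close> exhaust \<open>K\<close>.
\<close>

theorem card_trees_with_components:
  assumes I: "finite I" and fin: "finite K" "finite M" and KM: "K \<inter> M = {}" and M: "M \<noteq> {}"
    and S: "\<And>i. i \<in> I \<Longrightarrow> S i \<subseteq> K \<and> S i \<noteq> {}" and dis: "disjoint_family_on S I"
  shows "card {E. is_tree (K \<union> M) E \<and> (\<forall>i\<in>I. S i \<in> graph_components K (induced_edges K E))} *
      card (K \<union> M - \<Union>(S ` I)) =
    (\<Prod>i\<in>I. card M * card (S i) ^ (card (S i) - 1)) *
      card (K \<union> M - \<Union>(S ` I)) ^ card (K - \<Union>(S ` I)) * card (K \<union> M) ^ (card M - 1)"
proof -
  let ?T = "{E. is_tree (K \<union> M) E \<and> (\<forall>i\<in>I. S i \<in> graph_components K (induced_edges K E))}"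
  let ?r = "card (K \<union> M - \<Union>(S ` I))"
  have eq: "card {f \<in> parent_functions (K \<union> M) \<rho>. \<forall>i\<in>I. hangs_off K M f (S i)} = card ?T"
    if \<rho>: "\<rho> \<in> M" for \<rho>
  proof -
    let ?e = "parent_edges (K \<union> M - {\<rho>})"
    let ?P = "\<lambda>E. \<forall>i\<in>I. S i \<in> graph_components K (induced_edges K E)"
    have bij: "bij_betw ?e (parent_functions (K \<union> M) \<rho>) {E. is_tree (K \<union> M) E}"
      using \<rho> fin by (intro bij_betw_parent_edges) auto
    have "{f \<in> parent_functions (K \<union> M) \<rho>. \<forall>i\<in>I. hangs_off K M f (S i)} =
        {f \<in> parent_functions (K \<union> M) \<rho>. ?P (?e f)}"
      using hangs_off_iff_component[OF fin KM \<rho>] S by blast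
    moreover have "bij_betw ?e {f \<in> parent_functions (K \<union> M) \<rho>. ?P (?e f)} {E \<in> {E. is_tree (K \<union> M) E}. ?P E}"
    proof (rule bij_betw_subset[OF bij])
      show "?e ` {f \<in> parent_functions (K \<union> M) \<rho>. ?P (?e f)} = {E \<in> {E. is_tree (K \<union> M) E}. ?P E}"
        unfolding bij_betw_imp_surj_on[OF bij, symmetric] by (simp only: Compr_image_eq)
    qed auto
    ultimately show ?thesis by (auto dest!: bij_betw_same_card)
  qed
  have m: "card M > 0" using M fin by (auto simp: card_gt_0_iff)
  have "card M * card ?T = card (inner_forests K M I S) * card (K \<union> M) ^ (card M - 1)"
    using sum_card_parent_functions_hanging[OF fin KM M, of I S] S eq by simp
  then have "card M * (card ?T * ?r) =
      (card (inner_forests K M I S) * ?r) * card (K \<union> M) ^ (card M - 1)"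
    by (simp add: mult.assoc mult.left_commute mult.commute)
  also have "card (inner_forests K M I S) * ?r =
    (\<Prod>i\<in>I. card M * card (S i) ^ (card (S i) - 1)) * card M * ?r ^ card (K - \<Union>(S ` I))"
    by (rule card_inner_forests) (use assms in auto)
  finally show ?thesis using m by (simp add: mult.assoc mult.left_commute)
qed

section \<open>Expected number of tuples of components\<close>

definition disjoint_tuples :: "'a set \<Rightarrow> 'i set \<Rightarrow> ('i \<Rightarrow> nat) \<Rightarrow> ('i \<Rightarrow> 'a set) set" where
  "disjoint_tuples K I s =
     {S \<in> I \<rightarrow>\<^sub>E Pow K. disjoint_family_on S I \<and> (\<forall>i\<in>I. card (S i) = s i)}"

lemma finite_disjoint_tuples: "finite I \<Longrightarrow> finite K \<Longrightarrow> finite (disjoint_tuples K I s)"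
  unfolding disjoint_tuples_def by (rule finite_subset[OF _ finite_PiE[of I "\<lambda>_. Pow K"]]) auto

lemma disjoint_tuples_insert:
  assumes "i \<notin> I"
  shows "disjoint_tuples K (insert i I) s =
    (\<lambda>(T, S). S(i := T)) ` (SIGMA T : {T. T \<subseteq> K \<and> card T = s i}. disjoint_tuples (K - T) I s)"
    (is "?L = ?g ` ?R")
proof -
  have "S \<in> ?g ` ?R" if S: "S \<in> ?L" for S
  proof -
    have ext: "S \<in> insert i I \<rightarrow>\<^sub>E Pow K" and dis: "disjoint_family_on S (insert i I)"
      and c: "\<And>k. k \<in> insert i I \<Longrightarrow> card (S k) = s k"
      using S by (auto simp: disjoint_tuples_def)
    have SK: "S k \<subseteq> K" if "k \<in> insert i I" for k using ext that by (auto simp: PiE_def Pi_def)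
    have d: "S k \<inter> S i = {}" if "k \<in> I" for k
      using dis that assms unfolding disjoint_family_on_def by (metis insertCI)
    have "restrict S I \<in> I \<rightarrow>\<^sub>E Pow (K - S i)" using SK d by (intro PiE_I) auto
    moreover have "disjoint_family_on (restrict S I) I"
      using dis by (auto simp: disjoint_family_on_def)
    ultimately have "restrict S I \<in> disjoint_tuples (K - S i) I s"
      using c by (simp add: disjoint_tuples_def)
    moreover have "S = (restrict S I)(i := S i)"
    proof
      fix k show "S k = ((restrict S I)(i := S i)) k" using PiE_arb[OF ext, of k] by auto
    qed
    ultimately show ?thesis using SK[of i] c[of i] by (intro image_eqI[of _ _ "(S i, restrict S I)"]) auto
  qed
  moreover have "?g p \<in> ?L" if p: "p \<in> ?R" for p
  proof -
    obtain T S where TS: "p = (T, S)" "T \<subseteq> K" "card T = s i" "S \<in> disjoint_tuples (K - T) I s"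
      using p by auto
    have ext: "S \<in> I \<rightarrow>\<^sub>E Pow (K - T)" and dis: "disjoint_family_on S I"
      and c: "\<And>k. k \<in> I \<Longrightarrow> card (S k) = s k"
      using TS by (auto simp: disjoint_tuples_def)
    have SK: "S k \<subseteq> K - T" if "k \<in> I" for k using ext that by (auto simp: PiE_def Pi_def)
    have "S(i := T) \<in> insert i I \<rightarrow>\<^sub>E Pow K"
      using ext TS(2) by (intro PiE_fun_upd) (auto simp: PiE_def Pi_def)
    moreover have "disjoint_family_on (S(i := T)) (insert i I)"
      using dis SK assms by (fastforce simp: disjoint_family_on_def)
    ultimately show ?thesis using c TS(1,3) assms by (auto simp: disjoint_tuples_def)
  qed
  ultimately show ?thesis by blast
qed

lemma card_disjoint_tuples_insert:
  assumes "i \<notin> I" "finite I" "finite K"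
  shows "card (disjoint_tuples K (insert i I) s) =
    (\<Sum>T | T \<subseteq> K \<and> card T = s i. card (disjoint_tuples (K - T) I s))"
proof -
  have "inj_on (\<lambda>(T, S). S(i := T)) (SIGMA T : {T. T \<subseteq> K \<and> card T = s i}. disjoint_tuples (K - T) I s)"
  proof (rule inj_onI)
    fix p q assume p: "p \<in> (SIGMA T : {T. T \<subseteq> K \<and> card T = s i}. disjoint_tuples (K - T) I s)"
      and q: "q \<in> (SIGMA T : {T. T \<subseteq> K \<and> card T = s i}. disjoint_tuples (K - T) I s)"
      and eq: "(\<lambda>(T, S). S(i := T)) p = (\<lambda>(T, S). S(i := T)) q"
    obtain T S where TS: "p = (T, S)" "S \<in> I \<rightarrow>\<^sub>E Pow (K - T)" using p by (auto simp: disjoint_tuples_def)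
    obtain T' S' where TS': "q = (T', S')" "S' \<in> I \<rightarrow>\<^sub>E Pow (K - T')" using q by (auto simp: disjoint_tuples_def)
    have e: "S(i := T) = S'(i := T')" using eq unfolding TS(1) TS'(1) by (simp only: prod.case)
    have "S k = S' k" for k
      using fun_cong[OF e, of k] PiE_arb[OF TS(2) assms(1)] PiE_arb[OF TS'(2) assms(1)]
      by (cases "k = i") auto
    moreover have "T = T'" using fun_cong[OF e, of i] by simp
    ultimately show "p = q" by (auto simp: TS(1) TS'(1))
  qed
  then have "card (disjoint_tuples K (insert i I) s) =
      card (SIGMA T : {T. T \<subseteq> K \<and> card T = s i}. disjoint_tuples (K - T) I s)"
    unfolding disjoint_tuples_insert[OF assms(1)] by (rule card_image)
  also have "\<dots> = (\<Sum>T | T \<subseteq> K \<and> card T = s i. card (disjoint_tuples (K - T) I s))"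
    using assms by (intro card_SigmaI) (auto intro!: finite_disjoint_tuples)
  finally show ?thesis .
qed

text \<open>
The multinomial coefficient, written without division.
\<close>

lemma card_disjoint_tuples:
  assumes "finite I" "finite K" "sum s I \<le> card K"
  shows "card (disjoint_tuples K I s) * (\<Prod>i\<in>I. fact (s i)) * fact (card K - sum s I) = (fact (card K) :: nat)"
  using assms
proof (induction I arbitrary: K rule: finite_induct)
  case empty
  have "disjoint_tuples K {} s = {\<lambda>_. undefined}" by (auto simp: disjoint_tuples_def disjoint_family_on_def)
  then show ?case by simp
next
  case (insert i I)
  let ?k = "card K" and ?P = "(\<Prod>i\<in>I. fact (s i)) :: nat"
  let ?r = "?k - sum s (insert i I)"
  have le: "s i + sum s I \<le> ?k" using insert by simp
  have IH: "card (disjoint_tuples (K - T) I s) * ?P * fact ?r = fact (?k - s i)"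
    if T: "T \<subseteq> K" "card T = s i" for T
  proof -
    have c: "card (K - T) = ?k - s i" using card_Diff_subset[of T K] T insert.prems finite_subset by metis
    show ?thesis using insert.IH[of "K - T"] insert.prems insert.hyps le c by simp
  qed
  have "card (disjoint_tuples K (insert i I) s) * ?P * fact ?r =
      (\<Sum>T | T \<subseteq> K \<and> card T = s i. card (disjoint_tuples (K - T) I s) * ?P * fact ?r)"
    using insert by (simp add: card_disjoint_tuples_insert sum_distrib_right)
  also have "\<dots> = (\<Sum>T | T \<subseteq> K \<and> card T = s i. fact (?k - s i))"
    by (intro sum.cong refl IH) auto
  also have "\<dots> = (?k choose s i) * fact (?k - s i)" using insert.prems by (simp add: n_subsets)
  finally have "card (disjoint_tuples K (insert i I) s) * ?P * fact ?r = (?k choose s i) * fact (?k - s i)" .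
  then have "card (disjoint_tuples K (insert i I) s) * (fact (s i) * ?P) * fact ?r =
      fact (s i) * fact (?k - s i) * (?k choose s i)"
    by (simp add: mult.assoc mult.left_commute)
  also have "\<dots> = fact ?k" using le by (intro binomial_fact_lemma) simp
  finally show ?case using insert.hyps by simp
qed

lemma disjoint_tuples_eq_empty:
  assumes "finite I" "finite K" "sum s I > card K"
  shows "disjoint_tuples K I s = {}"
proof (rule ccontr)
  assume "disjoint_tuples K I s \<noteq> {}"
  then obtain S where "S \<in> disjoint_tuples K I s" by blast
  then have S: "\<And>i. i \<in> I \<Longrightarrow> S i \<subseteq> K" "disjoint_family_on S I" "\<And>i. i \<in> I \<Longrightarrow> card (S i) = s i"
    by (auto simp: disjoint_tuples_def PiE_def Pi_def)
  have "sum s I = (\<Sum>i\<in>I. card (S i))" using S by simp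
  also have "\<dots> = card (\<Union>i\<in>I. S i)" using S assms(1,2) finite_subset[of _ K]
    by (intro card_UN_disjoint[symmetric]) (auto simp: disjoint_family_on_def)
  also have "\<dots> \<le> card K" using S by (intro card_mono assms) auto
  finally show False using assms(3) by simp
qed

definition forest_components :: "nat \<Rightarrow> nat set set \<Rightarrow> nat set set" where
  "forest_components k E = graph_components {1..k} (induced_edges {1..k} E)"

text \<open>
Tuples of components with prescribed sizes. Distinct components are disjoint, so disjointness only
prevents that a component is used twice.
\<close>

definition component_tuples :: "nat \<Rightarrow> 'i set \<Rightarrow> ('i \<Rightarrow> nat) \<Rightarrow> nat set set \<Rightarrow> ('i \<Rightarrow> nat set) set" where
  "component_tuples k I s E =
     {S \<in> I \<rightarrow>\<^sub>E forest_components k E. disjoint_family_on S I \<and> (\<forall>i\<in>I. card (S i) = s i)}"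

definition expected_tuples :: "nat \<Rightarrow> nat \<Rightarrow> 'i set \<Rightarrow> ('i \<Rightarrow> nat) \<Rightarrow> real" where
  "expected_tuples n k I s =
     (\<Sum>E\<in>labeled_trees n. real (card (component_tuples k I s E))) / real (card (labeled_trees n))"

lemma forest_components_subset: "C \<in> forest_components k E \<Longrightarrow> C \<subseteq> {1..k}"
  by (auto simp: forest_components_def graph_components_def)

lemma finite_forest_components: "finite (forest_components k E)"
  by (rule finite_subset[of _ "Pow {1..k}"]) (use forest_components_subset in auto)

lemma finite_component_tuples: "finite I \<Longrightarrow> finite (component_tuples k I s E)"
  unfolding component_tuples_def
  by (rule finite_subset[OF _ finite_PiE[of I "\<lambda>_. forest_components k E"]])
    (auto simp: finite_forest_components)

lemma card_labeled_trees_with_components: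
  assumes "k < n" "finite I" "S \<in> disjoint_tuples {1..k} I s" "\<And>i. i \<in> I \<Longrightarrow> s i > 0"
  shows "card {E \<in> labeled_trees n. \<forall>i\<in>I. S i \<in> forest_components k E} * (n - sum s I) =
    (\<Prod>i\<in>I. (n - k) * s i ^ (s i - 1)) * (n - sum s I) ^ (k - sum s I) * n ^ (n - k - 1)"
proof -
  let ?K = "{1..k}" and ?M = "{k+1..n}"
  have S: "\<And>i. i \<in> I \<Longrightarrow> S i \<subseteq> ?K" "disjoint_family_on S I" "\<And>i. i \<in> I \<Longrightarrow> card (S i) = s i"
    using assms(3) by (auto simp: disjoint_tuples_def PiE_def Pi_def)
  have KM: "?K \<union> ?M = {1..n}" "?K \<inter> ?M = {}" "?M \<noteq> {}" "card ?M = n - k" using assms(1) by auto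
  have fS: "finite (S i)" if "i \<in> I" for i using S(1)[OF that] finite_subset by blast
  have U: "\<Union>(S ` I) \<subseteq> ?K" "card (\<Union>(S ` I)) = sum s I"
  proof -
    show "\<Union>(S ` I) \<subseteq> ?K" using S(1) by auto
    have "card (\<Union>(S ` I)) = (\<Sum>i\<in>I. card (S i))" using S(2) assms(2) fS
      by (intro card_UN_disjoint) (auto simp: disjoint_family_on_def)
    then show "card (\<Union>(S ` I)) = sum s I" using S(3) by simp
  qed
  have fU: "finite (\<Union>(S ` I))" using U(1) finite_subset by blast
  have cU: "card (?K \<union> ?M - \<Union>(S ` I)) = n - sum s I" "card (?K - \<Union>(S ` I)) = k - sum s I"
  proof -
    have "\<Union>(S ` I) \<subseteq> {1..n}" using U(1) KM(1) by auto
    then show "card (?K \<union> ?M - \<Union>(S ` I)) = n - sum s I"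
      unfolding KM(1) using card_Diff_subset[OF fU] U(2) by simp
    show "card (?K - \<Union>(S ` I)) = k - sum s I"
      using card_Diff_subset[OF fU U(1)] U(2) by simp
  qed
  have "card {E. is_tree (?K \<union> ?M) E \<and> (\<forall>i\<in>I. S i \<in> graph_components ?K (induced_edges ?K E))} *
      card (?K \<union> ?M - \<Union>(S ` I)) =
    (\<Prod>i\<in>I. card ?M * card (S i) ^ (card (S i) - 1)) *
      card (?K \<union> ?M - \<Union>(S ` I)) ^ card (?K - \<Union>(S ` I)) * card (?K \<union> ?M) ^ (card ?M - 1)"
    using S KM assms(2,4) by (intro card_trees_with_components) fastforce+
  moreover have "(\<Prod>i\<in>I. card ?M * card (S i) ^ (card (S i) - 1)) = (\<Prod>i\<in>I. (n - k) * s i ^ (s i - 1))"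
    using S(3) by (intro prod.cong) (auto simp: KM(4))
  ultimately show ?thesis unfolding cU unfolding KM(1,4)
    by (simp add: labeled_trees_def forest_components_def)
qed

text \<open>
Cayley's formula, the count of trees without any prescribed component.
\<close>

theorem card_labeled_trees:
  assumes "n \<ge> 1"
  shows "card (labeled_trees n) * n = n ^ (n - 1)"
proof -
  have "(\<lambda>_. undefined) \<in> disjoint_tuples {1..n - 1} ({} :: nat set) (\<lambda>_. 0)"
    by (auto simp: disjoint_tuples_def disjoint_family_on_def)
  from card_labeled_trees_with_components[OF _ _ this, of n] show ?thesis using assms by simp
qed

text \<open>
Double counting of the pairs of a tree and a tuple of its components.
\<close>

lemma sum_card_component_tuples:
  assumes "finite I"
  shows "(\<Sum>E\<in>labeled_trees n. card (component_tuples k I s E)) =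
    (\<Sum>S\<in>disjoint_tuples {1..k} I s. card {E \<in> labeled_trees n. \<forall>i\<in>I. S i \<in> forest_components k E})"
proof -
  have "component_tuples k I s E = {S \<in> disjoint_tuples {1..k} I s. \<forall>i\<in>I. S i \<in> forest_components k E}" for E
    using forest_components_subset[of _ k E]
    by (fastforce simp: component_tuples_def disjoint_tuples_def PiE_def Pi_def)
  moreover have "(\<Sum>E\<in>labeled_trees n. card {S \<in> disjoint_tuples {1..k} I s. \<forall>i\<in>I. S i \<in> forest_components k E}) =
    (\<Sum>S\<in>disjoint_tuples {1..k} I s. card {E \<in> labeled_trees n. \<forall>i\<in>I. S i \<in> forest_components k E})"
    using assms by (intro sum_multicount_gen) (auto simp: finite_labeled_trees finite_disjoint_tuples)
  ultimately show ?thesis by simp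
qed

text \<open>
The number of tuples of disjoint sets with the given sizes is a multinomial coefficient, and by
the count of trees each such tuple occurs equally often.
\<close>

theorem expected_tuples_eq:
  assumes k: "k < n" and I: "finite I" and s: "\<And>i. i \<in> I \<Longrightarrow> s i > 0" and le: "sum s I \<le> k"
  shows "expected_tuples n k I s =
    fact k / fact (k - sum s I) * (\<Prod>i\<in>I. real (n - k) * real (s i) ^ (s i - 1) / fact (s i)) *
    (real (n - sum s I) ^ (k - sum s I) / real (n - sum s I)) * (real n / real n ^ k)"
proof -
  define r where "r = n - sum s I"
  define l where "l = k - sum s I"
  define W where "W = (\<Prod>i\<in>I. (n - k) * s i ^ (s i - 1))"
  define X where "X = (\<Sum>E\<in>labeled_trees n. card (component_tuples k I s E))"
  define P where "P = ((\<Prod>i\<in>I. fact (s i)) :: nat)"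
  let ?D = "disjoint_tuples {1..k} I s"
  have "r > 0" "n > 0" using k le by (simp_all add: r_def)
  then have r: "real r > 0" and n: "real n > 0" by simp_all
  have P: "real P > 0" by (simp add: P_def prod_pos)
  have "X * r = (\<Sum>S\<in>?D. W * r ^ l * n ^ (n - k - 1))"
    unfolding X_def sum_card_component_tuples[OF I] sum_distrib_right r_def l_def W_def
    by (intro sum.cong refl card_labeled_trees_with_components k I s)
  then have "X * r = card ?D * (W * r ^ l * n ^ (n - k - 1))" by simp
  then have "X * r * P * fact l = (card ?D * P * fact l) * (W * r ^ l * n ^ (n - k - 1))" by simp
  also have "card ?D * P * fact l = fact k"
    using card_disjoint_tuples[of I "{1..k}" s] I le by (simp add: l_def P_def)
  finally have "real (X * r * P * fact l) = real (fact k * (W * r ^ l * n ^ (n - k - 1)))" by simp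
  then have X: "real X = fact k * W * r ^ l * n ^ (n - k - 1) / (r * P * fact l)"
    using r P by (simp add: field_simps)
  have T: "real (card (labeled_trees n)) = real n ^ (n - 1) / n"
  proof -
    have "real (card (labeled_trees n) * n) = real (n ^ (n - 1))"
      using card_labeled_trees[of n] k by simp
    then show ?thesis using n by (simp add: field_simps)
  qed
  have "n - 1 = (n - k - 1) + k" using k by simp
  then have "real n ^ (n - 1) = real n ^ (n - k - 1) * real n ^ k" by (metis power_add)
  then have N: "real n ^ (n - k - 1) / (real n ^ (n - 1) / n) = n / real n ^ k" using n by (simp add: field_simps)
  have "expected_tuples n k I s = real X / (real n ^ (n - 1) / n)"
    unfolding expected_tuples_def T X_def by simp
  also have "\<dots> = fact k * W * r ^ l / (r * P * fact l) * (real n ^ (n - k - 1) / (real n ^ (n - 1) / n))"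
    unfolding X by simp
  also have "\<dots> = fact k * W * r ^ l / (r * P * fact l) * (n / real n ^ k)"
    unfolding N ..
  also have "\<dots> = fact k / fact l * (real W / real P) * (real r ^ l / real r) * (n / real n ^ k)"
    by simp
  also have "real W / real P = (\<Prod>i\<in>I. real (n - k) * real (s i) ^ (s i - 1) / fact (s i))"
    by (simp add: W_def P_def prod_dividef)
  finally show ?thesis by (simp only: r_def l_def)
qed

lemma expected_tuples_eq_0:
  assumes "finite I" "sum s I > k"
  shows "expected_tuples n k I s = 0"
  using sum_card_component_tuples[OF assms(1), where n = n and k = k and s = s] assms
  by (simp add: expected_tuples_def disjoint_tuples_eq_empty flip: of_nat_sum)

section \<open>Stirling's formula\<close>

text \<open>
The quotient of \<open>n!\<close> and its Stirling approximation, up to the constant \<open>sqrt (2 * pi)\<close>. At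
\<open>n = 0\<close> it is \<open>0\<close> by division by zero.
\<close>

definition stirling_ratio :: "nat \<Rightarrow> real" where
  "stirling_ratio n = fact n / (sqrt (real n) * (real n / exp 1) ^ n)"

lemma stirling_ratio_pos: "n > 0 \<Longrightarrow> stirling_ratio n > 0"
  by (simp add: stirling_ratio_def)

lemma ln_stirling_ratio:
  assumes "n > 0"
  shows "ln (stirling_ratio n) = ln (fact n) - (real n + 1/2) * ln (real n) + real n"
proof -
  have "ln ((real n / exp 1) ^ n) = real n * (ln (real n) - 1)"
    using assms by (subst ln_realpow) (auto simp: ln_div)
  then show ?thesis using assms
    by (simp add: stirling_ratio_def ln_div ln_mult ln_sqrt algebra_simps)
qed

text \<open>
The increments of the logarithm are of order \<open>n ^ (-2)\<close>.
\<close>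

lemma convergent_ln_stirling_ratio: "convergent (\<lambda>n. ln (stirling_ratio n))"
proof -
  let ?a = "\<lambda>n. ln (stirling_ratio n)"
  have "(\<lambda>n. 1 - (real n + 1/2) * ln (1 + 1 / real n)) \<in> O(\<lambda>n. 1 / real n ^ 2)"
    by real_asymp
  moreover have "eventually (\<lambda>n. ?a (Suc n) - ?a n = 1 - (real n + 1/2) * ln (1 + 1 / real n)) sequentially"
    using eventually_gt_at_top[of 0]
  proof eventually_elim
    case (elim n)
    have "1 + 1 / real n = (real n + 1) / real n" using elim by (simp add: field_simps)
    then have l: "ln (1 + 1 / real n) = ln (real n + 1) - ln (real n)" using elim by (simp add: ln_div)
    have "ln (fact (Suc n)) = ln (real n + 1) + ln (fact n :: real)"
      by (simp add: ln_mult add.commute del: of_nat_Suc)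
    then show ?case using elim ln_stirling_ratio[of n] ln_stirling_ratio[of "Suc n"] unfolding l
      by (simp add: algebra_simps)
  qed
  ultimately have "(\<lambda>n. ?a (Suc n) - ?a n) \<in> O(\<lambda>n. 1 / real n ^ 2)"
    by (subst landau_o.big.in_cong) auto
  moreover have "summable (\<lambda>n. norm (1 / real n ^ 2))"
    using inverse_power_summable[of 2] by (simp add: inverse_eq_divide)
  ultimately have "summable (\<lambda>n. ?a (Suc n) - ?a n)" by (rule summable_comparison_test_bigo[rotated])
  then have "convergent (\<lambda>n. \<Sum>i<n. ?a (Suc i) - ?a i)" by (simp add: summable_iff_convergent)
  then have "convergent (\<lambda>n. ?a n - ?a 0)" by (simp only: sum_lessThan_telescope[of ?a])
  then obtain L where "(\<lambda>n. ?a n - ?a 0) \<longlonglongrightarrow> L" by (auto simp: convergent_def)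
  from tendsto_add[OF this tendsto_const[of "?a 0"]] show ?thesis by (auto simp: convergent_def)
qed

lemma wallis_product_eq:
  "(\<Prod>k=1..n. (4 * real k ^ 2) / (4 * real k ^ 2 - 1)) =
    2 ^ (4 * n) * fact n ^ 4 / (fact (2 * n) ^ 2 * (2 * real n + 1))"
proof (induction n)
  case (Suc n)
  have f: "fact (2 * Suc n) = (2 * real n + 2) * (2 * real n + 1) * fact (2 * n)" by (simp add: algebra_simps)
  have g: "fact (Suc n) = (real n + 1) * fact n" by (simp add: algebra_simps)
  have p: "(2::real) ^ (4 * Suc n) = 16 * 2 ^ (4 * n)" by (simp add: power_add)
  have "(\<Prod>k=1..Suc n. (4 * real k ^ 2) / (4 * real k ^ 2 - 1)) =
     2 ^ (4 * n) * fact n ^ 4 / (fact (2 * n) ^ 2 * (2 * real n + 1)) *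
       (4 * (real n + 1) ^ 2 / (4 * (real n + 1) ^ 2 - 1))"
    by (simp add: Suc.IH add.commute del: One_nat_def)
  also have "4 * (real n + 1) ^ 2 - 1 = (2 * real n + 1) * (2 * real n + 3)"
    by (simp add: power2_eq_square algebra_simps)
  also have "2 ^ (4 * n) * fact n ^ 4 / (fact (2 * n) ^ 2 * (2 * real n + 1)) *
       (4 * (real n + 1) ^ 2 / ((2 * real n + 1) * (2 * real n + 3))) =
     16 * 2 ^ (4 * n) * ((real n + 1) * fact n) ^ 4 /
       (((2 * real n + 2) * (2 * real n + 1) * fact (2 * n)) ^ 2 * (2 * real (Suc n) + 1))"
  proof -
    have alg: "a * b ^ 4 / (d ^ 2 * y) * (4 * x ^ 2 / (y * z)) = 16 * a * (x * b) ^ 4 / ((2 * x * y * d) ^ 2 * z)"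
      if "x > 0" "y > 0" "z > 0" "d > 0" for a b d x y z :: real
      using that by (simp add: field_simps power2_eq_square power4_eq_xxxx)
    show ?thesis using alg[of "real n + 1" "2 * real n + 1" "2 * real n + 3" "fact (2 * n)" "2 ^ (4 * n)" "fact n"]
      by (simp add: algebra_simps)
  qed
  finally show ?case unfolding f g p .
qed simp

text \<open>
The Wallis product is \<open>stirling_ratio n ^ 4 / stirling_ratio (2 * n) ^ 2\<close> times a rational
function of \<open>n\<close> that tends to \<open>1/4\<close>, and this determines the square of the limit.
\<close>

theorem stirling_ratio_tendsto: "stirling_ratio \<longlonglongrightarrow> sqrt (2 * pi)"
proof -
  obtain L where L: "(\<lambda>n. ln (stirling_ratio n)) \<longlonglongrightarrow> L"
    using convergent_ln_stirling_ratio by (auto simp: convergent_def)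
  define A where "A = exp L"
  have A0: "A > 0" by (simp add: A_def)
  have "(\<lambda>n. exp (ln (stirling_ratio n))) \<longlonglongrightarrow> A" unfolding A_def by (intro tendsto_exp L)
  moreover have "eventually (\<lambda>n. exp (ln (stirling_ratio n)) = stirling_ratio n) sequentially"
    using eventually_gt_at_top[of 0] by eventually_elim (simp add: stirling_ratio_pos)
  ultimately have A: "stirling_ratio \<longlonglongrightarrow> A" by (rule Lim_transform_eventually)
  have A2: "(\<lambda>n. stirling_ratio (2 * n)) \<longlonglongrightarrow> A"
    by (rule filterlim_compose[OF A]) (rule filterlim_subseq, simp add: strict_mono_def)
  have "(\<lambda>n. stirling_ratio n ^ 4 / stirling_ratio (2 * n) ^ 2 * (real n / (2 * (2 * real n + 1))))
      \<longlonglongrightarrow> A ^ 4 / A ^ 2 * (1 / 4)"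
  proof -
    have "(\<lambda>n. real n / (2 * (2 * real n + 1))) \<longlonglongrightarrow> 1 / 4" by real_asymp
    from tendsto_mult[OF tendsto_divide[OF tendsto_power[OF A] tendsto_power[OF A2]] this]
    show ?thesis using A0 by simp
  qed
  moreover have "eventually (\<lambda>n. stirling_ratio n ^ 4 / stirling_ratio (2 * n) ^ 2 * (real n / (2 * (2 * real n + 1)))
      = (\<Prod>k=1..n. (4 * real k ^ 2) / (4 * real k ^ 2 - 1))) sequentially"
    using eventually_gt_at_top[of 0]
  proof eventually_elim
    case (elim n)
    define e where "e = (real n / exp 1) ^ n"
    have e0: "e > 0" using elim by (simp add: e_def)
    have e2: "(real (2 * n) / exp 1) ^ (2 * n) = 2 ^ (2 * n) * e ^ 2"
      by (simp add: e_def power_mult_distrib power_divide flip: power_mult) (simp add: mult.commute)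
    have sr: "stirling_ratio n = fact n / (sqrt (real n) * e)"
      by (simp only: stirling_ratio_def e_def)
    have sr2: "stirling_ratio (2 * n) = fact (2 * n) / (sqrt (real (2 * n)) * (2 ^ (2 * n) * e ^ 2))"
      by (simp only: stirling_ratio_def e2)
    have s4: "sqrt (real n) ^ 4 = real n ^ 2" using power_mult[of "sqrt (real n)" 2 2] by simp
    have s2: "sqrt (real (2 * n)) ^ 2 = 2 * real n" by simp
    have p: "((2::real) ^ (2 * n)) ^ 2 = 2 ^ (4 * n)" by (simp flip: power_mult)
    have "stirling_ratio n ^ 4 = fact n ^ 4 / (real n ^ 2 * e ^ 4)"
      unfolding sr power_divide power_mult_distrib s4 ..
    moreover have alg: "F / (x ^ 2 * E) / (G / (2 * x * (T * E))) * (x / (2 * (2 * x + 1))) = T * F / (G * (2 * x + 1))"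
      if "x > 0" "E > 0" "G > 0" for F x E G T :: real
      using that by (simp add: divide_simps) (simp add: power2_eq_square)
    moreover have "stirling_ratio (2 * n) ^ 2 = fact (2 * n) ^ 2 / (2 * real n * (2 ^ (4 * n) * e ^ 4))"
      unfolding sr2 power_divide power_mult_distrib s2 p by (simp flip: power_mult)
    ultimately show ?case unfolding wallis_product_eq using elim e0
      by (simp only: alg of_nat_0_less_iff zero_less_power fact_gt_zero)
  qed
  ultimately have "(\<lambda>n. \<Prod>k=1..n. (4 * real k ^ 2) / (4 * real k ^ 2 - 1)) \<longlonglongrightarrow> A ^ 4 / A ^ 2 * (1 / 4)"
    by (rule Lim_transform_eventually)
  then have "A ^ 4 / A ^ 2 * (1 / 4) = pi / 2" using wallis LIMSEQ_unique by blast
  then have "A ^ 2 = 2 * pi" using A0 by (simp add: field_simps power2_eq_square power4_eq_xxxx)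
  then have "A = sqrt (2 * pi)" using A0 by (metis less_eq_real_def real_sqrt_unique)
  then show ?thesis using A by simp
qed

text \<open>
One constant serves for all \<open>n\<close>, since \<open>1 / 0 = 0\<close>.
\<close>

lemma stirling_ratio_bounds:
  obtains B where "B \<ge> 1" "\<And>n. stirling_ratio n \<le> B" "\<And>n. 1 / stirling_ratio n \<le> B"
proof -
  have "Bseq stirling_ratio" using stirling_ratio_tendsto by (intro convergent_imp_Bseq) (auto simp: convergent_def)
  then obtain B1 where B1: "\<And>n. norm (stirling_ratio n) \<le> B1" by (auto simp: Bseq_def)
  have "(\<lambda>n. 1 / stirling_ratio n) \<longlonglongrightarrow> 1 / sqrt (2 * pi)"
    by (intro tendsto_intros stirling_ratio_tendsto) simp
  then have "Bseq (\<lambda>n. 1 / stirling_ratio n)" by (intro convergent_imp_Bseq) (auto simp: convergent_def)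
  then obtain B2 where B2: "\<And>n. norm (1 / stirling_ratio n) \<le> B2" by (auto simp: Bseq_def)
  show thesis
  proof (rule that[of "max 1 (max B1 B2)"])
    show "stirling_ratio n \<le> max 1 (max B1 B2)" for n using B1[of n] abs_ge_self[of "stirling_ratio n"]
      by (simp only: real_norm_def; linarith)
    show "1 / stirling_ratio n \<le> max 1 (max B1 B2)" for n using B2[of n] abs_ge_self[of "1 / stirling_ratio n"]
      by (simp only: real_norm_def; linarith)
  qed simp
qed

section \<open>Asymptotics of the expected number of tuples\<close>

text \<open>
Multiplied by a factor \<open>n\<close> for each part, the expected number of tuples splits into one
\<open>part_factor\<close> for each part \<open>s\<^sub>i\<close> and this factor, which depends only on the total size \<open>\<sigma>\<close>. The
powers of \<open>e\<close> are distributed so that each factorial meets its Stirling approximation. With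
\<open>0 ^ 0 = 1\<close> the formula is also correct at \<open>\<sigma> = k\<close>.
\<close>

definition bulk_factor :: "nat \<Rightarrow> nat \<Rightarrow> nat \<Rightarrow> real" where
  "bulk_factor n k \<sigma> = (fact k * exp k / k ^ k) * (real (k - \<sigma>) ^ (k - \<sigma>) / (exp (real (k - \<sigma>)) * fact (k - \<sigma>))) *
     (real k / real n) ^ k * (real (n - \<sigma>) / real (k - \<sigma>)) ^ (k - \<sigma>) * (real n / real (n - \<sigma>))"

definition part_factor :: "nat \<Rightarrow> nat \<Rightarrow> nat \<Rightarrow> real" where
  "part_factor n k s = (real (n - k) / sqrt n) / (stirling_ratio s * (s / n * sqrt (s / n)))"

lemma fact_exp_stirling_ratio: "n > 0 \<Longrightarrow> fact n * exp n / real n ^ n = stirling_ratio n * sqrt n"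
  by (simp add: stirling_ratio_def power_divide field_simps flip: exp_of_nat_mult)

lemma part_factor_eq:
  assumes "s > 0" "n > 0"
  shows "real n * (real (n - k) * real s ^ (s - 1) / fact s) = part_factor n k s * exp s"
proof -
  have ps: "real s ^ s = real s * real s ^ (s - 1)" using assms by (cases s) auto
  have st: "stirling_ratio s = fact s * exp s / real s ^ s / sqrt s"
    using fact_exp_stirling_ratio[of s] assms by simp
  have sq: "sqrt (real s / real n) = sqrt s / sqrt n" by (rule real_sqrt_divide)
  have nn: "real n = sqrt n * sqrt n" by simp
  \<comment> \<open>With \<open>r = sqrt n\<close>, \<open>q = sqrt s\<close>, \<open>f = fact s\<close>, \<open>e = exp s\<close>, \<open>d = n - k\<close> and \<open>p = s ^ (s - 1)\<close>.\<close>
  have alg: "n' * (d * p / f) = (d / r) / (f * e / (s' * p) / q * (s' / n' * (q / r))) * e"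
    if "s' > 0" "p > 0" "f > 0" "e > 0" "q > 0" "r > 0" "n' = r * r" for n' d p f e s' q r :: real
    using that by (simp add: field_simps)
  show ?thesis unfolding part_factor_def sq st ps using assms
    by (intro alg) auto
qed

lemma bulk_prefactor_eq:
  assumes "\<sigma> \<le> k" "0 < k" "k < n"
  shows "fact k / fact (k - \<sigma>) * (real (n - \<sigma>) ^ (k - \<sigma>) / real (n - \<sigma>)) * (real n / real n ^ k) * exp \<sigma> =
    bulk_factor n k \<sigma>"
proof -
  define l where "l = k - \<sigma>"
  have e: "exp (real k) = exp \<sigma> * exp l" using assms by (simp add: l_def of_nat_diff flip: exp_add)
  show ?thesis
  proof (cases "l = 0")
    case True
    then have "k = \<sigma>" using assms by (simp add: l_def)
    then show ?thesis using assms by (simp add: bulk_factor_def power_divide mult_ac)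
  next
    case False
    then show ?thesis unfolding bulk_factor_def l_def[symmetric] e using assms
      by (simp add: power_divide mult_ac)
  qed
qed

lemma part_factor_bound:
  assumes \<alpha>: "\<alpha> > 0" and B: "\<And>n. 1 / stirling_ratio n \<le> B"
    and n: "n > 0" and s: "\<alpha> * real n \<le> real s" and c: "real (n - k) \<le> c' * sqrt n"
  shows "\<bar>part_factor n k s\<bar> \<le> c' * (B / (\<alpha> * sqrt \<alpha>))"
proof -
  have "0 < \<alpha> * real n" using \<alpha> n by simp
  then have "0 < real s" using s by linarith
  then have s0: "s > 0" by simp
  have A0: "stirling_ratio s > 0" using s0 by (rule stirling_ratio_pos)
  have an: "\<alpha> \<le> s / n" using s n by (simp add: field_simps)
  then have m: "\<alpha> * sqrt \<alpha> \<le> s / n * sqrt (s / n)" using \<alpha> by (intro mult_mono) auto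
  have as0: "\<alpha> * sqrt \<alpha> > 0" using \<alpha> by simp
  define x where "x = real (n - k) / sqrt n"
  define y where "y = (1 / stirling_ratio s) / (s / n * sqrt (s / n))"
  have "part_factor n k s = x * y" by (simp add: part_factor_def x_def y_def)
  moreover have x: "0 \<le> x" "x \<le> c'" using c n by (auto simp: x_def field_simps)
  moreover have "y \<le> B / (\<alpha> * sqrt \<alpha>)" unfolding y_def
    using B[of s] m as0 A0 by (intro frac_le) (auto intro: order_trans[OF _ B[of s]])
  moreover have "0 \<le> y" using A0 by (simp add: y_def)
  ultimately show ?thesis
    using mult_mono[of x c' y "B / (\<alpha> * sqrt \<alpha>)"] order_trans[OF x] by (simp only: abs_of_nonneg mult_nonneg_nonneg)
qed

text \<open>
The second-order term is the source of the Gaussian factor that makes the expectations bounded.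
\<close>

lemma ln_one_plus_le:
  assumes "y \<ge> (0::real)"
  shows "ln (1 + y) \<le> y - y\<^sup>2 / (2 * (1 + y))"
proof -
  define f where "f y = y - y\<^sup>2 / (2 * (1 + y)) - ln (1 + y)" for y :: real
  have "f 0 \<le> f y"
  proof (rule DERIV_nonneg_imp_nondecreasing[OF assms])
    fix x :: real assume x: "0 \<le> x" "x \<le> y"
    have "(f has_real_derivative (1 - (2 * x * (2 * (1 + x)) - x\<^sup>2 * 2) / (2 * (1 + x))\<^sup>2 - 1 / (1 + x))) (at x)"
      unfolding f_def using x by (auto intro!: derivative_eq_intros simp: power2_eq_square)
    moreover have "1 - (2 * x * (2 * (1 + x)) - x\<^sup>2 * 2) / (2 * (1 + x))\<^sup>2 - 1 / (1 + x) = x\<^sup>2 / (2 * (1 + x)\<^sup>2)"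
      using x by (simp add: divide_simps) (simp add: power2_eq_square algebra_simps)
    ultimately show "\<exists>d. (f has_real_derivative d) (at x) \<and> 0 \<le> d" by force
  qed
  then show ?thesis by (simp add: f_def)
qed

lemma square_mult_exp_le:
  assumes "d > (0::real)" "z \<ge> 0"
  shows "z\<^sup>2 * exp (- d * z) \<le> 2 / d\<^sup>2"
proof -
  have "1 + d * z + (d * z)\<^sup>2 / 2 \<le> exp (d * z)" using assms by (intro exp_lower_Taylor_quadratic) simp
  then have "(d * z)\<^sup>2 / 2 \<le> exp (d * z)" using assms by (smt (verit) mult_nonneg_nonneg)
  then have "z\<^sup>2 \<le> 2 / d\<^sup>2 * exp (d * z)" using assms by (simp add: field_simps power_mult_distrib)
  then have "z\<^sup>2 * exp (- d * z) \<le> 2 / d\<^sup>2 * exp (d * z) * exp (- d * z)" by (intro mult_right_mono) auto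
  also have "\<dots> = 2 / d\<^sup>2" by (simp flip: exp_add)
  finally show ?thesis .
qed

text \<open>
Put \<open>l = k - \<sigma>\<close>, \<open>m = n - k\<close>, \<open>r = n - \<sigma> = l + m\<close> and \<open>z = n / r\<close>. The powers \<open>(k / n) ^ k\<close> and
\<open>(r / l) ^ l\<close> are at most a constant times \<open>exp (- m)\<close> and at most \<open>exp (m - m\<^sup>2 / (2 * r))\<close>, so
their product is at most a constant times \<open>exp (- d * z)\<close> for a constant \<open>d > 0\<close>, because \<open>m\<close> is
of order \<open>sqrt n\<close>. All other factors together are at most a constant times \<open>z\<^sup>2\<close>: for \<open>l \<ge> m\<close>
because then \<open>r \<le> 2 * l\<close>, and for \<open>l < m\<close> because then \<open>sqrt n\<close> is at most a constant times \<open>z\<close>.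
\<close>

lemma bulk_factor_bound:
  assumes B: "B \<ge> 1" "\<And>n. stirling_ratio n \<le> B" "\<And>n. 1 / stirling_ratio n \<le> B"
    and c: "c > 0" "c * sqrt n \<le> real (n - k)" "real (n - k) \<le> c' * sqrt n"
    and k: "0 < k" "k < n" and \<sigma>: "\<sigma> \<le> k"
  shows "\<bar>bulk_factor n k \<sigma>\<bar> \<le> B\<^sup>2 * exp (c'\<^sup>2) * (2 + 2 * c') * (2 / (c\<^sup>2 / 2)\<^sup>2)"
proof -
  define l where "l = k - \<sigma>"
  define m where "m = n - k"
  define r where "r = n - \<sigma>"
  have rlm: "r = l + m" using k \<sigma> by (simp add: r_def l_def m_def)
  have m0: "m > 0" and r0: "r > 0" and n0: "n > 0" using k rlm by (auto simp: m_def)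
  have nkm: "n = k + m" using k by (simp add: m_def)
  have c'0: "c' > 0"
  proof -
    have "c * sqrt n > 0" using c n0 by simp
    then have "c' * sqrt n > 0" using c by linarith
    then show ?thesis using n0 by (simp add: zero_less_mult_iff)
  qed
  define z where "z = real n / real r"
  have rn: "r \<le> n" by (simp add: r_def)
  have z1: "z \<ge> 1" using r0 rn by (simp add: z_def)
  have "c\<^sup>2 * n = (c * sqrt n)\<^sup>2" by (simp add: power_mult_distrib)
  also have "\<dots> \<le> (real m)\<^sup>2" using c n0 by (intro power_mono) (auto simp: m_def)
  finally have m2l: "c\<^sup>2 * n \<le> (real m)\<^sup>2" .
  have "(real m)\<^sup>2 \<le> (c' * sqrt n)\<^sup>2" using c by (intro power_mono) (auto simp: m_def)
  then have m2u: "(real m)\<^sup>2 \<le> c'\<^sup>2 * n" by (simp add: power_mult_distrib)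
  have 1: "fact k * exp k / real k ^ k \<le> B * sqrt k"
    using fact_exp_stirling_ratio[OF k(1)] B(2)[of k] by (simp add: mult_right_mono)
  \<comment> \<open>The factor at \<open>l = 0\<close> is 1, which is where \<open>B \<ge> 1\<close> enters.\<close>
  have 2: "real l ^ l / (exp l * fact l) \<le> B * (1 / sqrt (max l 1))"
  proof (cases "l = 0")
    case False
    have "real l ^ l / (exp l * fact l) = 1 / stirling_ratio l * (1 / sqrt l)"
      using fact_exp_stirling_ratio[of l] False by (simp add: field_simps)
    also have "\<dots> \<le> B * (1 / sqrt l)" using B(3)[of l] by (intro mult_right_mono) auto
    finally have "real l ^ l / (exp l * fact l) \<le> B * (1 / sqrt l)" by simp
    moreover have "max l 1 = l" using False by simp
    ultimately show ?thesis by (simp only:)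
  qed (use B in simp)
  have 3: "(real k / real n) ^ k \<le> exp (c'\<^sup>2) * exp (- real m)"
  proof -
    have kr: "real k = real n - real m" using nkm by simp
    then have "real k / real n = 1 + (- (real m / n))" using n0 by (simp add: diff_divide_distrib)
    then have "real k / real n \<le> exp (- (real m / n))" using exp_ge_add_one_self by metis
    then have "(real k / real n) ^ k \<le> exp (- (real m / n)) ^ k" by (intro power_mono) auto
    also have "\<dots> = exp (- (real m * real k / n))" by (simp add: mult_ac flip: exp_of_nat_mult)
    also have "- (real m * real k / n) = (real m)\<^sup>2 / n - m"
      unfolding kr using n0 by (simp add: field_simps power2_eq_square)
    also have "exp ((real m)\<^sup>2 / n - m) \<le> exp (c'\<^sup>2 - m)" using m2u n0 by (simp add: field_simps)
    finally show ?thesis by (simp add: exp_diff exp_minus field_simps)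
  qed
  have 4: "(real r / real l) ^ l \<le> exp m * exp (- (c\<^sup>2 / 2) * z)"
  proof -
    have cz: "(c\<^sup>2 / 2) * z \<le> (real m)\<^sup>2 / (2 * r)" using m2l r0 by (simp add: z_def field_simps)
    have "(real r / real l) ^ l \<le> exp (m - (real m)\<^sup>2 / (2 * r))"
    proof (cases "l = 0")
      case True
      then show ?thesis using m0 rlm by (simp add: power2_eq_square)
    next
      case False
      define y where "y = real m / l"
      have y: "y > 0" "real r / real l = 1 + y" using False m0 rlm by (auto simp: y_def field_simps)
      have "(real r / real l) ^ l = exp (l * ln (1 + y))" unfolding y(2) using y(1)
        by (subst exp_of_nat_mult) simp
      also have "l * ln (1 + y) \<le> l * (y - y\<^sup>2 / (2 * (1 + y)))"
        using y(1) by (intro mult_left_mono ln_one_plus_le) auto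
      also have "\<dots> = m - (real m)\<^sup>2 / (2 * r)"
        unfolding y(2)[symmetric] using False r0 by (simp add: y_def field_simps power2_eq_square)
      finally show ?thesis by simp
    qed
    also have "\<dots> \<le> exp (m - (c\<^sup>2 / 2) * z)" using cz by simp
    also have "\<dots> = exp m * exp (- (c\<^sup>2 / 2) * z)" by (simp flip: exp_add)
    finally show ?thesis .
  qed
  have 5: "sqrt k / sqrt (max l 1) \<le> (2 + 2 * c') * z"
  proof -
    have mx: "sqrt k / sqrt (max l 1) \<le> sqrt (n / max l 1)"
      using k by (simp add: real_sqrt_divide divide_right_mono)
    also have "\<dots> \<le> (2 + 2 * c') * z"
    proof (cases "l \<ge> m")
      case True
      then have l0: "l > 0" using m0 by simp
      have "real n / max l 1 \<le> 2 * z"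
      proof -
        have "real r \<le> 2 * l" using True rlm by simp
        then show ?thesis using l0 r0 n0 by (simp add: z_def max_def field_simps)
      qed
      also have "\<dots> \<le> (2 * z)\<^sup>2" using z1 by (intro self_le_power) auto
      finally have "sqrt (n / max l 1) \<le> 2 * z" using z1 by (intro real_le_lsqrt) auto
      also have "\<dots> \<le> (2 + 2 * c') * z" using z1 c'0 by (intro mult_right_mono) auto
      finally show ?thesis .
    next
      case False
      have "real n / max l 1 \<le> n" using frac_le[of "real n" "real n" 1 "real (max l 1)"] by simp
      then have "sqrt (n / max l 1) \<le> sqrt n" by simp
      also have "sqrt n \<le> 2 * c' * z"
      proof -
        have "real r \<le> 2 * m" using False rlm by simp
        also have "\<dots> \<le> 2 * c' * sqrt n" using c by (simp add: m_def)
        finally have "sqrt n * r \<le> sqrt n * (2 * c' * sqrt n)" by (intro mult_left_mono) auto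
        also have "\<dots> = 2 * c' * n" by simp
        finally show ?thesis using r0 by (simp add: z_def field_simps)
      qed
      also have "\<dots> \<le> (2 + 2 * c') * z" using z1 by (intro mult_right_mono) auto
      finally show ?thesis .
    qed
    finally show ?thesis .
  qed
  have "\<bar>bulk_factor n k \<sigma>\<bar> = bulk_factor n k \<sigma>" by (simp add: bulk_factor_def)
  also have "\<dots> = (fact k * exp k / real k ^ k) * (real l ^ l / (exp l * fact l)) *
     (real k / real n) ^ k * (real r / real l) ^ l * z"
    by (simp add: bulk_factor_def l_def r_def z_def)
  also have "\<dots> \<le> (B * sqrt k) * (B * (1 / sqrt (max l 1))) * (exp (c'\<^sup>2) * exp (- real m)) *
      (exp m * exp (- (c\<^sup>2 / 2) * z)) * z"
    using 1 2 3 4 z1 B(1) by (intro mult_mono) auto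
  also have "\<dots> = B\<^sup>2 * exp (c'\<^sup>2) * (sqrt k / sqrt (max l 1)) * (exp (- real m) * exp m) * (z * exp (- (c\<^sup>2 / 2) * z))"
    by (simp only: power2_eq_square divide_inverse mult_ac mult_1_left mult_1_right)
  also have "exp (- real m) * exp m = 1" by (simp flip: exp_add)
  also have "B\<^sup>2 * exp (c'\<^sup>2) * (sqrt k / sqrt (max l 1)) * 1 * (z * exp (- (c\<^sup>2 / 2) * z)) \<le>
      B\<^sup>2 * exp (c'\<^sup>2) * ((2 + 2 * c') * z) * 1 * (z * exp (- (c\<^sup>2 / 2) * z))"
    using 5 z1 c'0 by (intro mult_mono) auto
  also have "\<dots> = B\<^sup>2 * exp (c'\<^sup>2) * (2 + 2 * c') * (z\<^sup>2 * exp (- (c\<^sup>2 / 2) * z))"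
    by (simp add: power2_eq_square mult_ac)
  also have "\<dots> \<le> B\<^sup>2 * exp (c'\<^sup>2) * (2 + 2 * c') * (2 / (c\<^sup>2 / 2)\<^sup>2)"
    using square_mult_exp_le[of "c\<^sup>2 / 2" z] c z1 c'0 by (intro mult_left_mono) auto
  finally show ?thesis .
qed

lemma filterlim_at_top_of_ratio:
  fixes s :: "nat \<Rightarrow> nat"
  assumes "(\<lambda>n. real (s n) / real n) \<longlonglongrightarrow> t" "t > 0"
  shows "filterlim s at_top sequentially"
proof -
  have "filterlim (\<lambda>n. real (s n) / real n * real n) at_top sequentially"
    by (rule filterlim_tendsto_pos_mult_at_top[OF assms filterlim_real_sequentially])
  moreover have "eventually (\<lambda>n. real (s n) / real n * real n = real (s n)) sequentially"
    using eventually_gt_at_top[of 0] by eventually_elim simp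
  ultimately have "filterlim (\<lambda>n. real (s n)) at_top sequentially"
    by (simp only: filterlim_cong[OF refl refl])
  then show ?thesis by (simp add: filterlim_sequentially_iff_filterlim_real)
qed

lemma part_factor_tendsto:
  assumes c: "(\<lambda>n. real (n - k n) / sqrt n) \<longlonglongrightarrow> c"
    and s: "(\<lambda>n. real (s n) / real n) \<longlonglongrightarrow> t" and t: "t > 0"
  shows "(\<lambda>n. part_factor n (k n) (s n)) \<longlonglongrightarrow> c / (sqrt (2 * pi) * (t * sqrt t))"
proof -
  have "(\<lambda>n. stirling_ratio (s n)) \<longlonglongrightarrow> sqrt (2 * pi)"
    by (rule filterlim_compose[OF stirling_ratio_tendsto filterlim_at_top_of_ratio[OF s t]])
  then show ?thesis unfolding part_factor_def using t
    by (intro tendsto_divide c tendsto_mult tendsto_real_sqrt s) auto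
qed

lemma ln_second_order: "((\<lambda>x::real. (ln (1 + x) - x) / x ^ 2) \<longlongrightarrow> - 1 / 2) (at 0)"
  by real_asymp

lemma ratio_tendsto_1:
  assumes c: "(\<lambda>n. real (n - k n) / sqrt n) \<longlonglongrightarrow> c" and kn: "eventually (\<lambda>n. k n < n) sequentially"
  shows "(\<lambda>n. real (k n) / real n) \<longlonglongrightarrow> 1"
proof -
  have inv: "(\<lambda>n. 1 / sqrt (real n)) \<longlonglongrightarrow> 0" by real_asymp
  have "(\<lambda>n. 1 - real (n - k n) / sqrt n * (1 / sqrt n)) \<longlonglongrightarrow> 1 - c * 0"
    by (intro tendsto_intros c inv)
  moreover have "eventually (\<lambda>n. 1 - real (n - k n) / sqrt n * (1 / sqrt n) = real (k n) / real n) sequentially"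
    using kn by eventually_elim (simp add: field_simps of_nat_diff)
  ultimately show ?thesis by (simp add: Lim_transform_eventually)
qed

text \<open>
The exponent \<open>k * ln (1 - m / n) + l * ln (1 + m / l)\<close> with \<open>l = k - \<sigma>\<close> is expanded to second
order, where \<open>\<phi> x = (ln (1 + x) - x) / x\<^sup>2\<close> tends to \<open>-1/2\<close>. The linear terms cancel up to
\<open>m\<^sup>2 / n\<close>, which tends to \<open>c\<^sup>2\<close>.
\<close>

lemma bulk_factor_tendsto:
  assumes c: "(\<lambda>n. real (n - k n) / sqrt n) \<longlonglongrightarrow> c" and kn: "eventually (\<lambda>n. k n < n) sequentially"
    and \<sigma>: "eventually (\<lambda>n. \<sigma> n \<le> k n) sequentially" "(\<lambda>n. real (\<sigma> n) / real n) \<longlonglongrightarrow> \<tau>"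
    and \<tau>: "\<tau> < 1"
  shows "(\<lambda>n. bulk_factor n (k n) (\<sigma> n)) \<longlonglongrightarrow>
    1 / ((1 - \<tau>) * sqrt (1 - \<tau>)) * exp (- (c\<^sup>2 * \<tau>) / (2 * (1 - \<tau>)))"
proof -
  define u where "u = 1 - \<tau>"
  have u: "u > 0" using \<tau> by (simp add: u_def)
  define m where "m n = n - k n" for n
  define l where "l n = k n - \<sigma> n" for n
  define \<phi> where "\<phi> x = (ln (1 + x) - x) / x ^ 2" for x :: real
  have n0: "eventually (\<lambda>n::nat. n > 0) sequentially" by (rule eventually_gt_at_top)
  have inv: "(\<lambda>n. 1 / sqrt (real n)) \<longlonglongrightarrow> 0" by real_asymp
  have mn: "(\<lambda>n. real (m n) / real n) \<longlonglongrightarrow> 0"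
  proof -
    have "(\<lambda>n. real (n - k n) / sqrt n * (1 / sqrt n)) \<longlonglongrightarrow> c * 0" by (intro tendsto_mult c inv)
    then show ?thesis by (simp add: m_def)
  qed
  have m2: "(\<lambda>n. real (m n) ^ 2 / real n) \<longlonglongrightarrow> c\<^sup>2"
    using tendsto_power[OF c, of 2] by (simp add: m_def power_divide)
  have kn1: "(\<lambda>n. real (k n) / real n) \<longlonglongrightarrow> 1" by (rule ratio_tendsto_1[OF c kn])
  have ln: "(\<lambda>n. real (l n) / real n) \<longlonglongrightarrow> u"
  proof -
    have "(\<lambda>n. real (k n) / real n - real (\<sigma> n) / real n) \<longlonglongrightarrow> u"
      unfolding u_def by (intro tendsto_intros kn1 \<sigma>)
    moreover have "eventually (\<lambda>n. real (k n) / real n - real (\<sigma> n) / real n = real (l n) / real n) sequentially"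
      using \<sigma>(1) by eventually_elim (simp add: l_def diff_divide_distrib of_nat_diff)
    ultimately show ?thesis by (rule Lim_transform_eventually)
  qed
  have rn: "(\<lambda>n. real (n - \<sigma> n) / real n) \<longlonglongrightarrow> u"
  proof -
    have "(\<lambda>n. 1 - real (\<sigma> n) / real n) \<longlonglongrightarrow> u" unfolding u_def by (intro tendsto_intros \<sigma>)
    moreover have "eventually (\<lambda>n. 1 - real (\<sigma> n) / real n = real (n - \<sigma> n) / real n) sequentially"
      using \<sigma>(1) kn n0 by eventually_elim (simp add: field_simps of_nat_diff)
    ultimately show ?thesis by (rule Lim_transform_eventually)
  qed
  have l_top: "filterlim l at_top sequentially" by (rule filterlim_at_top_of_ratio[OF ln u])
  have k_top: "filterlim k at_top sequentially" by (rule filterlim_at_top_of_ratio[OF kn1]) simp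
  have l0: "eventually (\<lambda>n. l n > 0) sequentially" using l_top by (rule eventually_compose_filterlim[OF eventually_gt_at_top])
  have k0: "eventually (\<lambda>n. k n > 0) sequentially" using k_top by (rule eventually_compose_filterlim[OF eventually_gt_at_top])
  have ml: "(\<lambda>n. real (m n) / real (l n)) \<longlonglongrightarrow> 0"
  proof -
    have "(\<lambda>n. (real (m n) / real n) / (real (l n) / real n)) \<longlonglongrightarrow> 0 / u"
      using u by (intro tendsto_divide mn ln) auto
    moreover have "eventually (\<lambda>n. (real (m n) / real n) / (real (l n) / real n) = real (m n) / real (l n)) sequentially"
      using n0 by eventually_elim simp
    ultimately show ?thesis by (simp add: Lim_transform_eventually)
  qed
  have \<phi>1: "(\<lambda>n. \<phi> (- (real (m n) / real n))) \<longlonglongrightarrow> - 1 / 2"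
  proof (rule filterlim_compose[OF ln_second_order[folded \<phi>_def]])
    show "filterlim (\<lambda>n. - (real (m n) / real n)) (at 0) sequentially"
    proof (rule filterlim_atI)
      show "(\<lambda>n. - (real (m n) / real n)) \<longlonglongrightarrow> 0" using tendsto_minus[OF mn] by simp
      show "eventually (\<lambda>n. - (real (m n) / real n) \<noteq> 0) sequentially"
        using kn n0 by eventually_elim (simp add: m_def)
    qed
  qed
  have \<phi>2: "(\<lambda>n. \<phi> (real (m n) / real (l n))) \<longlonglongrightarrow> - 1 / 2"
  proof (rule filterlim_compose[OF ln_second_order[folded \<phi>_def]])
    show "filterlim (\<lambda>n. real (m n) / real (l n)) (at 0) sequentially"
    proof (rule filterlim_atI[OF ml])
      show "eventually (\<lambda>n. real (m n) / real (l n) \<noteq> 0) sequentially"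
        using kn l0 by eventually_elim (simp add: m_def)
    qed
  qed
  define e where "e n = real (m n) ^ 2 / n + real (k n) / n * (real (m n) ^ 2 / n) * \<phi> (- (real (m n) / real n)) +
     (real (m n) ^ 2 / n) / (real (l n) / n) * \<phi> (real (m n) / real (l n))" for n
  have e: "e \<longlonglongrightarrow> c\<^sup>2 + 1 * c\<^sup>2 * (- 1 / 2) + c\<^sup>2 / u * (- 1 / 2)"
    unfolding e_def using u by (intro tendsto_add tendsto_mult tendsto_divide m2 kn1 \<phi>1 \<phi>2 ln) auto
  have "(\<lambda>n. stirling_ratio (k n) / stirling_ratio (l n) * sqrt ((real (k n) / n) / (real (l n) / n)) *
      exp (e n) * (1 / (real (n - \<sigma> n) / real n))) \<longlonglongrightarrow>
    sqrt (2 * pi) / sqrt (2 * pi) * sqrt (1 / u) * exp (c\<^sup>2 + 1 * c\<^sup>2 * (- 1 / 2) + c\<^sup>2 / u * (- 1 / 2)) * (1 / u)"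
    using u by (intro tendsto_mult tendsto_divide tendsto_real_sqrt tendsto_exp e kn1 ln rn tendsto_const
        filterlim_compose[OF stirling_ratio_tendsto k_top] filterlim_compose[OF stirling_ratio_tendsto l_top]) auto
  moreover have "eventually (\<lambda>n. stirling_ratio (k n) / stirling_ratio (l n) * sqrt ((real (k n) / n) / (real (l n) / n)) *
      exp (e n) * (1 / (real (n - \<sigma> n) / real n)) = bulk_factor n (k n) (\<sigma> n)) sequentially"
    using kn \<sigma>(1) l0 k0 n0
  proof eventually_elim
    case (elim n)
    have m0: "real (m n) > 0" using elim by (simp add: m_def)
    have k: "real (k n) = real n - real (m n)" using elim by (simp add: m_def of_nat_diff)
    have r: "real (n - \<sigma> n) = real (l n) + real (m n)" using elim by (simp add: m_def l_def of_nat_diff)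
    have x0: "ln (1 + x) = x + x\<^sup>2 * \<phi> x" if "x \<noteq> 0" for x using that by (simp add: \<phi>_def)
    have a: "(real (k n) / real n) ^ k n = exp (real (k n) * ln (1 + - (real (m n) / real n)))"
    proof -
      have "real (k n) / real n = 1 + - (real (m n) / real n)" using elim by (simp add: k diff_divide_distrib)
      moreover have "real (k n) / real n > 0" using elim by simp
      ultimately show ?thesis by (simp only: exp_of_nat_mult exp_ln)
    qed
    have b: "(real (n - \<sigma> n) / real (l n)) ^ l n = exp (real (l n) * ln (1 + real (m n) / real (l n)))"
    proof -
      have "real (n - \<sigma> n) / real (l n) = 1 + real (m n) / real (l n)" using elim by (simp add: r add_divide_distrib)
      moreover have "real (n - \<sigma> n) / real (l n) > 0" using elim m0 unfolding r by simp
      ultimately show ?thesis by (simp only: exp_of_nat_mult exp_ln)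
    qed
    have "real (k n) * ln (1 + - (real (m n) / real n)) + real (l n) * ln (1 + real (m n) / real (l n)) = e n"
    proof -
      have "real (k n) * ln (1 + - (real (m n) / real n)) =
          - real (k n) * (real (m n) / real n) + real (k n) / n * (real (m n) ^ 2 / n) * \<phi> (- (real (m n) / real n))"
        using elim m0 by (subst x0) (auto simp: power2_eq_square field_simps)
      also have "- real (k n) * (real (m n) / real n) = - real (m n) + real (m n) ^ 2 / n"
        using elim by (simp add: k power2_eq_square field_simps)
      finally have "real (k n) * ln (1 + - (real (m n) / real n)) = - real (m n) + real (m n) ^ 2 / n
         + real (k n) / n * (real (m n) ^ 2 / n) * \<phi> (- (real (m n) / real n))" .
      moreover have "real (l n) * ln (1 + real (m n) / real (l n)) =
         real (m n) + (real (m n) ^ 2 / n) / (real (l n) / n) * \<phi> (real (m n) / real (l n))"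
        using elim m0 by (subst x0) (auto simp: power2_eq_square field_simps)
      ultimately show ?thesis by (simp add: e_def)
    qed
    then have ex: "exp (e n) = (real (k n) / real n) ^ k n * (real (n - \<sigma> n) / real (l n)) ^ l n"
      unfolding a b by (simp flip: exp_add)
    have p: "fact (k n) * exp (real (k n)) / real (k n) ^ k n = stirling_ratio (k n) * sqrt (k n)"
      using elim by (intro fact_exp_stirling_ratio) simp
    have q: "real (l n) ^ l n / (exp (real (l n)) * fact (l n)) = 1 / (stirling_ratio (l n) * sqrt (l n))"
      using fact_exp_stirling_ratio[of "l n", symmetric] elim by simp
    have sq: "sqrt ((real (k n) / n) / (real (l n) / n)) = sqrt (k n) / sqrt (l n)"
      using elim by (simp add: real_sqrt_divide)
    show ?case unfolding bulk_factor_def l_def[symmetric] p q ex sq by simp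
  qed
  ultimately have "(\<lambda>n. bulk_factor n (k n) (\<sigma> n)) \<longlonglongrightarrow>
     sqrt (2 * pi) / sqrt (2 * pi) * sqrt (1 / u) * exp (c\<^sup>2 + 1 * c\<^sup>2 * (- 1 / 2) + c\<^sup>2 / u * (- 1 / 2)) * (1 / u)"
    by (rule Lim_transform_eventually)
  also have "c\<^sup>2 + 1 * c\<^sup>2 * (- 1 / 2) + c\<^sup>2 / u * (- 1 / 2) = - (c\<^sup>2 * \<tau>) / (2 * (1 - \<tau>))"
    using u \<tau> by (simp add: u_def field_simps)
  finally show ?thesis by (simp add: real_sqrt_divide mult_ac flip: u_def)
qed

section \<open>Convergence of the sums over component sizes\<close>

lemma scaled_expected_tuples:
  assumes k: "k < n" and I: "finite I" and s: "\<And>i. i \<in> I \<Longrightarrow> s i > 0" and le: "sum s I \<le> k" and k0: "k > 0"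
  shows "real n ^ card I * expected_tuples n k I s =
    (\<Prod>i\<in>I. part_factor n k (s i)) * bulk_factor n k (sum s I)"
proof -
  let ?X = "\<lambda>i. real (n - k) * real (s i) ^ (s i - 1) / fact (s i)"
  let ?Y = "fact k / fact (k - sum s I) * (real (n - sum s I) ^ (k - sum s I) / real (n - sum s I)) *
    (real n / real n ^ k)"
  have "real n ^ card I * (\<Prod>i\<in>I. ?X i) = (\<Prod>i\<in>I. real n * ?X i)"
    by (simp only: prod.distrib prod_constant)
  also have "\<dots> = (\<Prod>i\<in>I. part_factor n k (s i) * exp (real (s i)))"
    using s k by (intro prod.cong refl part_factor_eq) auto
  also have "\<dots> = (\<Prod>i\<in>I. part_factor n k (s i)) * exp (real (sum s I))"
    by (simp add: prod.distrib exp_sum I)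
  finally have X: "real n ^ card I * (\<Prod>i\<in>I. ?X i) = (\<Prod>i\<in>I. part_factor n k (s i)) * exp (real (sum s I))" .
  have "expected_tuples n k I s = (\<Prod>i\<in>I. ?X i) * ?Y"
    using expected_tuples_eq[of k n I s] k I s le by simp
  then have "real n ^ card I * expected_tuples n k I s = (real n ^ card I * (\<Prod>i\<in>I. ?X i)) * ?Y"
    by (simp only: mult_ac)
  also have "\<dots> = (\<Prod>i\<in>I. part_factor n k (s i)) * (?Y * exp (real (sum s I)))"
    unfolding X by (simp only: mult_ac)
  also have "?Y * exp (real (sum s I)) = bulk_factor n k (sum s I)"
    using bulk_prefactor_eq[OF le k0 k] by simp
  finally show ?thesis .
qed

text \<open>
Eventually \<open>(n - k) / sqrt n\<close> lies between \<open>c / 2\<close> and \<open>2 * c\<close>, so the bounds on the single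
factors hold with constants that depend neither on \<open>n\<close> nor on the sizes.
\<close>

lemma scaled_expected_tuples_bounded:
  fixes k :: "nat \<Rightarrow> nat" and I :: "'i set"
  assumes c: "(\<lambda>n. real (n - k n) / sqrt n) \<longlonglongrightarrow> c" "c > 0" and kn: "eventually (\<lambda>n. k n < n) sequentially"
    and \<alpha>: "\<alpha> > 0" and I: "finite I" "I \<noteq> {}"
  obtains C where "C \<ge> 0" and "eventually (\<lambda>n. \<forall>s. (\<forall>i\<in>I. \<alpha> * real n \<le> real (s i)) \<longrightarrow> sum s I \<le> k n \<longrightarrow>
    \<bar>real n ^ card I * expected_tuples n (k n) I s\<bar> \<le> C) sequentially"
proof -
  obtain B where B: "B \<ge> 1" "\<And>n. stirling_ratio n \<le> B" "\<And>n. 1 / stirling_ratio n \<le> B"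
    using stirling_ratio_bounds by blast
  let ?p = "2 * c * (B / (\<alpha> * sqrt \<alpha>))"
  let ?b = "B\<^sup>2 * exp ((2 * c)\<^sup>2) * (2 + 2 * (2 * c)) * (2 / ((c / 2)\<^sup>2 / 2)\<^sup>2)"
  have p0: "?p \<ge> 0" and b0: "?b \<ge> 0" using c(2) B(1) \<alpha> by simp_all
  have lo: "eventually (\<lambda>n. c / 2 < real (n - k n) / sqrt n) sequentially"
    using c by (intro order_tendstoD) auto
  have hi: "eventually (\<lambda>n. real (n - k n) / sqrt n < 2 * c) sequentially"
    using c by (intro order_tendstoD) auto
  show thesis
  proof (rule that[of "?p ^ card I * ?b"])
    show "?p ^ card I * ?b \<ge> 0" by (rule mult_nonneg_nonneg[OF zero_le_power[OF p0] b0])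
    show "eventually (\<lambda>n. \<forall>s. (\<forall>i\<in>I. \<alpha> * real n \<le> real (s i)) \<longrightarrow> sum s I \<le> k n \<longrightarrow>
      \<bar>real n ^ card I * expected_tuples n (k n) I s\<bar> \<le> ?p ^ card I * ?b) sequentially"
      using lo hi kn
    proof eventually_elim
      case (elim n)
      have n0: "n > 0" using elim by simp
      have m: "c / 2 * sqrt n \<le> real (n - k n)" "real (n - k n) \<le> 2 * c * sqrt n"
        using elim n0 by (simp_all add: field_simps)
      show ?case
      proof (intro allI impI)
        fix s :: "'i \<Rightarrow> nat" assume s: "\<forall>i\<in>I. \<alpha> * real n \<le> real (s i)" and le: "sum s I \<le> k n"
        have spos: "s i > 0" if "i \<in> I" for i
        proof -
          have "0 < \<alpha> * real n" using \<alpha> n0 by simp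
          also have "\<dots> \<le> real (s i)" using s that by simp
          finally show ?thesis by simp
        qed
        obtain i where i: "i \<in> I" using I by blast
        have k0: "k n > 0" using spos[OF i] le member_le_sum[OF i, of s] I by simp
        have "\<bar>\<Prod>i\<in>I. part_factor n (k n) (s i)\<bar> \<le> (\<Prod>i\<in>I. ?p)"
          unfolding abs_prod using s m n0 \<alpha> B(3)
          by (intro prod_mono conjI abs_ge_zero part_factor_bound) auto
        then have 1: "\<bar>\<Prod>i\<in>I. part_factor n (k n) (s i)\<bar> \<le> ?p ^ card I" by simp
        have 2: "\<bar>bulk_factor n (k n) (sum s I)\<bar> \<le> ?b"
          by (rule bulk_factor_bound[OF B _ m k0 elim(3) le]) (use c(2) in simp)
        have "real n ^ card I * expected_tuples n (k n) I s =
            (\<Prod>i\<in>I. part_factor n (k n) (s i)) * bulk_factor n (k n) (sum s I)"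
          by (rule scaled_expected_tuples) (use elim(3) I(1) spos le k0 in auto)
        then show "\<bar>real n ^ card I * expected_tuples n (k n) I s\<bar> \<le> ?p ^ card I * ?b"
          using mult_mono[OF 1 2 zero_le_power[OF p0] abs_ge_zero] by (simp only: abs_mult)
      qed
    qed
  qed
qed

text \<open>
The possible size vectors of \<open>j\<close> large components with distinct sizes, in increasing order.
\<close>

definition size_profiles :: "real \<Rightarrow> nat \<Rightarrow> nat \<Rightarrow> nat \<Rightarrow> (nat \<Rightarrow> nat) set" where
  "size_profiles \<alpha> n k j = {s \<in> {1..j} \<rightarrow>\<^sub>E {1..k}. \<alpha> * real n \<le> real (s 1) \<and>
     (\<forall>i\<in>{1..<j}. s i < s (i + 1)) \<and> sum s {1..j} \<le> k}"

lemma finite_size_profiles: "finite (size_profiles \<alpha> n k j)"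
  unfolding size_profiles_def by (rule finite_subset[OF _ finite_PiE[of "{1..j}" "\<lambda>_. {1..k}"]]) auto

lemma chain_le:
  fixes t :: "nat \<Rightarrow> 'a::preorder"
  assumes "\<forall>i\<in>{1..<j}. t i < t (i + 1)" "1 \<le> i" "i \<le> j"
  shows "t 1 \<le> t i"
  using assms(2,3)
proof (induction i rule: dec_induct)
  case (step n)
  then have "t n < t (Suc n)" using assms(1) by auto
  then show ?case using step by (meson Suc_leD less_imp_le order_trans)
qed simp

text \<open>
Cubes with side \<open>1 / n\<close>, open on the left, so that rounding up assigns each point to one cube.
\<close>

definition profile_cell :: "nat \<Rightarrow> nat \<Rightarrow> (nat \<Rightarrow> nat) \<Rightarrow> (nat \<Rightarrow> real) set" where
  "profile_cell n j s = (\<Pi>\<^sub>E i\<in>{1..j}. {(real (s i) - 1) / real n <.. real (s i) / real n})"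

definition rounded_profile :: "nat \<Rightarrow> nat \<Rightarrow> (nat \<Rightarrow> real) \<Rightarrow> nat \<Rightarrow> nat" where
  "rounded_profile n j t = restrict (\<lambda>i. nat \<lceil>real n * t i\<rceil>) {1..j}"

lemma mem_profile_cell_iff:
  assumes n: "n > 0" and s: "s \<in> {1..j} \<rightarrow>\<^sub>E {1..k}" and t: "t \<in> {1..j} \<rightarrow>\<^sub>E UNIV"
  shows "t \<in> profile_cell n j s \<longleftrightarrow> s = rounded_profile n j t"
proof -
  have "(real (s i) - 1) / n < t i \<and> t i \<le> real (s i) / n \<longleftrightarrow> s i = nat \<lceil>real n * t i\<rceil>"
    if i: "i \<in> {1..j}" for i
  proof -
    have s1: "s i \<ge> 1" using s i by (auto simp: PiE_def Pi_def)
    have "(real (s i) - 1) / n < t i \<and> t i \<le> real (s i) / n \<longleftrightarrow>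
        real_of_int (int (s i)) - 1 < real n * t i \<and> real n * t i \<le> real_of_int (int (s i))"
      using n by (simp add: field_simps)
    also have "\<dots> \<longleftrightarrow> \<lceil>real n * t i\<rceil> = int (s i)" by (rule ceiling_eq_iff[symmetric])
    also have "\<dots> \<longleftrightarrow> s i = nat \<lceil>real n * t i\<rceil>" using s1 by linarith
    finally show ?thesis .
  qed
  then have "t \<in> profile_cell n j s \<longleftrightarrow> (\<forall>i\<in>{1..j}. s i = nat \<lceil>real n * t i\<rceil>)"
    using t by (auto simp: profile_cell_def PiE_def Pi_def)
  also have "\<dots> \<longleftrightarrow> s = rounded_profile n j t"
  proof
    assume e: "\<forall>i\<in>{1..j}. s i = nat \<lceil>real n * t i\<rceil>"
    show "s = rounded_profile n j t"
    proof (rule ext)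
      fix i show "s i = rounded_profile n j t i"
        using e PiE_arb[OF s, of i] by (auto simp: rounded_profile_def)
    qed
  qed (auto simp: rounded_profile_def)
  finally show ?thesis .
qed

definition step_density :: "real \<Rightarrow> nat \<Rightarrow> nat \<Rightarrow> nat \<Rightarrow> (nat \<Rightarrow> real) \<Rightarrow> real" where
  "step_density \<alpha> n k j t = (\<Sum>s\<in>size_profiles \<alpha> n k j.
     real n ^ j * expected_tuples n k {1..j} s * indicator (profile_cell n j s) t)"

lemma step_density_eq:
  assumes n: "n > 0" and t: "t \<in> {1..j} \<rightarrow>\<^sub>E UNIV"
  shows "step_density \<alpha> n k j t = (if rounded_profile n j t \<in> size_profiles \<alpha> n k j
    then real n ^ j * expected_tuples n k {1..j} (rounded_profile n j t) else 0)"
proof -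
  have "step_density \<alpha> n k j t = (\<Sum>s\<in>size_profiles \<alpha> n k j.
      if s = rounded_profile n j t then real n ^ j * expected_tuples n k {1..j} s else 0)"
    unfolding step_density_def using mem_profile_cell_iff[OF n _ t]
    by (intro sum.cong refl) (auto simp: size_profiles_def indicator_def)
  then show ?thesis by (simp add: finite_size_profiles)
qed

lemma sets_profile_cell [measurable]: "profile_cell n j s \<in> sets (PiM {1..j} (\<lambda>_. lborel :: real measure))"
  unfolding profile_cell_def by (intro sets_PiM_I_finite) auto

lemma emeasure_profile_cell:
  assumes "n > 0"
  shows "emeasure (PiM {1..j} (\<lambda>_. lborel :: real measure)) (profile_cell n j s) = ennreal (1 / real n ^ j)"
proof -
  interpret product_sigma_finite "\<lambda>_::nat. lborel :: real measure" by standard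
  have "emeasure (PiM {1..j} (\<lambda>_. lborel :: real measure)) (profile_cell n j s) =
      (\<Prod>i\<in>{1..j}. emeasure lborel {(real (s i) - 1) / real n <.. real (s i) / real n})"
    unfolding profile_cell_def by (rule emeasure_PiM) auto
  also have "\<dots> = (\<Prod>i\<in>{1..j}. ennreal (1 / real n))"
    using assms by (intro prod.cong refl) (simp add: divide_right_mono diff_divide_distrib)
  also have "\<dots> = ennreal (1 / real n ^ j)" by (simp add: ennreal_power power_divide)
  finally show ?thesis .
qed

lemma integral_step_density:
  assumes "n > 0"
  shows "(LINT t | PiM {1..j} (\<lambda>_. lborel :: real measure). step_density \<alpha> n k j t) =
    (\<Sum>s\<in>size_profiles \<alpha> n k j. expected_tuples n k {1..j} s)"
proof -
  let ?M = "PiM {1..j} (\<lambda>_. lborel :: real measure)"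
  have m: "measure ?M (profile_cell n j s) = 1 / real n ^ j" for s
    using emeasure_profile_cell[OF assms] by (simp add: measure_def)
  have "integrable ?M (indicator (profile_cell n j s) :: _ \<Rightarrow> real)" for s
    by (intro integrable_real_indicator sets_profile_cell) (subst emeasure_profile_cell[OF assms], simp)
  then have "(LINT t | ?M. step_density \<alpha> n k j t) =
    (\<Sum>s\<in>size_profiles \<alpha> n k j. LINT t | ?M.
       real n ^ j * expected_tuples n k {1..j} s * indicator (profile_cell n j s) t)"
    unfolding step_density_def by (intro Bochner_Integration.integral_sum) auto
  also have "\<dots> = (\<Sum>s\<in>size_profiles \<alpha> n k j. expected_tuples n k {1..j} s)"
    using assms by (intro sum.cong refl) (simp add: m del: One_nat_def)
  finally show ?thesis .
qed

lemma nat_ceiling_ratio_tendsto: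
  assumes "t > 0"
  shows "(\<lambda>n. real (nat \<lceil>real n * t\<rceil>) / real n) \<longlonglongrightarrow> t"
  using assms by real_asymp

text \<open>
The integrand of the limit together with its constant, with powers of exponent \<open>-3/2\<close> written
through square roots; see \<open>limit_density_integral\<close>.
\<close>

definition limit_density :: "real \<Rightarrow> nat \<Rightarrow> (nat \<Rightarrow> real) \<Rightarrow> real" where
  "limit_density c j t = (\<Prod>i=1..j. c / (sqrt (2 * pi) * (t i * sqrt (t i)))) *
     (1 / ((1 - (\<Sum>i=1..j. t i)) * sqrt (1 - (\<Sum>i=1..j. t i))) *
      exp (- (c\<^sup>2 * (\<Sum>i=1..j. t i)) / (2 * (1 - (\<Sum>i=1..j. t i)))))"

text \<open>
This holds at every point, also on the boundary of the domain: rounding up is monotone, so it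
creates no strict increase where there is none, it keeps a first size of at least \<open>\<alpha> * n\<close>, and it
does not lower a total size of at least \<open>n\<close>, which exceeds \<open>k\<close>.
\<close>

lemma step_density_tendsto:
  assumes c: "(\<lambda>n. real (n - k n) / sqrt n) \<longlonglongrightarrow> c" and kn: "eventually (\<lambda>n. k n < n) sequentially"
    and \<alpha>: "\<alpha> > 0" and j: "j \<ge> 1" and t: "t \<in> {1..j} \<rightarrow>\<^sub>E UNIV"
  shows "(\<lambda>n. step_density \<alpha> n (k n) j t) \<longlonglongrightarrow> indicator (integration_domain \<alpha> j) t * limit_density c j t"
proof -
  have n0: "eventually (\<lambda>n::nat. n > 0) sequentially" by (rule eventually_gt_at_top)
  let ?N = "\<lambda>n. rounded_profile n j t"
  have N: "?N n i = nat \<lceil>real n * t i\<rceil>" if "i \<in> {1..j}" for n i using that by (simp add: rounded_profile_def)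
  have inc_iff: "?N n i < ?N n (i + 1) \<Longrightarrow> t i < t (i + 1)" if "i \<in> {1..<j}" for n i
  proof (rule ccontr)
    assume lt: "?N n i < ?N n (i + 1)" and "\<not> t i < t (i + 1)"
    then have "real n * t (i + 1) \<le> real n * t i" using linorder_not_less by (intro mult_left_mono) auto
    then have "nat \<lceil>real n * t (i + 1)\<rceil> \<le> nat \<lceil>real n * t i\<rceil>" by (intro nat_mono ceiling_mono)
    then have "?N n (i + 1) \<le> ?N n i" using that N[of i n] N[of "i + 1" n] by (simp del: nat_le_iff)
    then show False using lt by simp
  qed
  show ?thesis
  proof (cases "t \<in> integration_domain \<alpha> j")
    case True
    have t1: "\<alpha> \<le> t 1" and inc: "\<forall>i\<in>{1..<j}. t i < t (i + 1)" and su: "(\<Sum>i=1..j. t i) < 1"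
      using True by (auto simp: integration_domain_def)
    have tpos: "t i > 0" if "i \<in> {1..j}" for i using chain_le[OF inc, of i] that t1 \<alpha> by auto
    have lim: "(\<lambda>n. real (?N n i) / real n) \<longlonglongrightarrow> t i" if "i \<in> {1..j}" for i
      unfolding N[OF that] by (rule nat_ceiling_ratio_tendsto[OF tpos[OF that]])
    have "(\<lambda>n. \<Sum>i=1..j. real (?N n i) / real n) \<longlonglongrightarrow> (\<Sum>i=1..j. t i)" by (intro tendsto_sum lim)
    then have limsum: "(\<lambda>n. real (sum (?N n) {1..j}) / real n) \<longlonglongrightarrow> (\<Sum>i=1..j. t i)"
      by (simp add: sum_divide_distrib)
    have "(\<lambda>n. real (k n) / real n - real (sum (?N n) {1..j}) / real n) \<longlonglongrightarrow> 1 - (\<Sum>i=1..j. t i)"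
      by (intro tendsto_diff limsum ratio_tendsto_1[OF c kn])
    then have "eventually (\<lambda>n. 0 < real (k n) / real n - real (sum (?N n) {1..j}) / real n) sequentially"
      using su by (intro order_tendstoD) auto
    then have le: "eventually (\<lambda>n. sum (?N n) {1..j} \<le> k n) sequentially"
      using n0
    proof eventually_elim
      case (elim n)
      then have "real (sum (?N n) {1..j}) < real (k n)" by (simp add: field_simps)
      then show ?case by (simp only: of_nat_less_iff)
    qed
    have gap: "eventually (\<lambda>n. \<forall>i\<in>{1..<j}. ?N n i < ?N n (i + 1)) sequentially"
    proof (rule eventually_ball_finite[OF _ ballI])
      fix i assume i: "i \<in> {1..<j}"
      then have "t (i + 1) - t i > 0" using inc by auto
      then have "filterlim (\<lambda>n. (t (i + 1) - t i) * real n) at_top sequentially" by real_asymp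
      then have "eventually (\<lambda>n. 1 \<le> (t (i + 1) - t i) * real n) sequentially" by (simp add: filterlim_at_top)
      then show "eventually (\<lambda>n. ?N n i < ?N n (i + 1)) sequentially" using n0
      proof eventually_elim
        case (elim n)
        have "0 < real n * t (i + 1)" using tpos[of "i + 1"] i elim by simp
        then have "0 < \<lceil>real n * t (i + 1)\<rceil>" by simp
        moreover have "real n * t i + 1 \<le> real n * t (i + 1)" using elim by (simp add: algebra_simps)
        then have "\<lceil>real n * t i + 1\<rceil> \<le> \<lceil>real n * t (i + 1)\<rceil>" by (rule ceiling_mono)
        moreover have "0 < real n * t i" using tpos[of i] i elim by simp
        then have "0 < \<lceil>real n * t i\<rceil>" by simp
        ultimately have "nat \<lceil>real n * t i\<rceil> < nat \<lceil>real n * t (i + 1)\<rceil>" by linarith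
        then show ?case using i N[of i n] N[of "i + 1" n] by simp
      qed
    qed simp
    have mem: "eventually (\<lambda>n. ?N n \<in> size_profiles \<alpha> n (k n) j) sequentially"
      using le gap n0
    proof eventually_elim
      case (elim n)
      have "?N n i \<in> {1..k n}" if i: "i \<in> {1..j}" for i
      proof -
        have "0 < real n * t i" using tpos[OF i] elim by simp
        then have "?N n i \<ge> 1" unfolding N[OF i] by (simp add: Suc_le_eq)
        moreover have "?N n i \<le> sum (?N n) {1..j}" using i by (intro member_le_sum) auto
        ultimately show ?thesis using elim by simp
      qed
      then have "?N n \<in> {1..j} \<rightarrow>\<^sub>E {1..k n}" by (intro PiE_I) (auto simp: rounded_profile_def)
      moreover have "\<alpha> * real n \<le> real (?N n 1)"
      proof -
        have "\<alpha> * real n \<le> real n * t 1" using mult_left_mono[OF t1, of "real n"] by (simp add: mult.commute)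
        also have "\<dots> \<le> real (?N n 1)" using N[of 1 n] j real_nat_ceiling_ge[of "real n * t 1"] by simp
        finally show ?thesis .
      qed
      ultimately show ?case using elim by (simp add: size_profiles_def)
    qed
    have "(\<lambda>n. (\<Prod>i=1..j. part_factor n (k n) (?N n i)) * bulk_factor n (k n) (sum (?N n) {1..j}))
        \<longlonglongrightarrow> limit_density c j t"
      unfolding limit_density_def
      by (intro tendsto_mult tendsto_prod part_factor_tendsto[OF c lim tpos]
          bulk_factor_tendsto[OF c kn le limsum su])
    moreover have "eventually (\<lambda>n. (\<Prod>i=1..j. part_factor n (k n) (?N n i)) * bulk_factor n (k n) (sum (?N n) {1..j})
        = step_density \<alpha> n (k n) j t) sequentially"
      using mem kn n0
    proof eventually_elim
      case (elim n)
      have s: "?N n i > 0" if "i \<in> {1..j}" for i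
      proof -
        have "?N n i \<in> {1..k n}" using elim(1) that by (auto simp: size_profiles_def PiE_def Pi_def)
        then show ?thesis by simp
      qed
      have le: "sum (?N n) {1..j} \<le> k n" using elim(1) by (simp add: size_profiles_def)
      have "?N n 1 \<le> sum (?N n) {1..j}" using j by (intro member_le_sum) auto
      then have "k n > 0" using s[of 1] le j by simp
      then show ?case
        using scaled_expected_tuples[OF elim(2) _ s le] step_density_eq[OF elim(3) t, of \<alpha> "k n"] elim(1)
        by simp
    qed
    ultimately have "(\<lambda>n. step_density \<alpha> n (k n) j t) \<longlonglongrightarrow> limit_density c j t"
      by (rule Lim_transform_eventually)
    then show ?thesis using True by simp
  next
    case False
    then consider "t 1 < \<alpha>" | i where "i \<in> {1..<j}" "\<not> t i < t (i + 1)" | "(\<Sum>i=1..j. t i) \<ge> 1"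
      using t unfolding integration_domain_def by force
    then have "eventually (\<lambda>n. ?N n \<notin> size_profiles \<alpha> n (k n) j) sequentially"
    proof cases
      case 1
      have "filterlim (\<lambda>n. (\<alpha> - t 1) * real n) at_top sequentially" using 1 by real_asymp
      then have "eventually (\<lambda>n. 1 \<le> (\<alpha> - t 1) * real n) sequentially" by (simp add: filterlim_at_top)
      then show ?thesis using n0
      proof eventually_elim
        case (elim n)
        have a: "0 < \<alpha> * real n" using \<alpha> elim by simp
        have "real n * t 1 + 1 \<le> \<alpha> * real n" using elim by (simp add: algebra_simps)
        moreover have "real_of_int \<lceil>real n * t 1\<rceil> < real n * t 1 + 1" by linarith
        ultimately have "real (?N n 1) < \<alpha> * real n" using N[of 1] j a by (simp add: of_nat_nat max_def nat_less_iff)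
        then show ?case by (simp add: size_profiles_def)
      qed
    next
      case (2 i)
      have "?N n \<notin> size_profiles \<alpha> n (k n) j" for n
      proof
        assume "?N n \<in> size_profiles \<alpha> n (k n) j"
        then have "?N n i < ?N n (i + 1)" using 2(1) unfolding size_profiles_def by blast
        then show False using inc_iff[OF 2(1)] 2(2) by blast
      qed
      then show ?thesis by simp
    next
      case 3
      show ?thesis using kn
      proof eventually_elim
        case (elim n)
        have "real n * 1 \<le> real n * (\<Sum>i=1..j. t i)" using 3 by (intro mult_left_mono) auto
        also have "\<dots> = (\<Sum>i=1..j. real n * t i)" by (rule sum_distrib_left)
        also have "\<dots> \<le> (\<Sum>i=1..j. real (?N n i))"
          by (intro sum_mono) (simp add: N real_nat_ceiling_ge)
        finally have "n \<le> sum (?N n) {1..j}" by (simp flip: of_nat_sum)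
        then show ?case using elim by (auto simp: size_profiles_def)
      qed
    qed
    then have "eventually (\<lambda>n. step_density \<alpha> n (k n) j t = 0) sequentially"
      using n0 by eventually_elim (simp add: step_density_eq[OF _ t])
    then have "(\<lambda>n. step_density \<alpha> n (k n) j t) \<longlonglongrightarrow> 0" by (rule tendsto_eventually)
    then show ?thesis using False by simp
  qed
qed

text \<open>
From some \<open>n\<close> on the step functions are uniformly bounded and vanish outside of the unit cube, so
a multiple of the indicator of the cube dominates them.
\<close>

theorem sum_expected_tuples_tendsto:
  assumes c: "(\<lambda>n. real (n - k n) / sqrt n) \<longlonglongrightarrow> c" "c > 0" and kn: "eventually (\<lambda>n. k n < n) sequentially"
    and \<alpha>: "\<alpha> > 0" and j: "j \<ge> 1"
  shows "(\<lambda>n. \<Sum>s\<in>size_profiles \<alpha> n (k n) j. expected_tuples n (k n) {1..j} s) \<longlonglongrightarrow>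
    (LINT t | PiM {1..j} (\<lambda>_. lborel :: real measure). indicator (integration_domain \<alpha> j) t * limit_density c j t)"
proof -
  let ?M = "PiM {1..j} (\<lambda>_. lborel :: real measure)"
  let ?g = "\<lambda>t. indicator (integration_domain \<alpha> j) t * limit_density c j t :: real"
  let ?box = "\<Pi>\<^sub>E i\<in>{1..j}. {0<..1::real}"
  interpret product_sigma_finite "\<lambda>_::nat. lborel :: real measure" by standard
  have sp: "space ?M = {1..j} \<rightarrow>\<^sub>E UNIV" by (simp add: space_PiM)
  obtain C where C: "C \<ge> 0" "eventually (\<lambda>n. \<forall>s. (\<forall>i\<in>{1..j}. \<alpha> * real n \<le> real (s i)) \<longrightarrow> sum s {1..j} \<le> k n \<longrightarrow>
      \<bar>real n ^ card {1..j} * expected_tuples n (k n) {1..j} s\<bar> \<le> C) sequentially"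
    using scaled_expected_tuples_bounded[OF c kn \<alpha>, of "{1..j}"] j by auto
  have "eventually (\<lambda>n. \<forall>t\<in>space ?M. \<bar>step_density \<alpha> n (k n) j t\<bar> \<le> C * indicator ?box t) sequentially"
    using C(2) kn eventually_gt_at_top[of 0]
  proof eventually_elim
    case (elim n)
    show ?case
    proof
      fix t assume "t \<in> space ?M"
      then have t: "t \<in> {1..j} \<rightarrow>\<^sub>E UNIV" unfolding sp .
      let ?N = "rounded_profile n j t"
      show "\<bar>step_density \<alpha> n (k n) j t\<bar> \<le> C * indicator ?box t"
      proof (cases "?N \<in> size_profiles \<alpha> n (k n) j")
        case True
        have mem: "\<And>i. i \<in> {1..j} \<Longrightarrow> ?N i \<in> {1..k n}" and N1: "\<alpha> * real n \<le> real (?N 1)"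
          and inc: "\<forall>i\<in>{1..<j}. ?N i < ?N (i + 1)" and le: "sum ?N {1..j} \<le> k n"
          using True by (auto simp: size_profiles_def PiE_def Pi_def)
        have al: "\<forall>i\<in>{1..j}. \<alpha> * real n \<le> real (?N i)"
        proof
          fix i assume "i \<in> {1..j}"
          then have "real (?N 1) \<le> real (?N i)" using chain_le[OF inc, of i] by simp
          then show "\<alpha> * real n \<le> real (?N i)" using N1 by linarith
        qed
        have "t i \<in> {0<..1}" if i: "i \<in> {1..j}" for i
        proof -
          have "nat \<lceil>real n * t i\<rceil> \<in> {1..k n}" using mem[OF i] i by (simp add: rounded_profile_def)
          then have z: "0 < real n * t i" "real n * t i \<le> real (k n)" by (simp_all add: Suc_le_eq)
          have "real (k n) \<le> real n * 1" using elim(2) by simp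
          then have "real n * t i \<le> real n * 1" using z(2) by linarith
          then have "t i \<le> 1" using elim(3) mult_le_cancel_left_pos[of "real n" "t i" 1] by simp
          then show ?thesis using z(1) elim(3) by (simp add: zero_less_mult_iff)
        qed
        then have "t \<in> ?box" using t by (auto simp: PiE_def Pi_def)
        moreover have "\<bar>real n ^ j * expected_tuples n (k n) {1..j} ?N\<bar> \<le> C"
          using elim(1) al le by simp
        ultimately show ?thesis using True by (simp add: step_density_eq[OF elim(3) t])
      next
        case False
        then show ?thesis using C(1) by (simp add: step_density_eq[OF elim(3) t])
      qed
    qed
  qed
  then obtain n0 where n0: "\<And>n t. n \<ge> n0 \<Longrightarrow> t \<in> space ?M \<Longrightarrow>
      \<bar>step_density \<alpha> n (k n) j t\<bar> \<le> C * indicator ?box t"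
    unfolding eventually_sequentially by blast
  \<comment> \<open>The bound holds from \<open>n0\<close> on, and the cells make sense only for positive \<open>n\<close>; hence the shift.\<close>
  let ?h = "\<lambda>n. step_density \<alpha> (n + Suc n0) (k (n + Suc n0)) j"
  have lim: "(\<lambda>n. ?h n t) \<longlonglongrightarrow> ?g t" if "t \<in> space ?M" for t
    using that unfolding sp by (intro LIMSEQ_ignore_initial_segment step_density_tendsto c kn \<alpha> j)
  have meas: "?h n \<in> borel_measurable ?M" for n
    unfolding step_density_def by measurable
  have box: "?box \<in> sets ?M" by (intro sets_PiM_I_finite) auto
  have "emeasure ?M ?box = (\<Prod>i\<in>{1..j}. emeasure lborel {0<..1::real})" by (rule emeasure_PiM) auto
  then have eb: "emeasure ?M ?box < \<infinity>" by simp
  have "(\<lambda>n. integral\<^sup>L ?M (?h n)) \<longlonglongrightarrow> integral\<^sup>L ?M ?g"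
  proof (rule integral_dominated_convergence[where w = "\<lambda>t. C * indicator ?box t"])
    show "?g \<in> borel_measurable ?M" using lim meas by (rule borel_measurable_LIMSEQ_real)
    show "integrable ?M (\<lambda>t. C * indicator ?box t)"
      using box eb by (intro integrable_mult_right integrable_real_indicator) auto
    show "AE t in ?M. (\<lambda>n. ?h n t) \<longlonglongrightarrow> ?g t" using lim by (intro AE_I2)
    show "AE t in ?M. norm (?h n t) \<le> C * indicator ?box t" for n
      using n0[of "n + Suc n0"] by (intro AE_I2) simp
  qed (rule meas)
  then have "(\<lambda>n. \<Sum>s\<in>size_profiles \<alpha> (n + Suc n0) (k (n + Suc n0)) j.
      expected_tuples (n + Suc n0) (k (n + Suc n0)) {1..j} s) \<longlonglongrightarrow> integral\<^sup>L ?M ?g"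
    by (simp only: integral_step_density add_gr_0 zero_less_Suc simp_thms)
  then show ?thesis by (rule LIMSEQ_offset)
qed

lemma powr_minus_three_halves: "x > 0 \<Longrightarrow> x powr (-3/2) = 1 / (x * sqrt x)" for x :: real
proof -
  assume x: "x > 0"
  have "x powr (1 + 1/2) = x * sqrt x" using x unfolding powr_add by (simp add: powr_half_sqrt)
  then have "x powr (3/2) = x * sqrt x" by simp
  then show ?thesis using powr_minus[of x "3/2"] by (simp add: inverse_eq_divide)
qed

lemma limit_density_integral:
  assumes \<alpha>: "\<alpha> > 0" and j: "j \<ge> 1"
  shows "(LINT t | PiM {1..j} (\<lambda>_. lborel :: real measure). indicator (integration_domain \<alpha> j) t * limit_density c j t) =
    c ^ j / (2 * pi) powr (real j / 2) *
       (LINT t : integration_domain \<alpha> j | PiM {1..j} (\<lambda>_. lborel :: real measure).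
          (\<Prod>i=1..j. t i powr (-3/2)) * (1 - (\<Sum>i=1..j. t i)) powr (-3/2) *
          exp (- (c\<^sup>2 * (\<Sum>i=1..j. t i)) / (2 * (1 - (\<Sum>i=1..j. t i)))))"
proof -
  let ?f = "\<lambda>t. (\<Prod>i=1..j. t i powr (-3/2)) * (1 - (\<Sum>i=1..j. t i)) powr (-3/2) *
    exp (- (c\<^sup>2 * (\<Sum>i=1..j. t i)) / (2 * (1 - (\<Sum>i=1..j. t i))))"
  have p: "(2 * pi) powr (real j / 2) = sqrt (2 * pi) ^ j"
  proof -
    have "(2 * pi) powr (real j / 2) = ((2 * pi) powr (1/2)) powr real j" by (simp add: powr_powr)
    then show ?thesis by (simp add: powr_half_sqrt powr_realpow)
  qed
  have eq: "limit_density c j t = c ^ j / (2 * pi) powr (real j / 2) *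
      ?f t"
    if t: "t \<in> integration_domain \<alpha> j" for t
  proof -
    have t1: "\<alpha> \<le> t 1" and inc: "\<forall>i\<in>{1..<j}. t i < t (i + 1)" and su: "(\<Sum>i=1..j. t i) < 1"
      using t by (auto simp: integration_domain_def)
    have tpos: "t i > 0" if "i \<in> {1..j}" for i using chain_le[OF inc, of i] that t1 \<alpha> by auto
    have "(\<Prod>i=1..j. c / (sqrt (2 * pi) * (t i * sqrt (t i)))) = (\<Prod>i=1..j. c / sqrt (2 * pi) * t i powr (-3/2))"
    proof (rule prod.cong[OF refl])
      fix i assume i: "i \<in> {1..j}"
      show "c / (sqrt (2 * pi) * (t i * sqrt (t i))) = c / sqrt (2 * pi) * t i powr (-3/2)"
        unfolding powr_minus_three_halves[OF tpos[OF i]] by simp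
    qed
    also have "\<dots> = c ^ j / sqrt (2 * pi) ^ j * (\<Prod>i=1..j. t i powr (-3/2))"
      by (simp only: prod.distrib prod_constant power_divide card_atLeastAtMost diff_Suc_1)
    finally show ?thesis using su unfolding limit_density_def p
      by (simp only: powr_minus_three_halves diff_gt_0_iff_gt mult.assoc)
  qed
  have "(LINT t | PiM {1..j} (\<lambda>_. lborel :: real measure). indicator (integration_domain \<alpha> j) t * limit_density c j t) =
    (LINT t | PiM {1..j} (\<lambda>_. lborel :: real measure). c ^ j / (2 * pi) powr (real j / 2) *
      (indicator (integration_domain \<alpha> j) t *\<^sub>R ?f t))"
    by (intro Bochner_Integration.integral_cong refl) (simp add: eq indicator_def)
  then show ?thesis unfolding set_lebesgue_integral_def by simp
qed

section \<open>Inclusion and exclusion over large components\<close>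

text \<open>
If \<open>f\<close> is injective on \<open>C\<close>, a subset of \<open>C\<close> has exactly one enumeration with increasing values of
\<open>f\<close>.
\<close>

lemma card_increasing_functions:
  fixes f :: "'a \<Rightarrow> nat"
  assumes "finite C" "inj_on f C"
  shows "card {S \<in> {1..j} \<rightarrow>\<^sub>E C. \<forall>i\<in>{1..<j}. f (S i) < f (S (i + 1))} = card C choose j"
proof -
  let ?F = "{S \<in> {1..j} \<rightarrow>\<^sub>E C. \<forall>i\<in>{1..<j}. f (S i) < f (S (i + 1))}"
  let ?L = "\<lambda>S. map (\<lambda>i. f (S (i + 1))) [0..<j]"
  have SC: "S i \<in> C" if "S \<in> ?F" "i \<in> {1..j}" for S i using that by (auto simp: PiE_def Pi_def)
  have sorted: "sorted_wrt (<) (?L S)" if S: "S \<in> ?F" for S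
  proof -
    have "\<forall>i. Suc i < length (?L S) \<longrightarrow> ?L S ! i < ?L S ! Suc i" using S by auto
    then show ?thesis by (subst sorted_wrt_iff_nth_Suc_transp) auto
  qed
  have shift: "(\<lambda>i. i + 1) ` {0..<j} = {1..j}" using image_Suc_atLeastLessThan[of 0 j] by (simp add: atLeastLessThanSuc_atLeastAtMost)
  have setL: "set (?L S) = f ` S ` {1..j}" for S
    by (simp only: shift[symmetric] image_image set_map set_upt)
  have "bij_betw (\<lambda>S. S ` {1..j}) ?F {X. X \<subseteq> C \<and> card X = j}"
    unfolding bij_betw_def
  proof (intro conjI equalityI subsetI)
    show "inj_on (\<lambda>S. S ` {1..j}) ?F"
    proof (rule inj_onI)
      fix S T assume S: "S \<in> ?F" and T: "T \<in> ?F" and eq: "S ` {1..j} = T ` {1..j}"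
      have "set (?L S) = set (?L T)" unfolding setL eq ..
      then have LL: "?L S = ?L T" using strict_sorted_equal[OF sorted[OF S] sorted[OF T]] by simp
      have "S i = T i" if i: "i \<in> {1..j}" for i
      proof -
        have "\<forall>p\<in>set [0..<j]. f (S (p + 1)) = f (T (p + 1))" using LL by (simp only: map_eq_conv)
        moreover have "i - 1 \<in> set [0..<j]" "i - 1 + 1 = i" using i by auto
        ultimately have "f (S i) = f (T i)" by metis
        then show ?thesis using assms(2) SC[OF S i] SC[OF T i] by (simp add: inj_on_eq_iff)
      qed
      then show "S = T" using S T by (intro PiE_ext[of S _ _ T]) auto
    qed
  next
    fix X assume "X \<in> (\<lambda>S. S ` {1..j}) ` ?F"
    then obtain S where S: "S \<in> ?F" "X = S ` {1..j}" by blast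
    have XC: "X \<subseteq> C" using SC[OF S(1)] S(2) by blast
    have "card (f ` X) = length (?L S)"
      unfolding S(2) setL[symmetric] using sorted[OF S(1)] by (intro distinct_card) (simp add: strict_sorted_iff)
    then have "card X = j" using card_image[OF inj_on_subset[OF assms(2) XC]] by simp
    then show "X \<in> {X. X \<subseteq> C \<and> card X = j}" using XC by simp
  next
    fix X assume "X \<in> {X. X \<subseteq> C \<and> card X = j}"
    then have X: "X \<subseteq> C" "card X = j" by auto
    have injX: "inj_on f X" using assms(2) X(1) by (rule inj_on_subset)
    have finX: "finite X" using assms(1) X(1) finite_subset by blast
    define xs where "xs = sorted_list_of_set (f ` X)"
    have len: "length xs = j" using finX X(2) card_image[OF injX] by (simp add: xs_def)
    have setxs: "set xs = f ` X" using finX by (simp add: xs_def)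
    have sxs: "sorted_wrt (<) xs" by (simp add: xs_def)
    define S where "S = restrict (\<lambda>i. inv_into X f (xs ! (i - 1))) {1..j}"
    have fS: "f (S i) = xs ! (i - 1)" and SX: "S i \<in> X" if i: "i \<in> {1..j}" for i
    proof -
      have "xs ! (i - 1) \<in> set xs" using i len by (intro nth_mem) auto
      then have "xs ! (i - 1) \<in> f ` X" by (simp only: setxs)
      then show "f (S i) = xs ! (i - 1)" "S i \<in> X"
        using i by (simp_all add: S_def f_inv_into_f inv_into_into)
    qed
    have "S \<in> {1..j} \<rightarrow>\<^sub>E C" using SX X(1) by (intro PiE_I) (auto simp: S_def)
    moreover have "f (S i) < f (S (i + 1))" if i: "i \<in> {1..<j}" for i
    proof -
      have "xs ! (i - 1) < xs ! i" using sxs i len by (intro sorted_wrt_nth_less[of "(<)"]) auto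
      then show ?thesis using fS[of i] fS[of "i + 1"] i by simp
    qed
    moreover have "S ` {1..j} = X"
    proof (intro equalityI subsetI)
      fix x assume x: "x \<in> X"
      then have "f x \<in> set xs" by (simp add: setxs)
      then obtain p where p: "p < j" "f x = xs ! p" using len by (auto simp: in_set_conv_nth)
      have "f (S (p + 1)) = f x" using fS[of "p + 1"] p by simp
      then have "S (p + 1) = x" using inj_onD[OF injX, of "S (p + 1)" x] SX[of "p + 1"] x p by simp
      then show "x \<in> S ` {1..j}" using p by (intro image_eqI[of _ _ "p + 1"]) auto
    qed (use SX in auto)
    ultimately show "X \<in> (\<lambda>S. S ` {1..j}) ` ?F" by blast
  qed
  then have "card ?F = card {X. X \<subseteq> C \<and> card X = j}" by (rule bij_betw_same_card)
  then show ?thesis using n_subsets[OF assms(1)] by simp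
qed

lemma alternating_choose_sum:
  assumes "N \<le> J"
  shows "(\<Sum>j=1..J. (-1) ^ (j - 1) * real (N choose j)) = (if N = 0 then 0 else 1)"
proof (cases "N = 0")
  case False
  have "0 = (\<Sum>i\<le>N. (-1) ^ i * real (N choose i))" using choose_alternating_sum[of N, where ?'a = real] False by simp
  also have "\<dots> = (\<Sum>i\<le>J. (-1) ^ i * real (N choose i))"
    using assms by (intro sum.mono_neutral_left) (auto simp: binomial_eq_0)
  also have "\<dots> = 1 + (\<Sum>i=1..J. (-1) ^ i * real (N choose i))"
  proof -
    have "{..J} = insert 0 {1..J}" by auto
    then show ?thesis by simp
  qed
  also have "(\<Sum>i=1..J. (-1) ^ i * real (N choose i)) = - (\<Sum>j=1..J. (-1) ^ (j - 1) * real (N choose j))"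
    unfolding sum_negf[symmetric]
  proof (intro sum.cong refl)
    fix i assume "i \<in> {1..J}"
    then obtain p where "i = Suc p" by (cases i) auto
    then show "(-1) ^ i * real (N choose i) = - ((-1) ^ (i - 1) * real (N choose i))" by simp
  qed
  finally show ?thesis using False by simp
qed (auto intro!: sum.neutral simp: binomial_eq_0)

definition large_components :: "real \<Rightarrow> nat \<Rightarrow> nat \<Rightarrow> nat set set \<Rightarrow> nat set set" where
  "large_components \<alpha> n k E = {C \<in> forest_components k E. \<alpha> * real n \<le> real (card C)}"

lemma graph_components_disjoint:
  assumes "C \<in> graph_components V E" "D \<in> graph_components V E" "C \<noteq> D"
  shows "C \<inter> D = {}"
proof (rule ccontr)
  assume "C \<inter> D \<noteq> {}"
  obtain u v where u: "C = {x \<in> V. (u, x) \<in> (adj_rel E)\<^sup>*}" and v: "D = {x \<in> V. (v, x) \<in> (adj_rel E)\<^sup>*}"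
    using assms by (auto simp: graph_components_def)
  obtain w where w: "(u, w) \<in> (adj_rel E)\<^sup>*" "(v, w) \<in> (adj_rel E)\<^sup>*"
    using \<open>C \<inter> D \<noteq> {}\<close> u v by blast
  have "(u, v) \<in> (adj_rel E)\<^sup>*" "(v, u) \<in> (adj_rel E)\<^sup>*"
    using w adj_rel_rtrancl_sym by (meson rtrancl_trans)+
  then have "C = D" unfolding u v by (meson rtrancl_trans)
  then show False using assms(3) by simp
qed

lemma forest_components_disjoint:
  "C \<in> forest_components k E \<Longrightarrow> D \<in> forest_components k E \<Longrightarrow> C \<noteq> D \<Longrightarrow> C \<inter> D = {}"
  unfolding forest_components_def by (rule graph_components_disjoint)

lemma forest_components_nonempty: "C \<in> forest_components k E \<Longrightarrow> C \<noteq> {}"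
  by (auto simp: forest_components_def graph_components_def)

lemma finite_large_components: "finite (large_components \<alpha> n k E)"
  unfolding large_components_def using finite_forest_components by simp

lemma card_large_components_le:
  assumes "k \<le> n" "n > 0" "1 / \<alpha> \<le> real J" "\<alpha> > 0"
  shows "card (large_components \<alpha> n k E) \<le> J"
proof -
  let ?L = "large_components \<alpha> n k E"
  have fin: "finite C" if "C \<in> ?L" for C
    using forest_components_subset[of C k E] that finite_subset by (auto simp: large_components_def)
  have "real (card ?L) * (\<alpha> * real n) = (\<Sum>C\<in>?L. \<alpha> * real n)" by simp
  also have "\<dots> \<le> (\<Sum>C\<in>?L. real (card C))" by (intro sum_mono) (simp add: large_components_def)
  also have "\<dots> = real (card (\<Union>?L))"
    using fin finite_large_components forest_components_disjoint[of _ k E]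
    by (subst card_Union_disjoint) (auto simp: pairwise_def disjnt_def large_components_def)
  also have "\<dots> \<le> real (card {1..k})"
    using forest_components_subset[of _ k E] by (intro of_nat_mono card_mono) (auto simp: large_components_def)
  also have "\<dots> \<le> real n" using assms by simp
  finally have "real (card ?L) \<le> 1 / \<alpha>" using assms by (simp add: field_simps)
  then show ?thesis using assms by linarith
qed

text \<open>
Components with distinct sizes are distinct, hence disjoint, and their size vector is a profile.
\<close>

lemma sum_card_component_tuples_profiles:
  assumes j: "j \<ge> 1"
  shows "(\<Sum>s\<in>size_profiles \<alpha> n k j. card (component_tuples k {1..j} s E)) =
    card {S \<in> {1..j} \<rightarrow>\<^sub>E large_components \<alpha> n k E. \<forall>i\<in>{1..<j}. card (S i) < card (S (i + 1))}"
proof -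
  let ?P = "size_profiles \<alpha> n k j"
  let ?F = "{S \<in> {1..j} \<rightarrow>\<^sub>E large_components \<alpha> n k E. \<forall>i\<in>{1..<j}. card (S i) < card (S (i + 1))}"
  have fin: "finite (component_tuples k {1..j} s E)" for s
    by (intro finite_component_tuples) simp
  have disj: "component_tuples k {1..j} s E \<inter> component_tuples k {1..j} r E = {}"
    if "s \<in> ?P" "r \<in> ?P" "s \<noteq> r" for s r
  proof (rule ccontr)
    assume "component_tuples k {1..j} s E \<inter> component_tuples k {1..j} r E \<noteq> {}"
    then obtain S where "S \<in> component_tuples k {1..j} s E" "S \<in> component_tuples k {1..j} r E" by blast
    then have "s i = r i" if "i \<in> {1..j}" for i using that by (auto simp: component_tuples_def)
    moreover have "s \<in> {1..j} \<rightarrow>\<^sub>E {1..k}" "r \<in> {1..j} \<rightarrow>\<^sub>E {1..k}"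
      using that by (auto simp: size_profiles_def)
    ultimately have "s = r" by (intro PiE_ext) auto
    then show False using that by simp
  qed
  have "(\<Union>s\<in>?P. component_tuples k {1..j} s E) = ?F"
  proof (intro equalityI subsetI)
    fix S assume "S \<in> (\<Union>s\<in>?P. component_tuples k {1..j} s E)"
    then obtain s where s: "s \<in> ?P" "S \<in> component_tuples k {1..j} s E" by blast
    have inc: "\<forall>i\<in>{1..<j}. s i < s (i + 1)" and s1: "\<alpha> * real n \<le> real (s 1)"
      using s(1) by (auto simp: size_profiles_def)
    have ext: "S \<in> {1..j} \<rightarrow>\<^sub>E forest_components k E" and cs: "\<And>i. i \<in> {1..j} \<Longrightarrow> card (S i) = s i"
      using s(2) by (auto simp: component_tuples_def)
    have "S i \<in> large_components \<alpha> n k E" if i: "i \<in> {1..j}" for i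
    proof -
      have "s 1 \<le> s i" using chain_le[OF inc] i by simp
      then have "\<alpha> * real n \<le> real (card (S i))" using s1 cs[OF i] by linarith
      moreover have "S i \<in> forest_components k E" using ext i by (rule PiE_mem)
      ultimately show ?thesis by (simp add: large_components_def)
    qed
    then have "S \<in> {1..j} \<rightarrow>\<^sub>E large_components \<alpha> n k E" using ext by (intro PiE_I) (auto intro: PiE_arb)
    then show "S \<in> ?F" using inc cs by auto
  next
    fix S assume S: "S \<in> ?F"
    then have ext: "S \<in> {1..j} \<rightarrow>\<^sub>E large_components \<alpha> n k E"
      and inc: "\<forall>i\<in>{1..<j}. card (S i) < card (S (i + 1))" by auto
    have SL: "S i \<in> forest_components k E" "\<alpha> * real n \<le> real (card (S i))" if "i \<in> {1..j}" for i
      using PiE_mem[OF ext that] by (auto simp: large_components_def)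
    have finS: "finite (S i)" if "i \<in> {1..j}" for i
      using forest_components_subset[OF SL(1)[OF that]] finite_subset by blast
    define s where "s = restrict (\<lambda>i. card (S i)) {1..j}"
    have mono: "card (S i) < card (S i')" if "1 \<le> i" "Suc i \<le> i'" "i' \<le> j" for i i'
      using that(2,3)
    proof (induction i' rule: dec_induct)
      case base
      then show ?case using inc that(1) by auto
    next
      case (step m)
      then have "card (S m) < card (S (m + 1))" using inc that(1) by auto
      then show ?case using step by simp
    qed
    have neq: "S i \<noteq> S i'" if "i \<in> {1..j}" "i' \<in> {1..j}" "i \<noteq> i'" for i i'
      using mono[of i i'] mono[of i' i] that by (cases "i < i'") force+
    have dis: "disjoint_family_on S {1..j}"
      unfolding disjoint_family_on_def by (intro ballI impI forest_components_disjoint[OF SL(1) SL(1) neq])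
    have "s \<in> ?P"
    proof -
      have "card (S i) \<in> {1..k}" if i: "i \<in> {1..j}" for i
      proof -
        have "card (S i) > 0" using finS[OF i] forest_components_nonempty[OF SL(1)[OF i]] by (simp add: card_gt_0_iff)
        moreover have "card (S i) \<le> card {1..k}"
          using forest_components_subset[OF SL(1)[OF i]] by (intro card_mono) auto
        ultimately show ?thesis by simp
      qed
      then have "s \<in> {1..j} \<rightarrow>\<^sub>E {1..k}" by (intro PiE_I) (auto simp: s_def)
      moreover have "\<alpha> * real n \<le> real (s 1)" using SL(2)[of 1] j by (simp add: s_def)
      moreover have "\<forall>i\<in>{1..<j}. s i < s (i + 1)" using inc by (auto simp: s_def)
      moreover have "sum s {1..j} \<le> k"
      proof -
        have "sum s {1..j} = (\<Sum>i\<in>{1..j}. card (S i))" by (intro sum.cong) (auto simp: s_def)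
        also have "\<dots> = card (\<Union>i\<in>{1..j}. S i)"
          using finS dis by (intro card_UN_disjoint[symmetric]) (auto simp: disjoint_family_on_def)
        also have "\<dots> \<le> card {1..k}"
          using forest_components_subset SL(1) by (intro card_mono UN_least) auto
        finally show ?thesis by simp
      qed
      ultimately show ?thesis by (simp add: size_profiles_def)
    qed
    moreover have "S \<in> component_tuples k {1..j} s E"
    proof -
      have "S \<in> {1..j} \<rightarrow>\<^sub>E forest_components k E" using ext SL(1) by (intro PiE_I) (auto intro: PiE_arb)
      then show ?thesis using dis by (auto simp: component_tuples_def s_def)
    qed
    ultimately show "S \<in> (\<Union>s\<in>?P. component_tuples k {1..j} s E)" by blast
  qed
  then show ?thesis using card_UN_disjoint[of ?P "\<lambda>s. component_tuples k {1..j} s E"]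
      finite_size_profiles fin disj by simp
qed

lemma tied_pair_exists:
  assumes "\<not> inj_on card (large_components \<alpha> n k E)"
  shows "(\<Sum>a | a \<le> k \<and> \<alpha> * real n \<le> real a. card (component_tuples k {1..2::nat} (\<lambda>_. a) E)) \<ge> 1"
proof -
  obtain C D where CD: "C \<in> large_components \<alpha> n k E" "D \<in> large_components \<alpha> n k E" "card C = card D" "C \<noteq> D"
    using assms by (auto simp: inj_on_def)
  have f: "C \<in> forest_components k E" "D \<in> forest_components k E" "\<alpha> * real n \<le> real (card C)"
    using CD by (auto simp: large_components_def)
  have le: "card C \<le> k" using card_mono[OF _ forest_components_subset[OF f(1)]] by simp
  define S where "S = (\<lambda>i::nat. if i = 1 then C else if i = 2 then D else undefined)"
  have i12: "{1..2::nat} = {1, 2}" by auto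
  have "S \<in> component_tuples k {1..2} (\<lambda>_. card C) E"
    unfolding component_tuples_def disjoint_family_on_def PiE_def Pi_def extensional_def i12
    using f CD forest_components_disjoint[OF f(1,2) CD(4)] by (auto simp: S_def)
  moreover have "finite (component_tuples k {1..2::nat} (\<lambda>_. card C) E)"
    by (intro finite_component_tuples) simp
  ultimately have "card (component_tuples k {1..2::nat} (\<lambda>_. card C) E) \<ge> 1"
    by (metis One_nat_def Suc_leI card_gt_0_iff empty_iff)
  also have "card (component_tuples k {1..2::nat} (\<lambda>_. card C) E) \<le>
      (\<Sum>a | a \<le> k \<and> \<alpha> * real n \<le> real a. card (component_tuples k {1..2::nat} (\<lambda>_. a) E))"
    using le f(3) by (intro member_le_sum[of "card C" _ "\<lambda>a. card (component_tuples k {1..2::nat} (\<lambda>_. a) E)"]) auto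
  finally show ?thesis .
qed

text \<open>
The last factor counts pairs of distinct large components of equal size. If there is none, the
left side vanishes by inclusion-exclusion. Otherwise that count is at least \<open>1\<close>, and the left side
is at most \<open>1 + (\<Sum>j=1..J. J ^ j)\<close> because there are at most \<open>J\<close> large components.
\<close>

lemma inclusion_exclusion_error:
  assumes "k \<le> n" "n > 0" "1 / \<alpha> \<le> real J" "\<alpha> > 0"
  shows "\<bar>(if large_components \<alpha> n k E = {} then 0 else 1) -
      (\<Sum>j=1..J. (-1) ^ (j - 1) * (\<Sum>s\<in>size_profiles \<alpha> n k j. real (card (component_tuples k {1..j} s E))))\<bar> \<le>
    (1 + (\<Sum>j=1..J. real J ^ j)) *
      (\<Sum>a | a \<le> k \<and> \<alpha> * real n \<le> real a. real (card (component_tuples k {1..2::nat} (\<lambda>_. a) E)))"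
proof -
  let ?L = "large_components \<alpha> n k E"
  let ?F = "\<lambda>j::nat. {S \<in> {1..j} \<rightarrow>\<^sub>E ?L. \<forall>i\<in>{1..<j}. card (S i) < card (S (i + 1))}"
  let ?tie = "\<Sum>a | a \<le> k \<and> \<alpha> * real n \<le> real a. real (card (component_tuples k {1..2::nat} (\<lambda>_. a) E))"
  have F: "(\<Sum>s\<in>size_profiles \<alpha> n k j. real (card (component_tuples k {1..j} s E))) = real (card (?F j))"
    if "j \<in> {1..J}" for j
    using sum_card_component_tuples_profiles[where j = j and \<alpha> = \<alpha> and n = n and k = k and E = E] that by (simp flip: of_nat_sum)
  have LJ: "card ?L \<le> J" by (rule card_large_components_le[OF assms])
  have sum: "(\<Sum>j=1..J. (-1) ^ (j - 1) * (\<Sum>s\<in>size_profiles \<alpha> n k j. real (card (component_tuples k {1..j} s E))))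
      = (\<Sum>j=1..J. (-1) ^ (j - 1) * real (card (?F j)))"
    using F by (intro sum.cong refl) simp
  show ?thesis
  proof (cases "inj_on card ?L")
    case True
    have "(\<Sum>j=1..J. (-1) ^ (j - 1) * real (card (?F j))) = (if card ?L = 0 then 0 else 1)"
      unfolding card_increasing_functions[OF finite_large_components True] by (rule alternating_choose_sum[OF LJ])
    also have "\<dots> = (if ?L = {} then 0 else 1)" using finite_large_components by simp
    finally show ?thesis unfolding sum by (simp add: sum_nonneg)
  next
    case False
    have "real 1 \<le> real (\<Sum>a | a \<le> k \<and> \<alpha> * real n \<le> real a. card (component_tuples k {1..2::nat} (\<lambda>_. a) E))"
      using tied_pair_exists[OF False] by (rule of_nat_mono)
    then have tie: "1 \<le> ?tie" by simp
    have "\<bar>\<Sum>j=1..J. (-1) ^ (j - 1) * real (card (?F j))\<bar> \<le> (\<Sum>j=1..J. real J ^ j)"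
    proof (rule order_trans[OF sum_abs], rule sum_mono)
      fix j :: nat
      have "card (?F j) \<le> card ({1..j} \<rightarrow>\<^sub>E ?L)"
        by (intro card_mono finite_PiE finite_large_components finite_atLeastAtMost) auto
      also have "\<dots> = card ?L ^ j" by (simp add: card_PiE)
      also have "\<dots> \<le> J ^ j" using LJ by (rule power_mono) simp
      finally have "real (card (?F j)) \<le> real (J ^ j)" by (rule of_nat_mono)
      then show "\<bar>(-1) ^ (j - 1) * real (card (?F j))\<bar> \<le> real J ^ j" by (simp add: abs_mult power_abs)
    qed
    then have "\<bar>(if ?L = {} then 0 else 1) - (\<Sum>j=1..J. (-1) ^ (j - 1) * real (card (?F j)))\<bar> \<le>
        (1 + (\<Sum>j=1..J. real J ^ j)) * 1" by (cases "?L = {}") auto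
    also have "\<dots> \<le> (1 + (\<Sum>j=1..J. real J ^ j)) * ?tie"
      using tie by (intro mult_left_mono) (auto intro!: add_nonneg_nonneg sum_nonneg)
    finally show ?thesis unfolding sum .
  qed
qed

lemma has_large_component_iff:
  "k \<le> n \<Longrightarrow> has_large_component \<alpha> n k E \<longleftrightarrow> large_components \<alpha> n k E \<noteq> {}"
  by (auto simp: has_large_component_def large_components_def forest_components_def Int_absorb2)

text \<open>
This is \<open>inclusion_exclusion_error\<close> averaged over all trees.
\<close>

theorem prob_large_component_approx:
  assumes "k \<le> n" "n > 0" "1 / \<alpha> \<le> real J" "\<alpha> > 0"
  shows "\<bar>prob_large_component \<alpha> n k -
      (\<Sum>j=1..J. (-1) ^ (j - 1) * (\<Sum>s\<in>size_profiles \<alpha> n k j. expected_tuples n k {1..j} s))\<bar> \<le>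
    (1 + (\<Sum>j=1..J. real J ^ j)) *
      (\<Sum>a | a \<le> k \<and> \<alpha> * real n \<le> real a. expected_tuples n k {1..2::nat} (\<lambda>_. a))"
proof -
  let ?T = "labeled_trees n"
  let ?N = "real (card ?T)"
  let ?ind = "\<lambda>E. if large_components \<alpha> n k E = {} then 0 else 1 :: real"
  let ?ie = "\<lambda>E. \<Sum>j=1..J. (-1) ^ (j - 1) * (\<Sum>s\<in>size_profiles \<alpha> n k j. real (card (component_tuples k {1..j} s E)))"
  let ?tie = "\<lambda>E. \<Sum>a | a \<le> k \<and> \<alpha> * real n \<le> real a. real (card (component_tuples k {1..2::nat} (\<lambda>_. a) E))"
  let ?W = "1 + (\<Sum>j=1..J. real J ^ j)"
  have ne: "?T \<noteq> {}" using labeled_trees_nonempty[of n] assms by simp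
  then have N0: "?N > 0" using finite_labeled_trees by (simp add: card_gt_0_iff)
  have P: "prob_large_component \<alpha> n k = (\<Sum>E\<in>?T. ?ind E) / ?N"
  proof -
    have "prob_large_component \<alpha> n k = real (card (?T \<inter> {E. has_large_component \<alpha> n k E})) / ?N"
      unfolding prob_large_component_def using ne finite_labeled_trees by (simp add: measure_pmf_of_set)
    also have "?T \<inter> {E. has_large_component \<alpha> n k E} = ?T \<inter> - {E. large_components \<alpha> n k E = {}}"
      using has_large_component_iff[OF assms(1)] by auto
    also have "real (card (?T \<inter> - {E. large_components \<alpha> n k E = {}})) = (\<Sum>E\<in>?T. ?ind E)"
      by (simp add: sum.If_cases[OF finite_labeled_trees])
    finally show ?thesis .
  qed
  have S: "(\<Sum>j=1..J. (-1) ^ (j - 1) * (\<Sum>s\<in>size_profiles \<alpha> n k j. expected_tuples n k {1..j} s)) =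
      (\<Sum>E\<in>?T. ?ie E) / ?N"
    unfolding expected_tuples_def sum_divide_distrib[symmetric] times_divide_eq_right
    by (subst (1 2) sum.swap) (simp add: sum_distrib_left sum.swap[of _ ?T])
  have Q: "(\<Sum>a | a \<le> k \<and> \<alpha> * real n \<le> real a. expected_tuples n k {1..2::nat} (\<lambda>_. a)) = (\<Sum>E\<in>?T. ?tie E) / ?N"
    unfolding expected_tuples_def sum_divide_distrib[symmetric] by (subst sum.swap) simp
  have "\<bar>(\<Sum>E\<in>?T. ?ind E) - (\<Sum>E\<in>?T. ?ie E)\<bar> \<le> (\<Sum>E\<in>?T. ?W * ?tie E)"
    unfolding sum_subtractf[symmetric]
    by (rule order_trans[OF sum_abs], rule sum_mono, rule inclusion_exclusion_error[OF assms])
  also have "\<dots> = ?W * (\<Sum>E\<in>?T. ?tie E)" by (simp only: sum_distrib_left)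
  finally show ?thesis unfolding P S Q diff_divide_distrib[symmetric] abs_divide
    using N0 by (simp add: divide_right_mono)
qed

section \<open>The limiting probability\<close>

text \<open>
There are at most \<open>n\<close> common sizes, and each contributes \<open>O(n ^ (-2))\<close>.
\<close>

lemma tied_pairs_negligible:
  assumes c: "(\<lambda>n. real (n - k n) / sqrt n) \<longlonglongrightarrow> c" "c > 0" and kn: "eventually (\<lambda>n. k n < n) sequentially"
    and \<alpha>: "\<alpha> > 0"
  shows "(\<lambda>n. \<Sum>a | a \<le> k n \<and> \<alpha> * real n \<le> real a. expected_tuples n (k n) {1..2::nat} (\<lambda>_. a)) \<longlonglongrightarrow> 0"
proof -
  let ?e = "\<lambda>n a. expected_tuples n (k n) {1..2::nat} (\<lambda>_. a)"
  obtain C where C: "C \<ge> 0" "eventually (\<lambda>n. \<forall>s. (\<forall>i\<in>{1..2::nat}. \<alpha> * real n \<le> real (s i)) \<longrightarrow> sum s {1..2} \<le> k n \<longrightarrow>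
      \<bar>real n ^ card {1..2::nat} * expected_tuples n (k n) {1..2} s\<bar> \<le> C) sequentially"
    using scaled_expected_tuples_bounded[OF c kn \<alpha>, of "{1..2::nat}"] by auto
  have "eventually (\<lambda>n. norm (\<Sum>a | a \<le> k n \<and> \<alpha> * real n \<le> real a. ?e n a) \<le> C / real n) sequentially"
    using C(2) kn eventually_gt_at_top[of 0]
  proof eventually_elim
    case (elim n)
    have b: "\<bar>?e n a\<bar> \<le> C / real n ^ 2" if a: "\<alpha> * real n \<le> real a" for a
    proof (cases "sum (\<lambda>_. a) {1..2::nat} \<le> k n")
      case True
      have "\<bar>real n ^ card {1..2::nat} * ?e n a\<bar> \<le> C"
        by (rule elim(1)[rule_format, OF _ True]) (rule a)
      then have "real n ^ 2 * \<bar>?e n a\<bar> \<le> C" by (simp add: abs_mult del: One_nat_def)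
      then show ?thesis using elim(3) by (simp add: field_simps)
    next
      case False
      then have "?e n a = 0" by (intro expected_tuples_eq_0) auto
      then show ?thesis using C(1) by simp
    qed
    have "norm (\<Sum>a | a \<le> k n \<and> \<alpha> * real n \<le> real a. ?e n a) \<le>
        (\<Sum>a | a \<le> k n \<and> \<alpha> * real n \<le> real a. C / real n ^ 2)"
      unfolding real_norm_def by (rule order_trans[OF sum_abs], rule sum_mono) (use b in auto)
    also have "\<dots> = real (card {a. a \<le> k n \<and> \<alpha> * real n \<le> real a}) * (C / real n ^ 2)" by simp
    also have "\<dots> \<le> real n * (C / real n ^ 2)"
    proof (intro mult_right_mono of_nat_mono)
      have "card {a. a \<le> k n \<and> \<alpha> * real n \<le> real a} \<le> card {..k n}" by (intro card_mono) auto
      then show "card {a. a \<le> k n \<and> \<alpha> * real n \<le> real a} \<le> n" using elim(2) by simp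
    qed (use C(1) in simp)
    also have "\<dots> = C / real n" using elim(3) by (simp add: power2_eq_square)
    finally show ?case .
  qed
  moreover have "(\<lambda>n. C / real n) \<longlonglongrightarrow> 0" by real_asymp
  ultimately show ?thesis by (rule Lim_null_comparison)
qed

lemma integration_domain_empty:
  assumes "\<alpha> > 0" "j \<ge> 1" "real j * \<alpha> \<ge> 1"
  shows "integration_domain \<alpha> j = {}"
proof (rule ccontr)
  assume "integration_domain \<alpha> j \<noteq> {}"
  then obtain t where t1: "\<alpha> \<le> t 1" and inc: "\<forall>i\<in>{1..<j}. t i < t (i + 1)" and su: "(\<Sum>i=1..j. t i) < 1"
    by (auto simp: integration_domain_def)
  have "(\<Sum>i=1..j. \<alpha>) \<le> (\<Sum>i=1..j. t i)"
    using chain_le[OF inc] t1 by (intro sum_mono) (meson atLeastAtMost_iff order_trans)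
  then show False using su assms by simp
qed

theorem theorem14:
  fixes k :: "nat \<Rightarrow> nat" and c \<alpha> :: real
  assumes "c > 0" and "\<alpha> > 0"
    and "(\<lambda>n. real n - real (k n)) \<sim>[sequentially] (\<lambda>n. c * sqrt (real n))"
  shows "(\<lambda>n. prob_large_component \<alpha> n (k n)) \<longlonglongrightarrow>
    (\<Sum>\<^sub>\<infinity>j\<in>{1..}. (-1) ^ (j - 1) * c ^ j / (2 * pi) powr (real j / 2) *
       (LINT t : integration_domain \<alpha> j | PiM {1..j} (\<lambda>_. lborel :: real measure).
          (\<Prod>i=1..j. t i powr (-3/2)) * (1 - (\<Sum>i=1..j. t i)) powr (-3/2) *
          exp (- (c\<^sup>2 * (\<Sum>i=1..j. t i)) / (2 * (1 - (\<Sum>i=1..j. t i))))))"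
proof -
  let ?I = "\<lambda>j. LINT t : integration_domain \<alpha> j | PiM {1..j} (\<lambda>_. lborel :: real measure).
          (\<Prod>i=1..j. t i powr (-3/2)) * (1 - (\<Sum>i=1..j. t i)) powr (-3/2) *
          exp (- (c\<^sup>2 * (\<Sum>i=1..j. t i)) / (2 * (1 - (\<Sum>i=1..j. t i))))"
  let ?term = "\<lambda>j. (-1) ^ (j - 1) * c ^ j / (2 * pi) powr (real j / 2) * ?I j"
  let ?S = "\<lambda>n j. \<Sum>s\<in>size_profiles \<alpha> n (k n) j. expected_tuples n (k n) {1..j} s"
  let ?tie = "\<lambda>n. \<Sum>a | a \<le> k n \<and> \<alpha> * real n \<le> real a. expected_tuples n (k n) {1..2::nat} (\<lambda>_. a)"
  note c = \<open>c > 0\<close> and \<alpha> = \<open>\<alpha> > 0\<close>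
  have n0: "eventually (\<lambda>n::nat. n > 0) sequentially" by (rule eventually_gt_at_top)
  have ratio: "(\<lambda>n. (real n - real (k n)) / sqrt n) \<longlonglongrightarrow> c"
  proof -
    have "(\<lambda>n. if real n - real (k n) = 0 \<and> c * sqrt (real n) = 0 then 1
        else (real n - real (k n)) / (c * sqrt (real n))) \<longlonglongrightarrow> 1"
      using assms(3) by (simp add: asymp_equiv_def)
    then have "(\<lambda>n. c * (if real n - real (k n) = 0 \<and> c * sqrt (real n) = 0 then 1
        else (real n - real (k n)) / (c * sqrt (real n)))) \<longlonglongrightarrow> c * 1" by (intro tendsto_intros)
    moreover have "eventually (\<lambda>n. c * (if real n - real (k n) = 0 \<and> c * sqrt (real n) = 0 then 1
        else (real n - real (k n)) / (c * sqrt (real n))) = (real n - real (k n)) / sqrt n) sequentially"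
      using n0 by eventually_elim (use c in simp)
    ultimately show ?thesis by (simp add: Lim_transform_eventually)
  qed
  have kn: "eventually (\<lambda>n. k n < n) sequentially"
  proof -
    have "eventually (\<lambda>n. 0 < (real n - real (k n)) / sqrt n) sequentially"
      using ratio c by (rule order_tendstoD)
    then show ?thesis using n0 by eventually_elim (simp add: zero_less_divide_iff)
  qed
  have mc: "(\<lambda>n. real (n - k n) / sqrt n) \<longlonglongrightarrow> c"
    by (rule Lim_transform_eventually[OF ratio], rule eventually_mono[OF kn]) (simp add: of_nat_diff)
  \<comment> \<open>No tree has more than \<open>J\<close> large components, and all summands beyond \<open>J\<close> vanish.\<close>
  obtain J :: nat where J: "1 / \<alpha> \<le> real J" using real_arch_simple by blast
  have "(\<lambda>n. \<Sum>j=1..J. (-1) ^ (j - 1) * ?S n j) \<longlonglongrightarrow> (\<Sum>j=1..J. ?term j)"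
  proof (rule tendsto_sum)
    fix j assume "j \<in> {1..J}"
    then have j: "j \<ge> 1" by simp
    have "(\<lambda>n. (-1) ^ (j - 1) * ?S n j) \<longlonglongrightarrow> (-1) ^ (j - 1) * (c ^ j / (2 * pi) powr (real j / 2) * ?I j)"
      using sum_expected_tuples_tendsto[OF mc c kn \<alpha> j] unfolding limit_density_integral[OF \<alpha> j]
      by (intro tendsto_mult tendsto_const)
    then show "(\<lambda>n. (-1) ^ (j - 1) * ?S n j) \<longlonglongrightarrow> ?term j"
      by (simp only: times_divide_eq_right times_divide_eq_left mult.assoc)
  qed
  moreover have "(\<lambda>n. prob_large_component \<alpha> n (k n) - (\<Sum>j=1..J. (-1) ^ (j - 1) * ?S n j)) \<longlonglongrightarrow> 0"
  proof (rule Lim_null_comparison)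
    show "eventually (\<lambda>n. norm (prob_large_component \<alpha> n (k n) - (\<Sum>j=1..J. (-1) ^ (j - 1) * ?S n j)) \<le>
        (1 + (\<Sum>j=1..J. real J ^ j)) * ?tie n) sequentially"
      using kn n0
    proof eventually_elim
      case (elim n)
      show ?case unfolding real_norm_def
        by (rule prob_large_component_approx) (use elim J \<alpha> in auto)
    qed
    have "(\<lambda>n. (1 + (\<Sum>j=1..J. real J ^ j)) * ?tie n) \<longlonglongrightarrow> (1 + (\<Sum>j=1..J. real J ^ j)) * 0"
      by (intro tendsto_mult tendsto_const tied_pairs_negligible[OF mc c kn \<alpha>])
    then show "(\<lambda>n. (1 + (\<Sum>j=1..J. real J ^ j)) * ?tie n) \<longlonglongrightarrow> 0" by simp
  qed
  ultimately have "(\<lambda>n. (prob_large_component \<alpha> n (k n) - (\<Sum>j=1..J. (-1) ^ (j - 1) * ?S n j)) +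
      (\<Sum>j=1..J. (-1) ^ (j - 1) * ?S n j)) \<longlonglongrightarrow> 0 + (\<Sum>j=1..J. ?term j)"
    by (intro tendsto_add)
  then have "(\<lambda>n. prob_large_component \<alpha> n (k n)) \<longlonglongrightarrow> (\<Sum>j=1..J. ?term j)" by simp
  also have "(\<Sum>j=1..J. ?term j) = infsum ?term {1..J}" by (rule infsum_finite[symmetric]) simp
  also have "\<dots> = infsum ?term {1..}"
  proof (rule infsum_cong_neutral)
    fix j assume "j \<in> {1..} - {1..J}"
    then have j: "j \<ge> 1" "J < j" by auto
    have "1 \<le> real J * \<alpha>" using J \<alpha> by (simp add: field_simps)
    also have "\<dots> \<le> real j * \<alpha>" using j \<alpha> by (intro mult_right_mono) auto
    finally show "?term j = 0"
      using integration_domain_empty[OF \<alpha> j(1)] by (simp add: set_lebesgue_integral_def)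
  qed auto
  finally show ?thesis .
qed

end
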